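(* Let $k\ge 1$, and for $l=1,\ldots,k$ let $(M_l,g_l)$ be a Riemannian manifold and $f_l:M_l\to\mathbb{R}^{n_l}$ a smooth isometric immersion in the Euclidean space $\mathbb{R}^{n_l}$. Let $I\subset\mathbb{R}$ be an open interval and let $\rho,\eta_1,\ldots,\eta_k:I\to(0,\infty)$ be smooth functions. Let $M=I\times M_1\times\cdots\times M_k$ be endowed with the warped product metric $$g=\rho(t)^2\,dt^2+\eta_1(t)^2 g_1+\cdots+\eta_k(t)^2 g_k ,\qquad t\in I.$$ Set $n=n_1+\cdots+n_k$ and let $a\in\{0,\ldots,n\}$. Then, for all $c>0$, the manifold $(M,g)$ admits: (i) isometric immersions in $\mathbb{R}^{4n+1-2a}_{a}$, in $\mathbb{S}^{4n+1-2a}_{a}(c)$, and in $\mathbb{H}^{4n+1-a}_{a}(-c)$; (ii) isometric embeddings in $\mathbb{R}^{8n+1-6a}_{a}$, in $\mathbb{S}^{8n+3-6a}_{a}(c)$, and in $\mathbb{H}^{8n+1-5a}_{a}(-c)$, provided that each $f_l$ is an embedding.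
   Context: For integers $0\le a\le m$, the semi-Euclidean space $\mathbb{R}^m_a$ is $\mathbb{R}^m$ with the inner product $\langle\,,\rangle=-dx_1^2-\cdots-dx_a^2+dx_{a+1}^2+\cdots+dx_m^2$ (so $\mathbb{R}^m_0=\mathbb{R}^m$ is Euclidean space). For $c>0$ define the quadrics $$\mathbb{S}^m_a(c)=\{x\in\mathbb{R}^{m+1}_a : \langle x,x\rangle=1/c\},\qquad \mathbb{H}^m_a(-c)=\{x\in\mathbb{R}^{m+1}_{a+1} : \langle x,x\rangle=-1/c\},$$ with the semi-Riemannian metrics (with $a$ negative and $m-a$ positive directions) induced from the ambient semi-Euclidean space. An isometric immersion of a Riemannian manifold $(M,g)$ in a semi-Riemannian manifold $(N,h)$ is a (smooth) immersion $f:M\to N$ with $f^*h=g$. An embedding is an injective immersion which is a homeomorphism onto its image, the image carrying the topology induced from $N$; an isometric embedding is an isometric immersion that is an embedding. *)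

theory Defs
  imports "HOL-Analysis.Analysis"
begin

section \<open>Smooth functions\<close>

text \<open>
  Dimensions vary inside the statements, so \<open>\<real>\<^sup>d\<close> is the library space \<^term>\<open>Euclidean_space d\<close>:
  the sequences \<^typ>\<open>nat \<Rightarrow> real\<close> vanishing at all indices \<open>\<ge> d\<close>. Coordinates are numbered from 0.
  In \<open>Ck_on d r V f\<close> and \<open>smooth_on d V f\<close> the set \<open>V\<close> is meant to be open in \<^term>\<open>Euclidean_space d\<close>.
\<close>

definition partial_deriv :: "nat \<Rightarrow> ((nat \<Rightarrow> real) \<Rightarrow> real) \<Rightarrow> (nat \<Rightarrow> real) \<Rightarrow> real"
  where "partial_deriv i f x = deriv (\<lambda>t. f (x(i := t))) (x i)"

fun Ck_on :: "nat \<Rightarrow> nat \<Rightarrow> (nat \<Rightarrow> real) set \<Rightarrow> ((nat \<Rightarrow> real) \<Rightarrow> real) \<Rightarrow> bool" where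
  "Ck_on d 0 V f \<longleftrightarrow> continuous_on V f"
| "Ck_on d (Suc r) V f \<longleftrightarrow> continuous_on V f \<and>
     (\<forall>i<d. (\<forall>x\<in>V. (\<lambda>t. f (x(i := t))) differentiable (at (x i)))
            \<and> Ck_on d r V (partial_deriv i f))"

definition smooth_on :: "nat \<Rightarrow> (nat \<Rightarrow> real) set \<Rightarrow> ((nat \<Rightarrow> real) \<Rightarrow> real) \<Rightarrow> bool"
  where "smooth_on d V f \<longleftrightarrow> (\<forall>r. Ck_on d r V f)"

text \<open>Infinite differentiability of a function of one variable on an open set.\<close>

definition smooth_real_on :: "real set \<Rightarrow> (real \<Rightarrow> real) \<Rightarrow> bool"
  where "smooth_real_on I h \<longleftrightarrow> (\<forall>r. \<forall>t\<in>I. ((deriv ^^ r) h) differentiable (at t))"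


section \<open>Manifolds with a metric\<close>

text \<open>
  A manifold is given by a topological space and an atlas, written as an indexed family of charts:
  the chart with index \<open>\<alpha>\<close> is \<open>cmap M \<alpha>\<close> restricted to \<open>cdom M \<alpha>\<close>. A covariant 2-tensor field is given
  by its components in each chart: \<open>metric M \<alpha> p i j\<close> is \<open>g(\<partial>\<^sub>i, \<partial>\<^sub>j)\<close> at the point \<open>p\<close>, where
  \<open>\<partial>\<^sub>i\<close> are the coordinate vector fields of the chart \<open>\<alpha>\<close>.
\<close>

record ('a, 'i) metric_manifold =
  mdim :: nat
  mtop :: "'a topology"
  charts :: "'i set"
  cdom :: "'i \<Rightarrow> 'a set"
  cmap :: "'i \<Rightarrow> 'a \<Rightarrow> nat \<Rightarrow> real"
  metric :: "'i \<Rightarrow> 'a \<Rightarrow> nat \<Rightarrow> nat \<Rightarrow> real"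

definition cinv :: "('a, 'i) metric_manifold \<Rightarrow> 'i \<Rightarrow> (nat \<Rightarrow> real) \<Rightarrow> 'a"
  where "cinv M \<alpha> = inv_into (cdom M \<alpha>) (cmap M \<alpha>)"

definition local_rep ::
  "('a, 'i) metric_manifold \<Rightarrow> ('b, 'j) metric_manifold \<Rightarrow> ('a \<Rightarrow> 'b) \<Rightarrow> 'i \<Rightarrow> 'j
    \<Rightarrow> (nat \<Rightarrow> real) \<Rightarrow> nat \<Rightarrow> real"
  where "local_rep M N f \<alpha> \<beta> x = cmap N \<beta> (f (cinv M \<alpha> x))"

text \<open>\<open>jacobian M N f \<alpha> \<beta> p r i\<close> is the entry in row \<open>r\<close> and column \<open>i\<close>.\<close>

definition jacobian ::
  "('a, 'i) metric_manifold \<Rightarrow> ('b, 'j) metric_manifold \<Rightarrow> ('a \<Rightarrow> 'b) \<Rightarrow> 'i \<Rightarrow> 'j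
    \<Rightarrow> 'a \<Rightarrow> nat \<Rightarrow> nat \<Rightarrow> real"
  where "jacobian M N f \<alpha> \<beta> p r i =
           partial_deriv i (\<lambda>x. local_rep M N f \<alpha> \<beta> x r) (cmap M \<alpha> p)"

definition pullback_metric ::
  "('a, 'i) metric_manifold \<Rightarrow> ('b, 'j) metric_manifold \<Rightarrow> ('a \<Rightarrow> 'b) \<Rightarrow> 'i \<Rightarrow> 'j
    \<Rightarrow> 'a \<Rightarrow> nat \<Rightarrow> nat \<Rightarrow> real"
  where "pullback_metric M N f \<alpha> \<beta> p i j =
           (\<Sum>r<mdim N. \<Sum>s<mdim N.
              metric N \<beta> (f p) r s * jacobian M N f \<alpha> \<beta> p r i * jacobian M N f \<alpha> \<beta> p s j)"

definition smooth_manifold :: "('a, 'i) metric_manifold \<Rightarrow> bool"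
  where "smooth_manifold M \<longleftrightarrow>
     Hausdorff_space (mtop M) \<and> second_countable (mtop M) \<and>
     topspace (mtop M) = (\<Union>\<alpha>\<in>charts M. cdom M \<alpha>) \<and>
     (\<forall>\<alpha>\<in>charts M.
        openin (mtop M) (cdom M \<alpha>) \<and>
        openin (Euclidean_space (mdim M)) (cmap M \<alpha> ` cdom M \<alpha>) \<and>
        homeomorphic_map (subtopology (mtop M) (cdom M \<alpha>))
          (subtopology (Euclidean_space (mdim M)) (cmap M \<alpha> ` cdom M \<alpha>)) (cmap M \<alpha>)) \<and>
     (\<forall>\<alpha>\<in>charts M. \<forall>\<beta>\<in>charts M. \<forall>i<mdim M.
        smooth_on (mdim M) (cmap M \<alpha> ` (cdom M \<alpha> \<inter> cdom M \<beta>))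
          (\<lambda>x. local_rep M M id \<alpha> \<beta> x i))"

text \<open>
  The third condition is the transformation law of the components of a covariant 2-tensor under a
  change of charts.
\<close>

definition riemannian_manifold :: "('a, 'i) metric_manifold \<Rightarrow> bool"
  where "riemannian_manifold M \<longleftrightarrow>
     smooth_manifold M \<and>
     (\<forall>\<alpha>\<in>charts M. \<forall>i<mdim M. \<forall>j<mdim M.
        smooth_on (mdim M) (cmap M \<alpha> ` cdom M \<alpha>) (\<lambda>x. metric M \<alpha> (cinv M \<alpha> x) i j)) \<and>
     (\<forall>\<alpha>\<in>charts M. \<forall>\<beta>\<in>charts M. \<forall>p\<in>cdom M \<alpha> \<inter> cdom M \<beta>. \<forall>i<mdim M. \<forall>j<mdim M.
        metric M \<alpha> p i j = pullback_metric M M id \<alpha> \<beta> p i j) \<and>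
     (\<forall>\<alpha>\<in>charts M. \<forall>p\<in>cdom M \<alpha>.
        (\<forall>i<mdim M. \<forall>j<mdim M. metric M \<alpha> p i j = metric M \<alpha> p j i) \<and>
        (\<forall>v. (\<exists>i<mdim M. v i \<noteq> 0) \<longrightarrow>
             (\<Sum>i<mdim M. \<Sum>j<mdim M. metric M \<alpha> p i j * v i * v j) > 0))"


section \<open>Immersions and embeddings\<close>

definition smooth_map ::
  "('a, 'i) metric_manifold \<Rightarrow> ('b, 'j) metric_manifold \<Rightarrow> ('a \<Rightarrow> 'b) \<Rightarrow> bool"
  where "smooth_map M N f \<longleftrightarrow>
     continuous_map (mtop M) (mtop N) f \<and>
     (\<forall>\<alpha>\<in>charts M. \<forall>\<beta>\<in>charts N. \<forall>r<mdim N.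
        smooth_on (mdim M) (cmap M \<alpha> ` {p \<in> cdom M \<alpha>. f p \<in> cdom N \<beta>})
          (\<lambda>x. local_rep M N f \<alpha> \<beta> x r))"

definition immersion ::
  "('a, 'i) metric_manifold \<Rightarrow> ('b, 'j) metric_manifold \<Rightarrow> ('a \<Rightarrow> 'b) \<Rightarrow> bool"
  where "immersion M N f \<longleftrightarrow>
     smooth_map M N f \<and>
     (\<forall>\<alpha>\<in>charts M. \<forall>\<beta>\<in>charts N. \<forall>p\<in>cdom M \<alpha>. f p \<in> cdom N \<beta> \<longrightarrow>
        (\<forall>v. (\<forall>r<mdim N. (\<Sum>i<mdim M. jacobian M N f \<alpha> \<beta> p r i * v i) = 0)
             \<longrightarrow> (\<forall>i<mdim M. v i = 0)))"

definition isometric_immersion ::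
  "('a, 'i) metric_manifold \<Rightarrow> ('b, 'j) metric_manifold \<Rightarrow> ('a \<Rightarrow> 'b) \<Rightarrow> bool"
  where "isometric_immersion M N f \<longleftrightarrow>
     immersion M N f \<and>
     (\<forall>\<alpha>\<in>charts M. \<forall>\<beta>\<in>charts N. \<forall>p\<in>cdom M \<alpha>. f p \<in> cdom N \<beta> \<longrightarrow>
        (\<forall>i<mdim M. \<forall>j<mdim M. pullback_metric M N f \<alpha> \<beta> p i j = metric M \<alpha> p i j))"

text \<open>The library's \<^term>\<open>embedding_map\<close> says: injective and a homeomorphism onto the image.\<close>

definition embedding ::
  "('a, 'i) metric_manifold \<Rightarrow> ('b, 'j) metric_manifold \<Rightarrow> ('a \<Rightarrow> 'b) \<Rightarrow> bool"
  where "embedding M N f \<longleftrightarrow> immersion M N f \<and> embedding_map (mtop M) (mtop N) f"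

definition isometric_embedding ::
  "('a, 'i) metric_manifold \<Rightarrow> ('b, 'j) metric_manifold \<Rightarrow> ('a \<Rightarrow> 'b) \<Rightarrow> bool"
  where "isometric_embedding M N f \<longleftrightarrow> isometric_immersion M N f \<and> embedding M N f"


section \<open>Semi-Euclidean spaces and their quadrics\<close>

text \<open>The inner product of \<open>\<real>\<^sup>m\<^sub>a\<close> for \<open>a \<le> m\<close>; the first \<open>a\<close> coordinates are the negative ones.\<close>

definition semi_inner :: "nat \<Rightarrow> nat \<Rightarrow> (nat \<Rightarrow> real) \<Rightarrow> (nat \<Rightarrow> real) \<Rightarrow> real"
  where "semi_inner m a x y = - (\<Sum>i<a. x i * y i) + (\<Sum>i=a..<m. x i * y i)"

definition semi_euclidean :: "nat \<Rightarrow> nat \<Rightarrow> (nat \<Rightarrow> real, unit) metric_manifold"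
  where "semi_euclidean m a =
    \<lparr> mdim = m,
      mtop = Euclidean_space m,
      charts = {()},
      cdom = (\<lambda>_. topspace (Euclidean_space m)),
      cmap = (\<lambda>_ x. x),
      metric = (\<lambda>_ _ i j. semi_inner m a (\<lambda>r. if r = i then 1 else 0) (\<lambda>r. if r = j then 1 else 0)) \<rparr>"

definition quadric :: "nat \<Rightarrow> nat \<Rightarrow> real \<Rightarrow> (nat \<Rightarrow> real) set"
  where "quadric m b q = {x \<in> topspace (Euclidean_space (Suc m)). semi_inner (Suc m) b x x = q}"

definition drop_coord :: "nat \<Rightarrow> (nat \<Rightarrow> real) \<Rightarrow> nat \<Rightarrow> real"
  where "drop_coord j x = (\<lambda>i. if i < j then x i else x (Suc i))"

definition half_quadric :: "nat \<Rightarrow> nat \<Rightarrow> real \<Rightarrow> nat \<times> bool \<Rightarrow> (nat \<Rightarrow> real) set"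
  where "half_quadric m b q \<kappa> =
    {x \<in> quadric m b q. if snd \<kappa> then x (fst \<kappa>) > 0 else x (fst \<kappa>) < 0}"

definition coord_tangent ::
  "nat \<Rightarrow> nat \<Rightarrow> real \<Rightarrow> nat \<times> bool \<Rightarrow> (nat \<Rightarrow> real) \<Rightarrow> nat \<Rightarrow> nat \<Rightarrow> real"
  where "coord_tangent m b q \<kappa> p i = (\<lambda>s. partial_deriv i
           (\<lambda>y. inv_into (half_quadric m b q \<kappa>) (drop_coord (fst \<kappa>)) y s) (drop_coord (fst \<kappa>) p))"

text \<open>
  The hypersurface \<open>\<langle>x,x\<rangle> = q\<close> (with \<open>q \<noteq> 0\<close>) of \<open>\<real>\<^bsup>m+1\<^esup>\<^sub>b\<close>, with the induced topology, smooth structure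
  and metric. As usual for spheres, the atlas consists of the graph charts: the half where
  \<open>\<plusminus> x\<^sub>j > 0\<close> is projected along the \<open>j\<close>-th axis, where its equation can be solved for \<open>x\<^sub>j\<close>. The
  ambient vectors \<open>coord_tangent m b q \<kappa> p i\<close> are the coordinate vectors of such a chart (the
  partial derivatives of the inverse chart), and the metric is the restriction of the ambient inner
  product to them. Since \<open>q \<noteq> 0\<close>, some coordinate of each point is nonzero, and the charts cover.
\<close>

definition hyperquadric ::
  "nat \<Rightarrow> nat \<Rightarrow> real \<Rightarrow> (nat \<Rightarrow> real, nat \<times> bool) metric_manifold"
  where "hyperquadric m b q =
    \<lparr> mdim = m,
      mtop = subtopology (Euclidean_space (Suc m)) (quadric m b q),
      charts = {..m} \<times> UNIV,
      cdom = half_quadric m b q,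
      cmap = (\<lambda>\<kappa>. drop_coord (fst \<kappa>)),
      metric = (\<lambda>\<kappa> p i j.
        semi_inner (Suc m) b (coord_tangent m b q \<kappa> p i) (coord_tangent m b q \<kappa> p j)) \<rparr>"

definition pseudo_sphere :: "nat \<Rightarrow> nat \<Rightarrow> real \<Rightarrow> (nat \<Rightarrow> real, nat \<times> bool) metric_manifold"
  where "pseudo_sphere m a c = hyperquadric m a (1 / c)"

text \<open>\<open>pseudo_hyperbolic m a c\<close> is \<open>\<H>\<^sup>m\<^sub>a(-c)\<close>; the last argument is \<open>c\<close>, not \<open>-c\<close>.\<close>

definition pseudo_hyperbolic :: "nat \<Rightarrow> nat \<Rightarrow> real \<Rightarrow> (nat \<Rightarrow> real, nat \<times> bool) metric_manifold"
  where "pseudo_hyperbolic m a c = hyperquadric m (Suc a) (- (1 / c))"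


section \<open>Warped products\<close>

text \<open>
  The product \<open>I \<times> M\<^sub>1 \<times> \<dots> \<times> M\<^sub>k\<close> has points \<open>(t, p)\<close> with \<open>p \<in> (\<Pi>\<^sub>E l\<in>{1..k}. M\<^sub>l)\<close>. Its charts are the products
  of charts of the factors (and of the identity on \<open>I\<close>): coordinate 0 is \<open>t\<close>, and the coordinates of
  the \<open>l\<close>-th factor occupy the indices \<open>block_start M l, \<dots>, block_start M (Suc l) - 1\<close>.
\<close>

definition block_start :: "(nat \<Rightarrow> ('a, 'i) metric_manifold) \<Rightarrow> nat \<Rightarrow> nat"
  where "block_start M l = 1 + (\<Sum>l'\<in>{1..<l}. mdim (M l'))"

definition block :: "(nat \<Rightarrow> ('a, 'i) metric_manifold) \<Rightarrow> nat \<Rightarrow> nat set"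
  where "block M l = {block_start M l ..< block_start M l + mdim (M l)}"

definition warped_product ::
  "real set \<Rightarrow> (real \<Rightarrow> real) \<Rightarrow> nat \<Rightarrow> (nat \<Rightarrow> real \<Rightarrow> real) \<Rightarrow> (nat \<Rightarrow> ('a, 'i) metric_manifold)
    \<Rightarrow> (real \<times> (nat \<Rightarrow> 'a), nat \<Rightarrow> 'i) metric_manifold"
  where "warped_product I \<rho> k \<eta> M =
    \<lparr> mdim = 1 + (\<Sum>l=1..k. mdim (M l)),
      mtop = prod_topology (top_of_set I) (product_topology (\<lambda>l. mtop (M l)) {1..k}),
      charts = (\<Pi>\<^sub>E l\<in>{1..k}. charts (M l)),
      cdom = (\<lambda>\<alpha>. I \<times> (\<Pi>\<^sub>E l\<in>{1..k}. cdom (M l) (\<alpha> l))),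
      cmap = (\<lambda>\<alpha> (t, p) i.
        if i = 0 then t
        else \<Sum>l=1..k. if i \<in> block M l then cmap (M l) (\<alpha> l) (p l) (i - block_start M l) else 0),
      metric = (\<lambda>\<alpha> (t, p) i j.
        if i = 0 \<and> j = 0 then (\<rho> t)\<^sup>2
        else \<Sum>l=1..k. if i \<in> block M l \<and> j \<in> block M l
               then (\<eta> l t)\<^sup>2 * metric (M l) (\<alpha> l) (p l) (i - block_start M l) (j - block_start M l)
               else 0) \<rparr>"

end

theory Submission
  imports Defs
begin

text \<open>
  Since the \<open>f\<^sub>l\<close> are isometric, the map \<open>(t, p) \<mapsto> (t, f\<^sub>1(p\<^sub>1), \<dots>, f\<^sub>k(p\<^sub>k))\<close> is isometric into \<open>I \<times> \<real>\<^sup>n\<close> with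
  the metric \<open>\<rho>\<^sup>2 dt\<^sup>2 + \<Sum> \<eta>\<^sub>d\<^sup>2 dy\<^sub>d\<^sup>2\<close>, in which each of the \<open>n\<close> flat directions has the warping function of
  its factor. It therefore suffices to replace every flat direction by a model: a map of \<open>(t, y\<^sub>d)\<close> into
  a small semi-Euclidean space that induces \<open>\<eta>\<^sub>d\<^sup>2 dy\<^sub>d\<^sup>2 + P\<^sub>d(t) dt\<^sup>2\<close> and whose squared length depends on
  \<open>t\<close> only. The remainder \<open>(\<rho>\<^sup>2 - \<Sum> P\<^sub>d) dt\<^sup>2\<close> is supplied by a profile curve, a
  function of \<open>t\<close> alone (\<open>signed_isometry_coords\<close>).

  There are two kinds of models. Blanusa's model \<open>\<phi>\<^sub>b(t) \<sigma>(S\<^sub>b(t) y)\<close> for two values of \<open>b\<close> is positive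
  definite; \<open>\<sigma>\<close> is a unit speed curve in a unit sphere, and the frequencies \<open>S\<^sub>b\<close> are step functions so
  large that \<open>P\<close> and the squared length are below any given positive function (\<open>blanusa_amplitudes\<close>).
  A direction that may use a negative coordinate takes fewer coordinates: \<open>(\<eta> cosh y; \<eta> sinh y)\<close>, which
  gives \<open>P = -\<eta>'\<^sup>2 \<le> 0\<close>, or a curve in the light cone with \<open>P = 0\<close> and squared length 0. Using \<open>a\<close>
  directions of the second kind explains the dependence of the dimensions on \<open>a\<close>.

  In \<open>\<real>\<^sub>a\<close> the profile curve is a line. In a quadric it must also complete the squared length to
  \<open>\<plusminus>1/c\<close>. In \<open>\<S>\<close> it is \<open>r \<sigma>(\<theta>)\<close>, and its radial part is controlled by the Cauchy-Schwarz inequality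
  (\<open>pseudo_sphere_target\<close>). In \<open>\<H>\<close> it is \<open>(r cosh \<theta>; r sinh \<theta>)\<close>, and the light cone model keeps \<open>r\<^sup>2\<close>
  positive (\<open>pseudo_hyperbolic_target\<close>).

  For immersions \<open>\<sigma>\<close> is the circle in \<open>\<real>\<^sup>2\<close>. For embeddings it is an infinite spiral in the unit
  sphere of \<open>\<real>\<^sup>4\<close>, whose parameter depends continuously on the point (\<open>embedded_unit_sphere_curve\<close>). Then the
  parameter \<open>t\<close>, the flat coordinates \<open>y\<^sub>d\<close> and, if the \<open>f\<^sub>l\<close> are embeddings, the points \<open>p\<^sub>l\<close> can be recovered
  one after the other and continuously from the image (\<open>coords_recover\<close>,
  \<open>embedding_map_of_recovery\<close>).
\<close>

section \<open>Smooth functions of one variable\<close>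

text \<open>
  The derivatives are existential witnesses here, not iterated \<^const>\<open>deriv\<close>: a product or a composition
  then only has to exhibit one derivative at each order, and no equation between higher derivatives
  has to be transported along an open set.
\<close>

fun times_diff :: "nat \<Rightarrow> real set \<Rightarrow> (real \<Rightarrow> real) \<Rightarrow> bool" where
  "times_diff 0 U h \<longleftrightarrow> True"
| "times_diff (Suc r) U h \<longleftrightarrow>
     (\<exists>h'. (\<forall>t\<in>U. (h has_real_derivative h' t) (at t)) \<and> times_diff r U h')"

definition smooth1 :: "real set \<Rightarrow> (real \<Rightarrow> real) \<Rightarrow> bool"
  where "smooth1 U h \<longleftrightarrow> (\<forall>r. times_diff r U h)"

lemma times_diff_cong:
  assumes "open U" "\<And>t. t \<in> U \<Longrightarrow> g t = h t" "times_diff r U h"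
  shows "times_diff r U g"
proof (cases r)
  case (Suc s)
  then obtain h' where "\<forall>t\<in>U. (h has_real_derivative h' t) (at t)" "times_diff s U h'"
    using assms by auto
  moreover have "(g has_real_derivative D) (at t)" if "(h has_real_derivative D) (at t)" "t \<in> U" for t D
    using that assms(1,2) by (metis has_field_derivative_transform_within_open)
  ultimately show ?thesis using Suc by auto
qed simp

lemma times_diff_subset: "times_diff r U h \<Longrightarrow> V \<subseteq> U \<Longrightarrow> times_diff r V h"
proof (induction r arbitrary: h)
  case (Suc r)
  then obtain h' where "\<forall>t\<in>U. (h has_real_derivative h' t) (at t)" "times_diff r U h'"
    by auto
  with Suc have "\<forall>t\<in>V. (h has_real_derivative h' t) (at t)" "times_diff r V h'" by auto
  then show ?case by auto
qed simp

lemma times_diff_Suc: "times_diff (Suc r) U h \<Longrightarrow> times_diff r U h"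
proof (induction r arbitrary: h)
  case (Suc r)
  then show ?case by auto
qed simp

lemma times_diff_const: "times_diff r U (\<lambda>_. c)"
proof (induction r arbitrary: c)
  case (Suc r)
  have "\<forall>t\<in>U. ((\<lambda>_. c) has_real_derivative 0) (at t)" by auto
  with Suc show ?case by (metis times_diff.simps(2))
qed simp

lemma times_diff_ident: "times_diff r U (\<lambda>t. t)"
proof (cases r)
  case (Suc s)
  have "\<forall>t\<in>U. ((\<lambda>t. t) has_real_derivative 1) (at t)" by auto
  with Suc times_diff_const show ?thesis by (metis times_diff.simps(2))
qed simp

lemma times_diff_add: "times_diff r U g \<Longrightarrow> times_diff r U h \<Longrightarrow> times_diff r U (\<lambda>t. g t + h t)"
proof (induction r arbitrary: g h)
  case (Suc r)
  then obtain g' h' where "\<forall>t\<in>U. (g has_real_derivative g' t) (at t)" "times_diff r U g'"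
    "\<forall>t\<in>U. (h has_real_derivative h' t) (at t)" "times_diff r U h'"
    by auto
  then have "\<forall>t\<in>U. ((\<lambda>t. g t + h t) has_real_derivative g' t + h' t) (at t)"
    "times_diff r U (\<lambda>t. g' t + h' t)"
    using Suc.IH by (auto intro!: derivative_intros)
  then show ?case unfolding times_diff.simps by (intro exI[where x = "\<lambda>t. g' t + h' t"]) blast
qed simp

lemma times_diff_mult: "times_diff r U g \<Longrightarrow> times_diff r U h \<Longrightarrow> times_diff r U (\<lambda>t. g t * h t)"
proof (induction r arbitrary: g h)
  case (Suc r)
  then obtain g' h' where *: "\<forall>t\<in>U. (g has_real_derivative g' t) (at t)" "times_diff r U g'"
    "\<forall>t\<in>U. (h has_real_derivative h' t) (at t)" "times_diff r U h'"
    by auto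
  have "\<forall>t\<in>U. ((\<lambda>t. g t * h t) has_real_derivative g' t * h t + h' t * g t) (at t)"
    using * by (auto intro!: DERIV_mult)
  moreover have "times_diff r U (\<lambda>t. g' t * h t + h' t * g t)"
    using * times_diff_Suc[OF Suc.prems(1)] times_diff_Suc[OF Suc.prems(2)]
    by (intro times_diff_add Suc.IH)
  ultimately show ?case
    unfolding times_diff.simps
    by (intro exI[where x = "\<lambda>t. g' t * h t + h' t * g t"]) blast
qed simp

lemma times_diff_compose:
  "times_diff r V g \<Longrightarrow> times_diff r U h \<Longrightarrow> (\<And>t. t \<in> U \<Longrightarrow> h t \<in> V) \<Longrightarrow> times_diff r U (\<lambda>t. g (h t))"
proof (induction r arbitrary: g)
  case (Suc r)
  then obtain g' h' where *: "\<forall>t\<in>V. (g has_real_derivative g' t) (at t)" "times_diff r V g'"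
    "\<forall>t\<in>U. (h has_real_derivative h' t) (at t)" "times_diff r U h'"
    by auto
  have "\<forall>t\<in>U. ((\<lambda>t. g (h t)) has_real_derivative g' (h t) * h' t) (at t)"
    using * Suc.prems(3) DERIV_chain2 by blast
  moreover have "times_diff r U (\<lambda>t. g' (h t) * h' t)"
    using * times_diff_Suc[OF Suc.prems(2)] Suc.prems(3)
    by (intro times_diff_mult[OF Suc.IH]) 
  ultimately show ?case
    unfolding times_diff.simps
    by (intro exI[where x = "\<lambda>t. g' (h t) * h' t"]) blast
qed simp

lemma smooth1_subset: "smooth1 U h \<Longrightarrow> V \<subseteq> U \<Longrightarrow> smooth1 V h"
  unfolding smooth1_def using times_diff_subset[of _ U h V] by simp

lemma smooth1_compose:
  "smooth1 V g \<Longrightarrow> smooth1 U h \<Longrightarrow> (\<And>t. t \<in> U \<Longrightarrow> h t \<in> V) \<Longrightarrow> smooth1 U (\<lambda>t. g (h t))"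
  unfolding smooth1_def using times_diff_compose[of _ V g U h] by simp

lemma smooth1I:
  assumes "\<And>t. t \<in> U \<Longrightarrow> (h has_real_derivative h' t) (at t)" "smooth1 U h'"
  shows "smooth1 U h"
  unfolding smooth1_def
proof
  fix r show "times_diff r U h"
    using assms by (cases r) (auto simp: smooth1_def)
qed

lemma smooth1_DERIV: "smooth1 U h \<Longrightarrow> t \<in> U \<Longrightarrow> (h has_real_derivative deriv h t) (at t)"
  unfolding smooth1_def by (metis DERIV_imp_deriv times_diff.simps(2))

lemma smooth1_deriv:
  assumes "open U" "smooth1 U h"
  shows "smooth1 U (deriv h)"
  unfolding smooth1_def
proof
  fix r
  obtain h' where "\<forall>t\<in>U. (h has_real_derivative h' t) (at t)" "times_diff r U h'"
    using assms(2) unfolding smooth1_def by (metis times_diff.simps(2))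
  then show "times_diff r U (deriv h)"
    using times_diff_cong[OF assms(1), of "deriv h" h' r] by (metis DERIV_imp_deriv)
qed

lemma smooth1_isCont: "smooth1 U h \<Longrightarrow> t \<in> U \<Longrightarrow> isCont h t"
  using smooth1_DERIV DERIV_isCont by blast

lemma smooth1_continuous_on: "smooth1 U h \<Longrightarrow> continuous_on U h"
  using smooth1_isCont continuous_at_imp_continuous_on by blast

lemma smooth1_const [simp]: "smooth1 U (\<lambda>_. c)"
  and smooth1_ident [simp]: "smooth1 U (\<lambda>t. t)"
  and smooth1_add: "smooth1 U g \<Longrightarrow> smooth1 U h \<Longrightarrow> smooth1 U (\<lambda>t. g t + h t)"
  and smooth1_mult: "smooth1 U g \<Longrightarrow> smooth1 U h \<Longrightarrow> smooth1 U (\<lambda>t. g t * h t)"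
  by (auto simp: smooth1_def times_diff_const times_diff_ident times_diff_add times_diff_mult)

lemma smooth1_minus: "smooth1 U g \<Longrightarrow> smooth1 U (\<lambda>t. - g t)"
  using smooth1_mult[OF smooth1_const[of U "-1"], of g] by simp

lemma smooth1_diff: "smooth1 U g \<Longrightarrow> smooth1 U h \<Longrightarrow> smooth1 U (\<lambda>t. g t - h t)"
  using smooth1_add[OF _ smooth1_minus, of U g h] by simp

lemma smooth1_power: "smooth1 U g \<Longrightarrow> smooth1 U (\<lambda>t. g t ^ k)"
  by (induction k) (auto intro: smooth1_mult)

lemma smooth1_sum: "(\<And>i. i \<in> A \<Longrightarrow> smooth1 U (g i)) \<Longrightarrow> smooth1 U (\<lambda>t. \<Sum>i\<in>A. g i t)"
  by (induction A rule: infinite_finite_induct) (auto intro: smooth1_add)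

lemma smooth1_inverse_basic: "smooth1 {x. x \<noteq> 0} inverse"
proof -
  have "times_diff r {x. x \<noteq> 0} inverse" for r
  proof (induction r)
    case (Suc r)
    have "\<forall>t\<in>{x. x \<noteq> 0}. (inverse has_real_derivative (-1) * (inverse t * inverse t)) (at t)"
      by (auto intro!: derivative_eq_intros)
    moreover have "times_diff r {x. x \<noteq> 0} (\<lambda>t. (-1) * (inverse t * inverse t))"
      by (intro times_diff_mult times_diff_const Suc)
    ultimately show ?case
      unfolding times_diff.simps by (intro exI[where x = "\<lambda>t. (-1) * (inverse t * inverse t)"]) blast
  qed simp
  then show ?thesis by (simp add: smooth1_def)
qed

lemma smooth1_inverse: "smooth1 U g \<Longrightarrow> (\<And>t. t \<in> U \<Longrightarrow> g t \<noteq> 0) \<Longrightarrow> smooth1 U (\<lambda>t. inverse (g t))"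
  by (rule smooth1_compose[where h = g, OF smooth1_inverse_basic]) auto

lemma smooth1_divide:
  "smooth1 U g \<Longrightarrow> smooth1 U h \<Longrightarrow> (\<And>t. t \<in> U \<Longrightarrow> h t \<noteq> 0) \<Longrightarrow> smooth1 U (\<lambda>t. g t / h t)"
  unfolding divide_inverse by (intro smooth1_mult smooth1_inverse)

lemma smooth1_sqrt_basic: "smooth1 {0<..} sqrt"
proof -
  have "times_diff r {0<..} sqrt" for r
  proof (induction r)
    case (Suc r)
    have "\<forall>t\<in>{0<..}. (sqrt has_real_derivative (1/2) * inverse (sqrt t)) (at t)"
      using DERIV_real_sqrt by auto
    moreover have "times_diff r {0<..} (\<lambda>t. (1/2) * inverse (sqrt t))"
      using smooth1_inverse_basic
      by (intro times_diff_mult[OF times_diff_const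
            times_diff_compose[where g = inverse and h = sqrt and V = "{x. x \<noteq> 0}", OF _ Suc]])
        (auto simp: smooth1_def)
    ultimately show ?case
      unfolding times_diff.simps by (intro exI[where x = "\<lambda>t. (1/2) * inverse (sqrt t)"]) blast
  qed simp
  then show ?thesis by (simp add: smooth1_def)
qed

lemma smooth1_sqrt: "smooth1 U g \<Longrightarrow> (\<And>t. t \<in> U \<Longrightarrow> g t > 0) \<Longrightarrow> smooth1 U (\<lambda>t. sqrt (g t))"
  by (rule smooth1_compose[where h = g, OF smooth1_sqrt_basic]) auto

lemma smooth1_exp_basic: "smooth1 UNIV (exp :: real \<Rightarrow> real)"
proof -
  have "times_diff r UNIV exp" for r
    by (induction r) (auto intro!: exI[where x = exp] derivative_eq_intros)
  then show ?thesis by (simp add: smooth1_def)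
qed

lemma smooth1_exp: "smooth1 U g \<Longrightarrow> smooth1 U (\<lambda>t. exp (g t))"
  by (rule smooth1_compose[where h = g, OF smooth1_exp_basic]) auto

lemma smooth1_sin_cos_basic: "smooth1 UNIV (sin :: real \<Rightarrow> real)" "smooth1 UNIV (cos :: real \<Rightarrow> real)"
proof -
  have "times_diff r UNIV (sin :: real \<Rightarrow> real) \<and> times_diff r UNIV (cos :: real \<Rightarrow> real)" for r
  proof (induction r)
    case (Suc r)
    then have "times_diff r UNIV (\<lambda>t::real. (-1) * sin t)"
      by (intro times_diff_mult times_diff_const) auto
    moreover have "\<forall>t. ((cos :: real \<Rightarrow> real) has_real_derivative (-1) * sin t) (at t)"
      using DERIV_cos by auto
    ultimately have "times_diff (Suc r) UNIV (cos :: real \<Rightarrow> real)"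
      unfolding times_diff.simps by (intro exI[where x = "\<lambda>t. (-1) * sin t"]) blast
    moreover have "times_diff (Suc r) UNIV (sin :: real \<Rightarrow> real)"
      unfolding times_diff.simps using Suc DERIV_sin by blast
    ultimately show ?case by blast
  qed simp
  then show "smooth1 UNIV (sin :: real \<Rightarrow> real)" "smooth1 UNIV (cos :: real \<Rightarrow> real)"
    by (auto simp: smooth1_def)
qed

lemma smooth1_sin: "smooth1 U g \<Longrightarrow> smooth1 U (\<lambda>t. sin (g t))"
  and smooth1_cos: "smooth1 U g \<Longrightarrow> smooth1 U (\<lambda>t. cos (g t))"
  by (rule smooth1_compose[where h = g, OF smooth1_sin_cos_basic(1)]; simp)
    (rule smooth1_compose[where h = g, OF smooth1_sin_cos_basic(2)]; simp)

lemma smooth1_sinh: "smooth1 U g \<Longrightarrow> smooth1 U (\<lambda>t. sinh (g t))"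
  and smooth1_cosh: "smooth1 U g \<Longrightarrow> smooth1 U (\<lambda>t. cosh (g t))"
  unfolding sinh_field_def cosh_field_def
  by (intro smooth1_divide smooth1_add smooth1_diff smooth1_exp smooth1_minus; simp)+

lemmas smooth1_intros =
  smooth1_const smooth1_ident smooth1_add smooth1_mult smooth1_minus smooth1_diff smooth1_power
  smooth1_sum smooth1_inverse smooth1_divide smooth1_sqrt smooth1_exp smooth1_sin smooth1_cos
  smooth1_sinh smooth1_cosh

lemma smooth_real_on_imp_smooth1:
  assumes "smooth_real_on U h"
  shows "smooth1 U h"
proof -
  have "times_diff r U ((deriv ^^ s) h)" for r s
  proof (induction r arbitrary: s)
    case (Suc r)
    have "\<forall>t\<in>U. ((deriv ^^ s) h has_real_derivative (deriv ^^ Suc s) h t) (at t)"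
      using assms unfolding smooth_real_on_def
      by (auto simp: DERIV_deriv_iff_real_differentiable)
    with Suc show ?case by (metis times_diff.simps(2))
  qed simp
  from this[of _ 0] show ?thesis by (simp add: smooth1_def)
qed

text \<open>
  On an open interval that may be unbounded no single compact interval carries a primitive, so the
  integral is taken from a fixed base point and differentiated inside a compact interval around the
  base point and the point considered.
\<close>

lemma smooth1_antiderivative:
  assumes U: "open U" "is_interval U" and g: "smooth1 U g"
  shows "\<exists>h. smooth1 U h \<and> (\<forall>t\<in>U. (h has_real_derivative g t) (at t))"
proof (cases "U = {}")
  case False
  then obtain c where c: "c \<in> U" by blast
  define h where "h t = (if c \<le> t then integral {c..t} g else - integral {t..c} g)" for t
  have D: "(h has_real_derivative g t) (at t)" if t: "t \<in> U" for t
  proof -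
    obtain e1 where e1: "e1 > 0" "cball c e1 \<subseteq> U" using U(1) c open_contains_cball by blast
    obtain e2 where e2: "e2 > 0" "cball t e2 \<subseteq> U" using U(1) t open_contains_cball by blast
    define a where "a = min (c - e1) (t - e2)"
    define b where "b = max (c + e1) (t + e2)"
    have "a \<in> U" "b \<in> U"
      using e1 e2 by (auto simp: a_def b_def min_def max_def subset_iff dist_real_def)
    then have ab: "{a..b} \<subseteq> U"
      using U(2) mem_is_interval_1_I[of U a b] by auto
    have cont: "continuous_on {a..b} g"
      using smooth1_continuous_on[OF g] ab continuous_on_subset by blast
    have lt: "a < t" "t < b" "a < c" "c < b" using e1 e2 by (auto simp: a_def b_def)
    have eq: "h x = integral {a..x} g - integral {a..c} g" if "x \<in> {a<..<b}" for x
    proof -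
      have int: "g integrable_on {a..y}" if "y \<le> b" for y
        using continuous_on_subset[OF cont, of "{a..y}"] that by (auto intro: integrable_continuous_interval)
      show ?thesis
        using Henstock_Kurzweil_Integration.integral_combine[OF _ _ int, of c x]
          Henstock_Kurzweil_Integration.integral_combine[OF _ _ int, of x c] that lt
        by (auto simp: h_def)
    qed
    have "((\<lambda>x. integral {a..x} g) has_real_derivative g t) (at t within {a..b})"
      using cont lt by (intro integral_has_real_derivative) auto
    then have "((\<lambda>x. integral {a..x} g) has_real_derivative g t) (at t)"
      using lt by (simp add: at_within_Icc_at)
    then have "((\<lambda>x. integral {a..x} g - integral {a..c} g) has_real_derivative g t) (at t)"
      by (auto intro!: derivative_eq_intros)
    then show ?thesis
      by (rule has_field_derivative_transform_within_open[where S = "{a<..<b}"]) (use lt eq in auto)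
  qed
  then show ?thesis using smooth1I[OF D g] D by blast
qed (auto intro!: exI[of _ "\<lambda>_. 0"])

lemma DERIV_pos_imp_strict_mono_on:
  fixes h :: "real \<Rightarrow> real"
  assumes "is_interval U" "\<And>t. t \<in> U \<Longrightarrow> (h has_real_derivative g t) (at t)"
    "\<And>t. t \<in> U \<Longrightarrow> g t > 0"
  shows "strict_mono_on U h"
proof (rule strict_mono_onI)
  fix r s assume rs: "r \<in> U" "s \<in> U" "r < s"
  then have sub: "{r..s} \<subseteq> U" using assms(1) mem_is_interval_1_I[of U r s] by auto
  show "h r < h s"
  proof (rule DERIV_pos_imp_increasing[OF rs(3)])
    fix x assume "r \<le> x" "x \<le> s"
    then have "x \<in> U" using sub by auto
    then show "\<exists>y. DERIV h x :> y \<and> y > 0" using assms(2,3) by blast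
  qed
qed

section \<open>A smooth function vanishing on a half line\<close>

text \<open>
  The functions \<open>x\<^sup>-\<^sup>j e\<^sup>-\<^sup>1\<^sup>/\<^sup>x\<close> for \<open>x > 0\<close>, extended by 0. The powers are there only to make the family
  closed under differentiation; \<open>flat 0\<close> is the function that is used.
\<close>

definition flat :: "nat \<Rightarrow> real \<Rightarrow> real"
  where "flat j x = (if x > 0 then inverse x ^ j * exp (- inverse x) else 0)"

lemma flat_tendsto_0: "(flat j \<longlongrightarrow> 0) (at 0)"
proof -
  have R: "((\<lambda>x. inverse x ^ j * exp (- inverse x)) \<longlongrightarrow> (0::real)) (at_right 0)"
  proof -
    have "((\<lambda>y::real. y ^ j / exp y) \<longlongrightarrow> 0) at_top" by (rule tendsto_power_div_exp_0)
    then have "((\<lambda>x::real. inverse x ^ j / exp (inverse x)) \<longlongrightarrow> 0) (at_right 0)"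
      by (rule filterlim_compose) (rule filterlim_inverse_at_top_right)
    then show ?thesis by (simp add: exp_minus divide_inverse)
  qed
  have "(flat j \<longlongrightarrow> 0) (at_right 0)"
    by (rule Lim_transform_eventually[OF R]) (auto simp: flat_def eventually_at_filter)
  moreover have "(flat j \<longlongrightarrow> 0) (at_left 0)"
    by (rule Lim_transform_eventually[of "\<lambda>_. 0"]) (auto simp: flat_def eventually_at_filter)
  ultimately show ?thesis by (rule filterlim_split_at[rotated])
qed

lemma flat_DERIV: "(flat j has_real_derivative flat (j + 2) x - j * flat (j + 1) x) (at x)"
proof -
  consider "x > 0" | "x < 0" | "x = 0" by linarith
  then show ?thesis
  proof cases
    case 1
    define z where "z = inverse x"
    have inv: "(inverse has_real_derivative - (z * z)) (at x)"
      using 1 by (auto intro!: derivative_eq_intros simp: z_def)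
    have "((\<lambda>x. inverse x ^ j * exp (- inverse x)) has_real_derivative
        real j * (- (z * z) * z ^ (j - 1)) * exp (- z) + exp (- z) * (z * z) * z ^ j) (at x)"
      using DERIV_mult[OF DERIV_power[OF inv, of j] DERIV_chain2[OF DERIV_exp DERIV_minus[OF inv]]]
      by (simp add: z_def)
    moreover have "real j * (- (z * z) * z ^ (j - 1)) * exp (- z) + exp (- z) * (z * z) * z ^ j
        = flat (j + 2) x - j * flat (j + 1) x"
      using 1 by (cases j) (simp_all add: flat_def algebra_simps flip: z_def)
    ultimately have "((\<lambda>x. inverse x ^ j * exp (- inverse x)) has_real_derivative
        flat (j + 2) x - j * flat (j + 1) x) (at x)"
      by simp
    then show ?thesis
      by (rule has_field_derivative_transform_within_open[where S = "{0<..}"]) (use 1 in \<open>auto simp: flat_def\<close>)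
  next
    case 2
    have "((\<lambda>x. 0) has_real_derivative flat (j + 2) x - j * flat (j + 1) x) (at x)"
      using 2 by (auto simp: flat_def)
    then show ?thesis
      by (rule has_field_derivative_transform_within_open[where S = "{..<0}"]) (use 2 in \<open>auto simp: flat_def\<close>)
  next
    case 3
    \<comment> \<open>At 0 the difference quotient is again a member of the family, so it tends to 0.\<close>
    have "(flat j y - flat j 0) / (y - 0) = flat (Suc j) y" for y
      by (auto simp: flat_def field_simps)
    then have "(flat j has_real_derivative 0) (at 0)"
      using flat_tendsto_0[of "Suc j"] by (simp add: has_field_derivative_iff)
    then show ?thesis using 3 by (simp add: flat_def)
  qed
qed

lemma smooth1_flat: "smooth1 UNIV (flat j)"
proof -
  have "times_diff r UNIV (flat j)" for r
  proof (induction r arbitrary: j)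
    case (Suc r)
    have "times_diff r UNIV (\<lambda>x. flat (j + 2) x + (- real j) * flat (j + 1) x)"
      by (intro times_diff_add times_diff_mult times_diff_const Suc)
    then show ?case
      using flat_DERIV[of j]
      by (auto intro!: exI[where x = "\<lambda>x. flat (j + 2) x + (- real j) * flat (j + 1) x"])
  qed simp
  then show ?thesis by (simp add: smooth1_def)
qed

section \<open>Smooth functions of several variables\<close>

lemma Euclidean_space_eq_top_of_set: "Euclidean_space d = top_of_set {x. \<forall>i\<ge>d. x i = 0}"
  by (simp add: Euclidean_space_def euclidean_product_topology)

lemma openin_Euclidean_space_eventually:
  assumes "openin (Euclidean_space d) V" "x \<in> V" "i < d"
  shows "\<forall>\<^sub>F s in nhds (x i). x(i := s) \<in> V"
proof -
  obtain T where T: "open T" "V = {x. \<forall>i\<ge>d. x i = 0} \<inter> T"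
    using assms(1) by (auto simp: Euclidean_space_eq_top_of_set openin_open)
  have "continuous_on UNIV (\<lambda>s. x(i := s))"
  proof (rule continuous_on_coordinatewise_then_product)
    show "continuous_on UNIV (\<lambda>s. (x(i := s)) j)" for j
      by (cases "j = i") (simp_all add: continuous_on_id)
  qed
  then have "open ((\<lambda>s. x(i := s)) -` T)" using T(1) by (simp add: open_vimage)
  moreover have "x i \<in> (\<lambda>s. x(i := s)) -` T" using assms(2) T(2) by simp
  ultimately have "\<forall>\<^sub>F s in nhds (x i). s \<in> (\<lambda>s. x(i := s)) -` T"
    by (rule eventually_nhds_in_open)
  then show ?thesis
    by eventually_elim (use assms T(2) in auto)
qed

text \<open>
  \<^const>\<open>partial_deriv\<close> says nothing about existence. The relational form carries existence and value
  together and is what the rules of differentiation are about.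
\<close>

definition has_partial :: "nat \<Rightarrow> ((nat \<Rightarrow> real) \<Rightarrow> real) \<Rightarrow> real \<Rightarrow> (nat \<Rightarrow> real) \<Rightarrow> bool"
  where "has_partial i f D x \<longleftrightarrow> ((\<lambda>s. f (x(i := s))) has_real_derivative D) (at (x i))"

lemma has_partial_imp_partial_deriv: "has_partial i f D x \<Longrightarrow> partial_deriv i f x = D"
  unfolding has_partial_def partial_deriv_def by (rule DERIV_imp_deriv)

lemma has_partial_cong:
  assumes "openin (Euclidean_space d) V" "x \<in> V" "i < d" "\<And>y. y \<in> V \<Longrightarrow> f y = g y"
  shows "has_partial i f D x \<longleftrightarrow> has_partial i g D x"
  unfolding has_partial_def
  by (rule DERIV_cong_ev[OF refl _ refl])
    (use openin_Euclidean_space_eventually[OF assms(1-3)] in eventually_elim, simp add: assms(4))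

lemma partial_deriv_cong:
  assumes "openin (Euclidean_space d) V" "x \<in> V" "i < d" "\<And>y. y \<in> V \<Longrightarrow> f y = g y"
  shows "partial_deriv i f x = partial_deriv i g x"
  unfolding partial_deriv_def
  by (rule deriv_cong_ev[OF _ refl])
    (use openin_Euclidean_space_eventually[OF assms(1-3)] in eventually_elim, simp add: assms(4))

lemma Ck_on_imp_has_partial:
  "Ck_on d (Suc r) V f \<Longrightarrow> x \<in> V \<Longrightarrow> i < d \<Longrightarrow> has_partial i f (partial_deriv i f x) x"
  by (auto simp: has_partial_def partial_deriv_def DERIV_deriv_iff_real_differentiable)

lemma Ck_on_continuous: "Ck_on d r V f \<Longrightarrow> continuous_on V f"
  by (cases r) auto

lemma Ck_on_cong:
  assumes "openin (Euclidean_space d) V"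
  shows "(\<And>x. x \<in> V \<Longrightarrow> f x = g x) \<Longrightarrow> Ck_on d r V f \<Longrightarrow> Ck_on d r V g"
proof (induction r arbitrary: f g)
  case 0
  then show ?case by (simp cong: continuous_on_cong)
next
  case (Suc r)
  have "continuous_on V g"
    using Suc.prems by (simp cong: continuous_on_cong)
  moreover have "(\<lambda>s. g (x(i := s))) differentiable at (x i)" if "x \<in> V" "i < d" for x i
    using has_partial_cong[OF assms that, of f g "partial_deriv i f x"] Suc.prems
      Ck_on_imp_has_partial[OF Suc.prems(2) that]
    by (auto simp: has_partial_def real_differentiable_def)
  moreover have "Ck_on d r V (partial_deriv i g)" if "i < d" for i
  proof (rule Suc.IH)
    show "partial_deriv i f x = partial_deriv i g x" if "x \<in> V" for x
      using partial_deriv_cong[OF assms that \<open>i < d\<close>] Suc.prems(1) by blast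
    show "Ck_on d r V (partial_deriv i f)" using Suc.prems(2) that by simp
  qed
  ultimately show ?case by simp
qed

lemma Ck_on_SucI:
  assumes "openin (Euclidean_space d) V" "continuous_on V f"
    "\<And>i x. i < d \<Longrightarrow> x \<in> V \<Longrightarrow> has_partial i f (f' i x) x" "\<And>i. i < d \<Longrightarrow> Ck_on d r V (f' i)"
  shows "Ck_on d (Suc r) V f"
proof -
  have "Ck_on d r V (partial_deriv i f)" if "i < d" for i
    using Ck_on_cong[OF assms(1) _ assms(4)[OF that], of "partial_deriv i f"]
      has_partial_imp_partial_deriv[OF assms(3)[OF that]] by metis
  moreover have "(\<lambda>s. f (x(i := s))) differentiable at (x i)" if "x \<in> V" "i < d" for x i
    using assms(3)[OF that(2,1)] by (auto simp: has_partial_def real_differentiable_def)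
  ultimately show ?thesis using assms(2) by simp
qed

lemma Ck_on_subset: "Ck_on d r V f \<Longrightarrow> W \<subseteq> V \<Longrightarrow> Ck_on d r W f"
proof (induction r arbitrary: f)
  case 0
  then show ?case using continuous_on_subset by auto
next
  case (Suc r)
  then show ?case using continuous_on_subset[of V f W] by (simp add: subset_iff)
qed

lemma Ck_on_Suc: "Ck_on d (Suc r) V f \<Longrightarrow> Ck_on d r V f"
proof (induction r arbitrary: f)
  case (Suc r)
  have "Ck_on d r V (partial_deriv i f)" if "i < d" for i
    using Suc.prems that by (intro Suc.IH) simp
  with Suc.prems show ?case by simp
qed simp

text \<open>
  Locality is essential below: the coordinate functions of the immersions are products of functions
  of one variable only near each point.
\<close>

lemma Ck_on_local:
  assumes "\<And>x. x \<in> V \<Longrightarrow> \<exists>W. openin (top_of_set V) W \<and> x \<in> W \<and> Ck_on d r W f"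
  shows "Ck_on d r V f"
  using assms
proof (induction r arbitrary: f)
  case 0
  have "continuous (at x within V) f" if "x \<in> V" for x
  proof -
    obtain W where W: "openin (top_of_set V) W" "x \<in> W" "continuous_on W f"
      using 0[OF \<open>x \<in> V\<close>] unfolding Ck_on.simps by blast
    then obtain T where T: "open T" "W = V \<inter> T" by (auto simp: openin_open)
    then have "at x within W = at x within V"
      using W(2) by (intro at_within_nhd[of x T]) auto
    then show ?thesis using W by (metis continuous_on_eq_continuous_within)
  qed
  then show ?case by (simp add: continuous_on_eq_continuous_within)
next
  case (Suc r)
  have "Ck_on d r V f"
  proof (rule Suc.IH)
    fix x assume "x \<in> V"
    then obtain W where "openin (top_of_set V) W" "x \<in> W" "Ck_on d (Suc r) W f"
      using Suc.prems by blast
    then show "\<exists>W. openin (top_of_set V) W \<and> x \<in> W \<and> Ck_on d r W f"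
      using Ck_on_Suc[of d r W f] by blast
  qed
  then have "continuous_on V f" by (rule Ck_on_continuous)
  moreover have "Ck_on d r V (partial_deriv i f)" if "i < d" for i
    using Suc.prems that by (intro Suc.IH) fastforce
  moreover have "(\<lambda>s. f (x(i := s))) differentiable at (x i)" if "x \<in> V" "i < d" for x i
    using Suc.prems[OF that(1)] that(2) by auto
  ultimately show ?case by simp
qed

lemma Ck_on_const: "Ck_on d r V (\<lambda>_. c)"
proof (induction r arbitrary: c)
  case (Suc r)
  have "partial_deriv i (\<lambda>_. c) = (\<lambda>_. 0)" for i by (simp add: partial_deriv_def fun_eq_iff)
  with Suc show ?case by simp
qed simp

lemma has_partial_coordinate: "has_partial i (\<lambda>x. x j) (if i = j then 1 else 0) x"
  by (auto simp: has_partial_def)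

lemma Ck_on_coordinate:
  assumes "openin (Euclidean_space d) V"
  shows "Ck_on d r V (\<lambda>x. x j)"
proof -
  have c: "continuous_on V (\<lambda>x :: nat \<Rightarrow> real. x j)"
    by (rule continuous_on_subset[OF continuous_on_product_coordinates]) simp
  show ?thesis
  proof (cases r)
    case 0
    then show ?thesis using c by simp
  next
    case (Suc s)
    show ?thesis unfolding Suc
      by (rule Ck_on_SucI[OF assms c has_partial_coordinate]) (simp add: Ck_on_const)
  qed
qed

lemma has_partial_mult:
  "has_partial i f D x \<Longrightarrow> has_partial i g E x \<Longrightarrow> has_partial i (\<lambda>x. f x * g x) (D * g x + E * f x) x"
  unfolding has_partial_def using DERIV_mult by fastforce

lemma has_partial_compose:
  "has_partial i f D x \<Longrightarrow> (h has_real_derivative E) (at (f x)) \<Longrightarrow> has_partial i (\<lambda>x. h (f x)) (E * D) x"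
  unfolding has_partial_def using DERIV_chain2[of h E "\<lambda>s. f (x(i := s))" "x i"] by simp

lemma Ck_on_add:
  assumes V: "openin (Euclidean_space d) V"
  shows "Ck_on d r V f \<Longrightarrow> Ck_on d r V g \<Longrightarrow> Ck_on d r V (\<lambda>x. f x + g x)"
proof (induction r arbitrary: f g)
  case 0
  then show ?case by (auto intro: continuous_intros)
next
  case (Suc r)
  show ?case
  proof (rule Ck_on_SucI[OF V])
    show "continuous_on V (\<lambda>x. f x + g x)" using Suc.prems by (auto intro: continuous_intros)
    show "has_partial i (\<lambda>x. f x + g x) (partial_deriv i f x + partial_deriv i g x) x"
      if "i < d" "x \<in> V" for i x
      using Suc.prems[THEN Ck_on_imp_has_partial, OF that(2,1)]
      by (auto simp: has_partial_def intro: DERIV_add)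
    show "Ck_on d r V (\<lambda>x. partial_deriv i f x + partial_deriv i g x)" if "i < d" for i
      using Suc that by auto
  qed
qed

lemma Ck_on_mult:
  assumes V: "openin (Euclidean_space d) V"
  shows "Ck_on d r V f \<Longrightarrow> Ck_on d r V g \<Longrightarrow> Ck_on d r V (\<lambda>x. f x * g x)"
proof (induction r arbitrary: f g)
  case 0
  then show ?case by (auto intro: continuous_intros)
next
  case (Suc r)
  show ?case
  proof (rule Ck_on_SucI[OF V])
    show "continuous_on V (\<lambda>x. f x * g x)" using Suc.prems by (auto intro: continuous_intros)
    show "has_partial i (\<lambda>x. f x * g x) (partial_deriv i f x * g x + partial_deriv i g x * f x) x"
      if "i < d" "x \<in> V" for i x
      using Suc.prems[THEN Ck_on_imp_has_partial, OF that(2,1)] by (rule has_partial_mult)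
    show "Ck_on d r V (\<lambda>x. partial_deriv i f x * g x + partial_deriv i g x * f x)" if "i < d" for i
      using Suc.prems[THEN Ck_on_Suc] Suc.prems that by (intro Ck_on_add[OF V] Suc.IH) simp_all
  qed
qed

text \<open>
  Only outer functions of one variable occur, so the full chain rule of several variables is avoided.
\<close>

lemma Ck_on_compose:
  assumes V: "openin (Euclidean_space d) V" and f: "\<And>r. Ck_on d r V f" "\<And>x. x \<in> V \<Longrightarrow> f x \<in> U"
    and U: "open U"
  shows "smooth1 U h \<Longrightarrow> Ck_on d r V (\<lambda>x. h (f x))"
proof (induction r arbitrary: h)
  case 0
  have "continuous_on V (\<lambda>x. h (f x))"
    using continuous_on_compose2[OF smooth1_continuous_on[OF 0] Ck_on_continuous[OF f(1)]] f(2)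
    by blast
  then show ?case by simp
next
  case (Suc r)
  show ?case
  proof (rule Ck_on_SucI[OF V])
    show "continuous_on V (\<lambda>x. h (f x))"
      using continuous_on_compose2[OF smooth1_continuous_on[OF Suc.prems] Ck_on_continuous[OF f(1)]] f(2)
      by blast
    show "has_partial i (\<lambda>x. h (f x)) (deriv h (f x) * partial_deriv i f x) x"
      if "i < d" "x \<in> V" for i x
      using Ck_on_imp_has_partial[OF f(1)] smooth1_DERIV[OF Suc.prems] f(2) that
      by (intro has_partial_compose) auto
    show "Ck_on d r V (\<lambda>x. deriv h (f x) * partial_deriv i f x)" if "i < d" for i
      using f(1)[of "Suc r"] that
      by (intro Ck_on_mult[OF V] Suc.IH smooth1_deriv[OF U Suc.prems]) simp
  qed
qed

text \<open>
  The projection to the coordinates of one factor of a product chart, with the zeros that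
  \<^const>\<open>Euclidean_space\<close> demands beyond the dimension.
\<close>

definition restrict_block :: "nat \<Rightarrow> nat \<Rightarrow> (nat \<Rightarrow> real) \<Rightarrow> nat \<Rightarrow> real"
  where "restrict_block b e x = (\<lambda>j. if j < e then x (b + j) else 0)"

lemma restrict_block_upd:
  "restrict_block b e (x(i := s)) =
     (if i \<in> {b..<b + e} then (restrict_block b e x)(i - b := s) else restrict_block b e x)"
  by (auto simp: restrict_block_def fun_eq_iff)

lemma continuous_on_restrict_block: "continuous_on V (restrict_block b e)"
proof (rule continuous_on_coordinatewise_then_product)
  fix j
  have "continuous_on V (\<lambda>x :: nat \<Rightarrow> real. x (b + j))"
    by (rule continuous_on_subset[OF continuous_on_product_coordinates]) simp
  then show "continuous_on V (\<lambda>x. restrict_block b e x j)"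
    by (cases "j < e") (simp_all add: restrict_block_def)
qed

lemma has_partial_restrict_block:
  assumes "i \<in> {b..<b + e} \<Longrightarrow> has_partial (i - b) f D (restrict_block b e x)"
  shows "has_partial i (\<lambda>x. f (restrict_block b e x)) (if i \<in> {b..<b + e} then D else 0) x"
proof (cases "i \<in> {b..<b + e}")
  case True
  then have "restrict_block b e x (i - b) = x i" by (auto simp: restrict_block_def)
  with True show ?thesis
    using assms by (simp add: has_partial_def restrict_block_upd)
next
  case False
  then show ?thesis by (auto simp: has_partial_def restrict_block_upd)
qed

lemma Ck_on_restrict_block:
  assumes V: "openin (Euclidean_space d) V" "\<And>x. x \<in> V \<Longrightarrow> restrict_block b e x \<in> W"
  shows "Ck_on e r W f \<Longrightarrow> Ck_on d r V (\<lambda>x. f (restrict_block b e x))"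
proof (induction r arbitrary: f)
  case 0
  then show ?case
    using continuous_on_compose2[OF _ continuous_on_restrict_block, of W f b e V] V(2) by auto
next
  case (Suc r)
  show ?case
  proof (rule Ck_on_SucI[OF V(1)])
    show "continuous_on V (\<lambda>x. f (restrict_block b e x))"
      using continuous_on_compose2[OF _ continuous_on_restrict_block, of W f b e V] V(2) Suc.prems
      by auto
    show "has_partial i (\<lambda>x. f (restrict_block b e x))
        (if i \<in> {b..<b + e} then partial_deriv (i - b) f (restrict_block b e x) else 0) x"
      if "i < d" "x \<in> V" for i x
      using Ck_on_imp_has_partial[OF Suc.prems V(2)[OF that(2)]]
      by (intro has_partial_restrict_block) auto
    show "Ck_on d r V (\<lambda>x. if i \<in> {b..<b + e} then partial_deriv (i - b) f (restrict_block b e x) else 0)"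
      if "i < d" for i
      using Suc by (cases "i \<in> {b..<b + e}") (auto simp: Ck_on_const)
  qed
qed

section \<open>Amplitudes and frequencies of Blanusa type\<close>

text \<open>
  A direction with metric \<open>\<eta>(t)\<^sup>2 dy\<^sup>2\<close> is wound up as \<open>\<phi>\<^sub>b(t) \<sigma>(S\<^sub>b(t) y)\<close> for \<open>b\<close> in a two-element set,
  where \<open>\<sigma>\<close> has unit speed and lies in a unit sphere. If \<open>\<phi>\<^sub>b\<close> is supported where \<open>S\<^sub>b\<close> is locally
  constant, this induces \<open>\<Sum>\<phi>\<^sub>b\<^sup>2 S\<^sub>b\<^sup>2 dy\<^sup>2 + \<Sum>\<phi>\<^sub>b'\<^sup>2 dt\<^sup>2\<close>. Raising the frequencies \<open>S\<^sub>b\<close> while keeping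
  \<open>\<Sum>\<phi>\<^sub>b\<^sup>2 S\<^sub>b\<^sup>2 = \<eta>\<^sup>2\<close> makes the amplitudes and their derivatives as small as required. On a noncompact
  interval the frequencies must grow towards the ends, and two functions are needed so that one can
  take over while the frequency of the other jumps.
\<close>

text \<open>
  A smooth proper function, namely \<open>t\<^sup>2\<close> plus the reciprocals of the distances to the finite end points.
\<close>

lemma smooth_exhaustion:
  assumes I: "open I" "is_interval I"
  obtains s :: "real \<Rightarrow> real"
  where "smooth1 I s" "\<And>C. \<exists>K. compact K \<and> K \<subseteq> I \<and> {t \<in> I. s t \<le> C} \<subseteq> K"
proof -
  define lo where "lo t = (if bdd_below I then inverse (t - Inf I) else 0)" for t
  define up where "up t = (if bdd_above I then inverse (Sup I - t) else 0)" for t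
  define s where "s t = t\<^sup>2 + lo t + up t" for t
  have gtInf: "Inf I < t" if "bdd_below I" "t \<in> I" for t
  proof -
    obtain e where "e > 0" "cball t e \<subseteq> I" using I(1) \<open>t \<in> I\<close> open_contains_cball by blast
    then have "t - e \<in> I" by (auto simp: subset_iff dist_real_def)
    then have "Inf I \<le> t - e" using that(1) by (rule cInf_lower)
    then show ?thesis using \<open>e > 0\<close> by simp
  qed
  have ltSup: "t < Sup I" if "bdd_above I" "t \<in> I" for t
  proof -
    obtain e where "e > 0" "cball t e \<subseteq> I" using I(1) \<open>t \<in> I\<close> open_contains_cball by blast
    then have "t + e \<in> I" by (auto simp: subset_iff dist_real_def)
    then have "t + e \<le> Sup I" using that(1) by (rule cSup_upper)
    then show ?thesis using \<open>e > 0\<close> by simp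
  qed
  have lo0: "lo t \<ge> 0" if "t \<in> I" for t using gtInf[OF _ that] by (auto simp: lo_def less_imp_le)
  have up0: "up t \<ge> 0" if "t \<in> I" for t using ltSup[OF _ that] by (auto simp: up_def less_imp_le)
  have "smooth1 I lo"
  proof (cases "bdd_below I")
    case True
    then have "smooth1 I (\<lambda>t. inverse (t - Inf I))" using gtInf by (intro smooth1_intros) force
    then show ?thesis using True by (simp add: lo_def[abs_def])
  qed (simp add: lo_def[abs_def])
  moreover have "smooth1 I up"
  proof (cases "bdd_above I")
    case True
    then have "smooth1 I (\<lambda>t. inverse (Sup I - t))" using ltSup by (intro smooth1_intros) force
    then show ?thesis using True by (simp add: up_def[abs_def])
  qed (simp add: up_def[abs_def])
  ultimately have "smooth1 I s"
    unfolding s_def[abs_def] by (intro smooth1_add smooth1_power smooth1_ident)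
  moreover have "\<exists>K. compact K \<and> K \<subseteq> I \<and> {t \<in> I. s t \<le> C} \<subseteq> K" for C
  proof (cases "I = {}")
    case False
    define B where "B = max C 1"
    have B: "B \<ge> 1" "C \<le> B" by (auto simp: B_def)
    have bnd: "\<bar>t\<bar> \<le> B + 1 \<and> lo t \<le> B \<and> up t \<le> B" if "t \<in> I" "s t \<le> C" for t
    proof -
      have "t\<^sup>2 \<le> B" "lo t \<le> B" "up t \<le> B"
        using that lo0[OF that(1)] up0[OF that(1)] B(2) zero_le_power2[of t] unfolding s_def
        by linarith+
      moreover have "\<bar>t\<bar> \<le> B + 1"
      proof (rule ccontr)
        assume "\<not> ?thesis"
        then have "\<bar>t\<bar> > 1" "\<bar>t\<bar> > B" using B by auto
        then have "\<bar>t\<bar> * 1 < \<bar>t\<bar> * \<bar>t\<bar>" by (intro mult_strict_left_mono) auto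
        then show False using \<open>t\<^sup>2 \<le> B\<close> \<open>\<bar>t\<bar> > B\<close> by (simp add: power2_eq_square)
      qed
      ultimately show ?thesis by blast
    qed
    have inv: "inverse B \<le> y" if "0 < y" "inverse y \<le> B" for y
      using that B by (simp add: field_simps)
    obtain x where x: "x \<in> I" "\<And>t. t \<in> I \<Longrightarrow> s t \<le> C \<Longrightarrow> x \<le> t"
    proof (cases "bdd_below I")
      case True
      have "Inf I < Inf I + inverse B" using B by simp
      then obtain x where "x \<in> I" "x < Inf I + inverse B"
        using cInf_less_iff[OF False True] by blast
      moreover have "Inf I + inverse B \<le> t" if "t \<in> I" "s t \<le> C" for t
        using bnd[OF that] inv[of "t - Inf I"] gtInf[OF True that(1)] True by (simp add: lo_def)
      ultimately show ?thesis using that by fastforce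
    next
      case unbounded: False
      then obtain x where "x \<in> I" "x < - (B + 1)" unfolding bdd_below_def by (meson not_le)
      then show ?thesis using that[of x] bnd by fastforce
    qed
    obtain y where y: "y \<in> I" "\<And>t. t \<in> I \<Longrightarrow> s t \<le> C \<Longrightarrow> t \<le> y"
    proof (cases "bdd_above I")
      case True
      have "Sup I - inverse B < Sup I" using B by simp
      then obtain y where "y \<in> I" "Sup I - inverse B < y"
        using less_cSup_iff[OF False True] by blast
      moreover have "t \<le> Sup I - inverse B" if "t \<in> I" "s t \<le> C" for t
        using bnd[OF that] inv[of "Sup I - t"] ltSup[OF True that(1)] True by (simp add: up_def)
      ultimately show ?thesis using that by fastforce
    next
      case unbounded: False
      then obtain y where "y \<in> I" "y > B + 1" unfolding bdd_above_def by (meson not_le)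
      then show ?thesis using that[of y] bnd by fastforce
    qed
    have "{x..y} \<subseteq> I" using I(2) x(1) y(1) mem_is_interval_1_I[of I x y] by auto
    then show ?thesis using x(2) y(2) by (intro exI[of _ "{x..y}"]) auto
  qed (auto intro: exI[of _ "{}"])
  ultimately show thesis using that by blast
qed

text \<open>
  The condition under which \<open>u / S\<close> is as smooth as \<open>u\<close> although \<open>S\<close> has jumps. It is inherited by the
  derivative of \<open>u\<close>, which gives \<open>(u / S)' = u' / S\<close> at every order.
\<close>

definition locally_zero_or_const :: "real set \<Rightarrow> (real \<Rightarrow> real) \<Rightarrow> (real \<Rightarrow> real) \<Rightarrow> bool"
  where "locally_zero_or_const I u S \<longleftrightarrow>
    (\<forall>t0\<in>I. \<exists>J. open J \<and> t0 \<in> J \<and> J \<subseteq> I \<and> ((\<forall>t\<in>J. u t = 0) \<or> (\<exists>S0. \<forall>t\<in>J. S t = S0)))"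

lemma DERIV_divide_locally_const:
  assumes u: "smooth1 I u" and loc: "locally_zero_or_const I u S" and t: "t \<in> I"
  shows "((\<lambda>t. u t / S t) has_real_derivative deriv u t / S t) (at t)"
proof -
  obtain J where J: "open J" "t \<in> J" "(\<forall>t\<in>J. u t = 0) \<or> (\<exists>S0. \<forall>t\<in>J. S t = S0)"
    using loc[unfolded locally_zero_or_const_def, rule_format, OF t] by (elim exE conjE)
  show ?thesis
  proof (rule has_field_derivative_transform_within_open[OF _ J(1,2)])
    show "((\<lambda>x. u x / S t) has_real_derivative deriv u t / S t) (at t)"
      by (rule DERIV_cdivide[OF smooth1_DERIV[OF u t]])
    show "u x / S t = u x / S x" if "x \<in> J" for x
      using J(2,3) that by auto
  qed
qed

lemma locally_zero_or_const_deriv: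
  assumes "locally_zero_or_const I u S"
  shows "locally_zero_or_const I (deriv u) S"
proof -
  have "deriv u t = 0" if "open J" "t \<in> J" "\<forall>t\<in>J. u t = 0" for J t
  proof (rule DERIV_imp_deriv)
    show "(u has_real_derivative 0) (at t)"
      by (rule has_field_derivative_transform_within_open[where f = "\<lambda>_. 0" and S = J])
        (use that in auto)
  qed
  then have zero: "(\<forall>t\<in>J. deriv u t = 0) \<or> (\<exists>S0. \<forall>t\<in>J. S t = S0)"
    if "open J" "(\<forall>t\<in>J. u t = 0) \<or> (\<exists>S0. \<forall>t\<in>J. S t = S0)" for J
    using that by auto
  show ?thesis
    unfolding locally_zero_or_const_def
  proof
    fix t0 assume "t0 \<in> I"
    from assms[unfolded locally_zero_or_const_def, rule_format, OF this]
    obtain J where "open J" "t0 \<in> J" "J \<subseteq> I" "(\<forall>t\<in>J. u t = 0) \<or> (\<exists>S0. \<forall>t\<in>J. S t = S0)"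
      by (elim exE conjE)
    with zero[OF this(1) this(4)]
    show "\<exists>J. open J \<and> t0 \<in> J \<and> J \<subseteq> I \<and> ((\<forall>t\<in>J. deriv u t = 0) \<or> (\<exists>S0. \<forall>t\<in>J. S t = S0))"
      by (intro exI[of _ J] conjI)
  qed
qed

lemma smooth1_divide_locally_const:
  assumes I: "open I" and u: "smooth1 I u" and loc: "locally_zero_or_const I u S"
  shows "smooth1 I (\<lambda>t. u t / S t)"
  unfolding smooth1_def
proof
  fix r from u loc show "times_diff r I (\<lambda>t. u t / S t)"
  proof (induction r arbitrary: u)
    case (Suc r)
    have "\<forall>t\<in>I. ((\<lambda>t. u t / S t) has_real_derivative deriv u t / S t) (at t)"
      using DERIV_divide_locally_const Suc.prems by blast
    moreover have "times_diff r I (\<lambda>t. deriv u t / S t)"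
      using Suc.IH[OF smooth1_deriv[OF I Suc.prems(1)] locally_zero_or_const_deriv[OF Suc.prems(2)]] .
    ultimately show ?case
      unfolding times_diff.simps by (intro exI[of _ "\<lambda>t. deriv u t / S t"]) blast
  qed simp
qed

text \<open>
  A smooth function of period 1 that vanishes near the integers and is positive where
  \<open>sin\<^sup>2(\<pi>x) > 1/4\<close>. It and its translate by \<open>1/2\<close> have no common zero.
\<close>

definition pulse :: "real \<Rightarrow> real"
  where "pulse x = flat 0 ((sin (pi * x))\<^sup>2 - 1 / 4)"

lemma smooth1_pulse: "smooth1 UNIV pulse"
  unfolding pulse_def[abs_def]
  by (rule smooth1_compose[OF smooth1_flat]) (intro smooth1_intros, simp)

lemma pulse_covers: "pulse x > 0 \<or> pulse (x + 1 / 2) > 0"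
proof -
  have "sin (pi * (x + 1 / 2)) = cos (pi * x)"
    by (simp add: distrib_left sin_add)
  then have "(sin (pi * x))\<^sup>2 + (sin (pi * (x + 1 / 2)))\<^sup>2 = 1" by simp
  then have "(sin (pi * x))\<^sup>2 > 1 / 4 \<or> (sin (pi * (x + 1 / 2)))\<^sup>2 > 1 / 4" by linarith
  then show ?thesis by (auto simp: pulse_def flat_def)
qed

lemma pulse_locally_zero_or_floor_const:
  "\<exists>J. open J \<and> x \<in> J \<and> ((\<forall>y\<in>J. pulse y = 0) \<or> (\<forall>y\<in>J. \<lfloor>y\<rfloor> = \<lfloor>x\<rfloor>))"
proof (cases "x \<in> \<int>")
  case True
  let ?J = "{y. (sin (pi * y))\<^sup>2 < 1 / 4}"
  have "open ?J" by (intro open_Collect_less continuous_intros)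
  moreover have "x \<in> ?J" using True sin_integer_2pi by (auto elim!: Ints_cases simp: sin_zero_iff_int2 mult.commute)
  moreover have "\<forall>y\<in>?J. pulse y = 0" by (auto simp: pulse_def flat_def)
  ultimately show ?thesis by blast
next
  case False
  let ?J = "{of_int \<lfloor>x\<rfloor> <..< of_int \<lfloor>x\<rfloor> + (1::real)}"
  have "x \<noteq> of_int \<lfloor>x\<rfloor>" using False by (metis Ints_of_int)
  then have "of_int \<lfloor>x\<rfloor> < x" "x < of_int \<lfloor>x\<rfloor> + 1" by linarith+
  then have "x \<in> ?J" by simp
  moreover have "open ?J" by simp
  moreover have "\<forall>y\<in>?J. \<lfloor>y\<rfloor> = \<lfloor>x\<rfloor>" by (auto simp: floor_eq_iff)
  ultimately show ?thesis by blast
qed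

text \<open>
  With a proper function \<open>s\<close>, the two pulses at \<open>s(t)\<close> and \<open>s(t) + 1/2\<close> are normalised to have squares
  of sum 1 and multiplied by \<open>\<eta>\<close>, which gives \<open>u\<^sub>b\<close>. The frequency \<open>S\<^sub>b\<close> depends only on the integer part
  of the argument of the pulse, so near each of its jumps \<open>u\<^sub>b\<close> vanishes. Each integer part
  belongs to a set of \<open>t\<close> contained in a compact subset of \<open>I\<close>; there \<open>u\<^sub>b\<^sup>2 + u\<^sub>b'\<^sup>2\<close> is bounded by a multiple of \<open>\<delta>\<close>, so a
  sufficiently large constant is a suitable value of \<open>S\<^sub>b\<close>.
\<close>

lemma blanusa_amplitudes:
  fixes \<eta> \<delta> :: "real \<Rightarrow> real"
  assumes I: "open I" "is_interval I" and \<eta>: "smooth1 I \<eta>" "\<And>t. t \<in> I \<Longrightarrow> \<eta> t > 0"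
    and \<delta>: "continuous_on I \<delta>" "\<And>t. t \<in> I \<Longrightarrow> \<delta> t > 0"
  obtains \<phi> S :: "bool \<Rightarrow> real \<Rightarrow> real"
  where "\<And>b. smooth1 I (\<phi> b)" "\<And>b t. S b t > 0"
    "\<And>b. locally_zero_or_const I (\<phi> b) (S b)"
    "\<And>t. t \<in> I \<Longrightarrow> (\<Sum>b\<in>UNIV. (\<phi> b t)\<^sup>2 * (S b t)\<^sup>2) = (\<eta> t)\<^sup>2"
    "\<And>t. t \<in> I \<Longrightarrow> (\<Sum>b\<in>UNIV. (\<phi> b t)\<^sup>2) < \<delta> t"
    "\<And>t. t \<in> I \<Longrightarrow> (\<Sum>b\<in>UNIV. (deriv (\<phi> b) t)\<^sup>2) < \<delta> t"
proof -
  obtain s where s: "smooth1 I s" "\<And>C. \<exists>K. compact K \<and> K \<subseteq> I \<and> {t \<in> I. s t \<le> C} \<subseteq> K"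
    using smooth_exhaustion[OF I] by blast
  define sh :: "bool \<Rightarrow> real" where "sh b = (if b then 0 else 1 / 2)" for b
  define E where "E b t = pulse (s t + sh b)" for b t
  define Q where "Q t = (E True t)\<^sup>2 + (E False t)\<^sup>2" for t
  define u where "u b t = \<eta> t * (E b t / sqrt (Q t))" for b t
  have E: "smooth1 I (E b)" for b
    unfolding E_def[abs_def]
    by (rule smooth1_compose[OF smooth1_pulse]) (intro smooth1_intros s(1), simp)
  have Qpos: "Q t > 0" for t
    using pulse_covers[of "s t"] by (auto simp: Q_def E_def sh_def intro: add_pos_nonneg add_nonneg_pos)
  have u: "smooth1 I (u b)" for b
    unfolding u_def[abs_def]
    by (intro smooth1_mult smooth1_divide smooth1_sqrt E \<eta>(1))
      (auto simp: Q_def[abs_def] intro!: smooth1_add smooth1_power E, use Qpos Q_def in \<open>auto simp: less_le\<close>)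
  have sum_u: "(\<Sum>b\<in>UNIV. (u b t)\<^sup>2) = (\<eta> t)\<^sup>2" if "t \<in> I" for t
    using Qpos[of t]
    by (simp add: UNIV_bool u_def power_mult_distrib power_divide Q_def flip: distrib_left add_divide_distrib)
      (auto simp: add.commute)
  define v where "v b t = ((u b t)\<^sup>2 + (deriv (u b) t)\<^sup>2) / \<delta> t" for b t
  have v: "continuous_on I (v b)" for b
    unfolding v_def[abs_def]
    using smooth1_continuous_on[OF u[of b]] smooth1_continuous_on[OF smooth1_deriv[OF I(1) u[of b]]]
      \<delta>(1) less_imp_neq[OF \<delta>(2)]
    by (intro continuous_intros ballI) metis+
  have ex_c: "\<exists>c. c \<ge> 1 \<and> (\<forall>t\<in>I. s t \<le> real_of_int j + 1 \<longrightarrow> 2 * v b t < c)" for b j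
  proof -
    obtain K where K: "compact K" "K \<subseteq> I" "{t \<in> I. s t \<le> real_of_int j + 1} \<subseteq> K"
      using s(2) by blast
    then have "bounded (v b ` K)"
      using continuous_on_subset[OF v] compact_continuous_image compact_imp_bounded by blast
    then obtain B where "\<forall>t\<in>K. \<bar>v b t\<bar> \<le> B" by (auto simp: bounded_iff)
    with K(3) show ?thesis by (intro exI[of _ "max 1 (2 * B + 1)"]) fastforce
  qed
  define c where
    "c b j = (SOME c. c \<ge> 1 \<and> (\<forall>t\<in>I. s t \<le> real_of_int j + 1 \<longrightarrow> 2 * v b t < c))" for b j
  have c: "c b j \<ge> 1" "t \<in> I \<Longrightarrow> s t \<le> real_of_int j + 1 \<Longrightarrow> 2 * v b t < c b j" for b j t
    using someI_ex[OF ex_c[of j b]] unfolding c_def by blast+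
  define S where "S b t = c b \<lfloor>s t + sh b\<rfloor>" for b t
  define \<phi> where "\<phi> b t = u b t / S b t" for b t
  have S1: "S b t \<ge> 1" for b t using c(1) by (simp add: S_def)
  have loc: "locally_zero_or_const I (u b) (S b)" for b
    unfolding locally_zero_or_const_def
  proof
    fix t0 assume t0: "t0 \<in> I"
    obtain J where J: "open J" "s t0 + sh b \<in> J"
      "(\<forall>y\<in>J. pulse y = 0) \<or> (\<forall>y\<in>J. \<lfloor>y\<rfloor> = \<lfloor>s t0 + sh b\<rfloor>)"
      using pulse_locally_zero_or_floor_const by blast
    let ?J' = "I \<inter> (\<lambda>t. s t + sh b) -` J"
    have "open ?J'"
      using I(1) J(1) smooth1_continuous_on[OF s(1)]
      by (intro continuous_open_preimage continuous_intros)
    moreover have "t0 \<in> ?J'" using t0 J(2) by simp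
    moreover have "(\<forall>t\<in>?J'. u b t = 0) \<or> (\<exists>S0. \<forall>t\<in>?J'. S b t = S0)"
      using J(3)
    proof
      assume "\<forall>y\<in>J. pulse y = 0"
      then show ?thesis by (auto simp: u_def E_def)
    next
      assume "\<forall>y\<in>J. \<lfloor>y\<rfloor> = \<lfloor>s t0 + sh b\<rfloor>"
      then show ?thesis by (auto simp: S_def)
    qed
    ultimately show "\<exists>J. open J \<and> t0 \<in> J \<and> J \<subseteq> I \<and> ((\<forall>t\<in>J. u b t = 0) \<or> (\<exists>S0. \<forall>t\<in>J. S b t = S0))"
      by blast
  qed
  have d\<phi>: "deriv (\<phi> b) t = deriv (u b) t / S b t" if "t \<in> I" for b t
    unfolding \<phi>_def[abs_def]
    by (rule DERIV_imp_deriv[OF DERIV_divide_locally_const[OF u loc that]])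
  \<comment> \<open>Applied with \<open>w = u\<close> and \<open>w = u'\<close>. The choice of \<open>c\<close> gives \<open>2 w\<^sup>2 < S \<delta> \<le> S\<^sup>2 \<delta>\<close>, as \<open>S \<ge> 1\<close>.\<close>
  have small: "(w / S b t)\<^sup>2 < \<delta> t / 2" if "t \<in> I" "w\<^sup>2 \<le> (u b t)\<^sup>2 + (deriv (u b) t)\<^sup>2" for b t w
  proof -
    have "s t \<le> real_of_int \<lfloor>s t + sh b\<rfloor> + 1" by (simp add: sh_def) linarith
    then have "2 * v b t < S b t" using c(2)[OF that(1)] by (simp add: S_def)
    then have "2 * (v b t * \<delta> t) < S b t * \<delta> t" using \<delta>(2)[OF that(1)] by simp
    then have "2 * w\<^sup>2 < S b t * \<delta> t" using that(2) \<delta>(2)[OF that(1)] by (simp add: v_def)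
    moreover have "S b t * 1 \<le> S b t * S b t" using S1[of b t] by (intro mult_left_mono) auto
    then have "S b t * \<delta> t \<le> (S b t)\<^sup>2 * \<delta> t"
      using \<delta>(2)[OF that(1)] by (intro mult_right_mono) (simp_all add: power2_eq_square)
    ultimately have "2 * w\<^sup>2 < (S b t)\<^sup>2 * \<delta> t" by linarith
    moreover have "0 < (S b t)\<^sup>2" using S1[of b t] by simp
    ultimately show ?thesis by (simp add: power_divide field_simps)
  qed
  show thesis
  proof
    show "smooth1 I (\<phi> b)" for b
      unfolding \<phi>_def[abs_def] by (rule smooth1_divide_locally_const[OF I(1) u loc])
    show "S b t > 0" for b t using S1[of b t] by linarith
    show "locally_zero_or_const I (\<phi> b) (S b)" for b
      using loc[of b] unfolding locally_zero_or_const_def \<phi>_def by (metis div_0)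
    show "(\<Sum>b\<in>UNIV. (\<phi> b t)\<^sup>2 * (S b t)\<^sup>2) = (\<eta> t)\<^sup>2" if "t \<in> I" for t
    proof -
      have "(\<phi> b t)\<^sup>2 * (S b t)\<^sup>2 = (u b t)\<^sup>2" for b
        using S1[of b t] by (simp add: \<phi>_def flip: power_mult_distrib)
      then show ?thesis using sum_u[OF that] by simp
    qed
    show "(\<Sum>b\<in>UNIV. (\<phi> b t)\<^sup>2) < \<delta> t" if "t \<in> I" for t
      using small[OF that, of "u True t" True] small[OF that, of "u False t" False]
      by (simp add: UNIV_bool \<phi>_def)
    show "(\<Sum>b\<in>UNIV. (deriv (\<phi> b) t)\<^sup>2) < \<delta> t" if "t \<in> I" for t
      using small[OF that, of "deriv (u True) t" True] small[OF that, of "deriv (u False) t" False]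
      by (simp add: UNIV_bool d\<phi>[OF that])
  qed
qed

section \<open>Curves of unit speed in the unit sphere\<close>

text \<open>
  Injectivity and continuity of the inverse in one condition: along any filter, convergence of the
  values of \<open>u\<close> forces convergence of the parameter. The principal filters of points give
  injectivity. The filters are on the line of parameters, so the condition can be applied along any map
  into \<open>U\<close>.
\<close>

definition recovers_parameter :: "real set \<Rightarrow> 'q set \<Rightarrow> ('q \<Rightarrow> real \<Rightarrow> real) \<Rightarrow> bool"
  where "recovers_parameter U Q u \<longleftrightarrow>
    (\<forall>F. \<forall>t0\<in>U. (\<forall>\<^sub>F t in F. t \<in> U) \<longrightarrow> (\<forall>q\<in>Q. (u q \<longlongrightarrow> u q t0) F) \<longrightarrow> ((\<lambda>t. t) \<longlongrightarrow> t0) F)"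

lemma strict_mono_on_tendsto:
  fixes h :: "real \<Rightarrow> real"
  assumes U: "open U" and h: "strict_mono_on U h" and t0: "t0 \<in> U"
    and F: "\<forall>\<^sub>F x in F. g x \<in> U" "((\<lambda>x. h (g x)) \<longlongrightarrow> h t0) F"
  shows "(g \<longlongrightarrow> t0) F"
proof -
  obtain e where e: "e > 0" "\<And>x. \<bar>x - t0\<bar> \<le> e \<Longrightarrow> x \<in> U"
    using U t0 unfolding open_contains_cball by (auto simp: subset_iff dist_real_def abs_minus_commute)
  show ?thesis
  proof (rule order_tendstoI)
    fix a assume a: "a < t0"
    define a' where "a' = max (t0 - e) ((a + t0) / 2)"
    have a': "a' \<in> U" "a < a'" "a' < t0"
      using e(1) a by (auto simp: a'_def less_max_iff_disj intro!: e(2))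
    then have "h a' < h t0" using h t0 by (auto simp: strict_mono_on_def)
    then have "\<forall>\<^sub>F x in F. h a' < h (g x)" using F(2) by (rule order_tendstoD(1)[rotated])
    with F(1) show "\<forall>\<^sub>F x in F. a < g x"
    proof eventually_elim
      case (elim x)
      then have "a' < g x"
        using strict_mono_on_leD[OF h, of "g x" a'] a'(1) by (meson linorder_not_less)
      then show ?case using a' by linarith
    qed
  next
    fix a assume a: "t0 < a"
    define a' where "a' = min (t0 + e) ((a + t0) / 2)"
    have a': "a' \<in> U" "a' < a" "t0 < a'"
      using e(1) a by (auto simp: a'_def min_less_iff_disj intro!: e(2))
    then have "h t0 < h a'" using h t0 by (auto simp: strict_mono_on_def)
    then have "\<forall>\<^sub>F x in F. h (g x) < h a'" using F(2) by (rule order_tendstoD(2)[rotated])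
    with F(1) show "\<forall>\<^sub>F x in F. g x < a"
    proof eventually_elim
      case (elim x)
      then have "g x < a'"
        using strict_mono_on_leD[OF h, of a' "g x"] a'(1) by (meson linorder_not_less)
      then show ?case using a' by linarith
    qed
  qed
qed

text \<open>
  Constant length makes \<open>\<sigma>\<close> and \<open>\<sigma>'\<close> orthogonal, which removes the mixed terms \<open>dt dy\<close> in the metric
  induced by \<open>\<phi>(t) \<sigma>(S y)\<close>; unit length and unit speed turn the
  coefficients of \<open>dt\<^sup>2\<close> and \<open>dy\<^sup>2\<close> into \<open>\<phi>'\<^sup>2\<close> and \<open>\<phi>\<^sup>2 S\<^sup>2\<close>.
\<close>

definition unit_sphere_curve :: "nat \<Rightarrow> (nat \<Rightarrow> real \<Rightarrow> real) \<Rightarrow> bool"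
  where "unit_sphere_curve N \<sigma> \<longleftrightarrow> (\<forall>q<N. smooth1 UNIV (\<sigma> q)) \<and>
    (\<forall>x. (\<Sum>q<N. (\<sigma> q x)\<^sup>2) = 1 \<and> (\<Sum>q<N. (deriv (\<sigma> q) x)\<^sup>2) = 1)"

lemma unit_sphere_curve_DERIV:
  "unit_sphere_curve N \<sigma> \<Longrightarrow> q < N \<Longrightarrow> (\<sigma> q has_real_derivative deriv (\<sigma> q) x) (at x)"
  using smooth1_DERIV[of UNIV "\<sigma> q"] by (simp add: unit_sphere_curve_def)

lemma unit_sphere_curve_orthogonal:
  assumes "unit_sphere_curve N \<sigma>"
  shows "(\<Sum>q<N. \<sigma> q x * deriv (\<sigma> q) x) = 0"
proof -
  have "((\<lambda>x. \<Sum>q<N. (\<sigma> q x)\<^sup>2) has_real_derivative (\<Sum>q<N. 2 * (\<sigma> q x * deriv (\<sigma> q) x))) (at x)"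
  proof (rule DERIV_sum)
    fix q assume "q \<in> {..<N}"
    then have D: "(\<sigma> q has_real_derivative deriv (\<sigma> q) x) (at x)"
      using unit_sphere_curve_DERIV[OF assms] by simp
    show "((\<lambda>x. (\<sigma> q x)\<^sup>2) has_real_derivative 2 * (\<sigma> q x * deriv (\<sigma> q) x)) (at x)"
      by (rule derivative_eq_intros D refl)+ (simp add: mult_ac)
  qed
  moreover have "(\<lambda>x. \<Sum>q<N. (\<sigma> q x)\<^sup>2) = (\<lambda>_. 1)"
    using assms by (simp add: unit_sphere_curve_def)
  ultimately have "(\<Sum>q<N. 2 * (\<sigma> q x * deriv (\<sigma> q) x)) = 0"
    using DERIV_unique[OF _ DERIV_const] by metis
  then show ?thesis by (simp flip: sum_distrib_left)
qed

lemma circle_is_unit_sphere_curve: "unit_sphere_curve 2 (\<lambda>q. if q = 0 then cos else sin)"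
proof -
  have "deriv cos x = - sin x" "deriv sin x = cos x" for x :: real
    by (auto intro!: DERIV_imp_deriv derivative_eq_intros)
  then show ?thesis
    by (auto simp: unit_sphere_curve_def numeral_2_eq_2 smooth1_sin_cos_basic add.commute)
qed

text \<open>
  A spiral on the 2-sphere with latitude \<open>w(x) = arctan(x) / 2\<close>. The latitude is strictly increasing
  and so recovers the parameter; it moves with speed at most \<open>1/2\<close> and stays away from the poles, so a
  longitude \<open>v\<close> with \<open>w'\<^sup>2 + cos\<^sup>2(w) v'\<^sup>2 = 1\<close> exists on the whole line. The fourth coordinate is 0,
  since the dimensions in the theorem leave room for it.
\<close>

lemma embedded_unit_sphere_curve:
  obtains \<sigma> where "unit_sphere_curve 4 \<sigma>" "recovers_parameter UNIV {..<4} \<sigma>"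
proof -
  define w where "w x = arctan x / 2" for x :: real
  define w' where "w' x = inverse (1 + x\<^sup>2) / 2" for x :: real
  have w': "0 < w' x" "w' x \<le> 1 / 2" for x
    by (auto simp: w'_def field_simps add_pos_nonneg)
  have w'_sq: "(w' x)\<^sup>2 < 1" for x
    using w'[of x] power_strict_mono[of "w' x" 1 2] by simp
  have Dw: "(w has_real_derivative w' x) (at x)" for x
    unfolding w_def[abs_def] w'_def by (intro DERIV_cdivide DERIV_arctan)
  have sw': "smooth1 UNIV w'"
    unfolding w'_def[abs_def]
    by (intro smooth1_divide smooth1_inverse smooth1_add smooth1_power smooth1_const smooth1_ident)
      (auto simp: add_nonneg_eq_0_iff)
  have sw: "smooth1 UNIV w" by (rule smooth1I[OF Dw sw'])
  have w_bnd: "- (pi / 4) < w x" "w x < pi / 4" for x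
    using arctan_bounded[of x] by (auto simp: w_def)
  have cos_pos: "cos (w x) > 0" for x
    using w_bnd[of x] pi_gt_zero by (intro cos_gt_zero_pi) linarith+
  define v' where "v' x = sqrt (1 - (w' x)\<^sup>2) / cos (w x)" for x
  have sv': "smooth1 UNIV v'"
    unfolding v'_def[abs_def] using w'_sq cos_pos
    by (intro smooth1_divide smooth1_sqrt smooth1_diff smooth1_const smooth1_power smooth1_cos sw sw')
      (auto simp: less_imp_neq[symmetric])
  obtain v where sv: "smooth1 UNIV v" and Dv: "\<And>x. (v has_real_derivative v' x) (at x)"
    using smooth1_antiderivative[OF open_UNIV is_interval_univ sv'] by auto
  define \<sigma> where "\<sigma> q x = (if q = 0 then cos (w x) * cos (v x) else if q = 1 then cos (w x) * sin (v x)
    else if q = 2 then sin (w x) else 0)" for q :: nat and x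
  have lt4: "{..<4} = {0, 1, 2, 3 :: nat}" by auto
  have D0: "(\<sigma> 0 has_real_derivative - sin (w x) * w' x * cos (v x) - cos (w x) * (sin (v x) * v' x)) (at x)" for x
    unfolding \<sigma>_def[abs_def] by (auto intro!: derivative_eq_intros Dw Dv)
  have D1: "(\<sigma> 1 has_real_derivative - sin (w x) * w' x * sin (v x) + cos (w x) * (cos (v x) * v' x)) (at x)" for x
    unfolding \<sigma>_def[abs_def] by (auto intro!: derivative_eq_intros Dw Dv)
  have D2: "(\<sigma> 2 has_real_derivative cos (w x) * w' x) (at x)" for x
    unfolding \<sigma>_def[abs_def] by (auto intro!: derivative_eq_intros Dw Dv)
  have D3: "(\<sigma> 3 has_real_derivative 0) (at x)" for x
    unfolding \<sigma>_def[abs_def] by auto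
  have "smooth1 UNIV (\<sigma> q)" for q
  proof -
    consider "q = 0" | "q = 1" | "q = 2" | "q > 2" by linarith
    then show ?thesis
      by cases (auto simp: \<sigma>_def[abs_def] intro!: smooth1_mult smooth1_cos smooth1_sin sw sv)
  qed
  moreover have "(\<Sum>q<4. (\<sigma> q x)\<^sup>2) = 1" for x
  proof -
    have "(\<Sum>q<4. (\<sigma> q x)\<^sup>2) = (cos (w x) * cos (v x))\<^sup>2 + (cos (w x) * sin (v x))\<^sup>2 + (sin (w x))\<^sup>2"
      unfolding lt4 by (simp add: \<sigma>_def)
    also have "\<dots> = (cos (w x))\<^sup>2 * ((sin (v x))\<^sup>2 + (cos (v x))\<^sup>2) + (sin (w x))\<^sup>2"
      by algebra
    finally show ?thesis by simp
  qed
  moreover have "(\<Sum>q<4. (deriv (\<sigma> q) x)\<^sup>2) = 1" for x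
  proof -
    have "(\<Sum>q<4. (deriv (\<sigma> q) x)\<^sup>2) =
        (- sin (w x) * w' x * cos (v x) - cos (w x) * (sin (v x) * v' x))\<^sup>2
        + (- sin (w x) * w' x * sin (v x) + cos (w x) * (cos (v x) * v' x))\<^sup>2 + (cos (w x) * w' x)\<^sup>2"
      unfolding lt4
      using D0[THEN DERIV_imp_deriv] D1[THEN DERIV_imp_deriv] D2[THEN DERIV_imp_deriv] D3[THEN DERIV_imp_deriv]
      by simp
    also have "\<dots> = ((sin (w x))\<^sup>2 * (w' x)\<^sup>2 + (cos (w x))\<^sup>2 * (v' x)\<^sup>2) * ((sin (v x))\<^sup>2 + (cos (v x))\<^sup>2)
        + (cos (w x))\<^sup>2 * (w' x)\<^sup>2"
      by algebra
    also have "\<dots> = ((sin (w x))\<^sup>2 + (cos (w x))\<^sup>2) * (w' x)\<^sup>2 + (cos (w x))\<^sup>2 * (v' x)\<^sup>2"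
      using sin_cos_squared_add[of "v x"] by algebra
    also have "(cos (w x))\<^sup>2 * (v' x)\<^sup>2 = 1 - (w' x)\<^sup>2"
      using cos_pos[of x] w'_sq[of x] by (simp add: v'_def power_divide)
    finally show ?thesis by simp
  qed
  ultimately have curve: "unit_sphere_curve 4 \<sigma>" by (simp add: unit_sphere_curve_def)
  have "recovers_parameter UNIV {..<4} \<sigma>"
    unfolding recovers_parameter_def
  proof (intro ballI allI impI)
    fix F :: "real filter" and t0 :: real
    assume "\<forall>q\<in>{..<4}. (\<sigma> q \<longlongrightarrow> \<sigma> q t0) F"
    then have lim: "(\<sigma> 2 \<longlongrightarrow> \<sigma> 2 t0) F" by simp
    have "strict_mono_on UNIV (\<sigma> 2)"
      using D2 cos_pos w'(1) by (intro DERIV_pos_imp_strict_mono_on[where g = "\<lambda>x. cos (w x) * w' x"]) auto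
    then show "((\<lambda>t. t) \<longlongrightarrow> t0) F"
      by (rule strict_mono_on_tendsto[OF open_UNIV]) (use lim in auto)
  qed
  with curve show thesis by (rule that)
qed

section \<open>Isometric images of a line with a warped metric\<close>

text \<open>
  Functions of this form have partial derivatives that are again locally products, and their
  composition with smooth functions needs only the product rule and outer functions of one variable.
  Global products would not suffice, because the frequencies \<open>S\<^sub>b\<close> jump.
\<close>

definition locally_product :: "real set \<Rightarrow> (real \<Rightarrow> real \<Rightarrow> real) \<Rightarrow> bool"
  where "locally_product I G \<longleftrightarrow> (\<forall>t0\<in>I. \<exists>J u w. open J \<and> t0 \<in> J \<and> J \<subseteq> I \<and>
    smooth1 J u \<and> smooth1 UNIV w \<and> (\<forall>t\<in>J. \<forall>y. G t y = u t * w y))"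

definition dt :: "(real \<Rightarrow> real \<Rightarrow> real) \<Rightarrow> real \<Rightarrow> real \<Rightarrow> real"
  where "dt G t y = deriv (\<lambda>s. G s y) t"

definition dy :: "(real \<Rightarrow> real \<Rightarrow> real) \<Rightarrow> real \<Rightarrow> real \<Rightarrow> real"
  where "dy G t y = deriv (G t) y"

lemma locally_productE:
  assumes "locally_product I G" "t0 \<in> I"
  obtains J u w where "open J" "t0 \<in> J" "J \<subseteq> I" "smooth1 J u" "smooth1 UNIV w"
    "\<And>t y. t \<in> J \<Longrightarrow> G t y = u t * w y"
    "\<And>t y. t \<in> J \<Longrightarrow> dt G t y = deriv u t * w y" "\<And>t y. t \<in> J \<Longrightarrow> dy G t y = u t * deriv w y"
proof -
  from assms(1)[unfolded locally_product_def, rule_format, OF assms(2)]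
  obtain J u w where J: "open J" "t0 \<in> J" "J \<subseteq> I" "smooth1 J u" "smooth1 UNIV w"
    and eq: "\<forall>t\<in>J. \<forall>y. G t y = u t * w y"
    by (elim exE conjE)
  have "dt G t y = deriv u t * w y" if t: "t \<in> J" for t y
    unfolding dt_def
  proof (rule DERIV_imp_deriv, rule has_field_derivative_transform_within_open[OF _ J(1) t])
    show "((\<lambda>t. u t * w y) has_real_derivative deriv u t * w y) (at t)"
      by (rule DERIV_cmult_right[OF smooth1_DERIV[OF J(4) t]])
  qed (use eq in simp)
  moreover have "dy G t y = u t * deriv w y" if t: "t \<in> J" for t y
  proof -
    have "G t = (\<lambda>y. u t * w y)" using eq t by auto
    then show ?thesis
      unfolding dy_def using DERIV_imp_deriv[OF DERIV_cmult[OF smooth1_DERIV[OF J(5)]]] by simp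
  qed
  ultimately show thesis using that J eq by simp
qed

lemma product_locally_product:
  assumes "open I" "smooth1 I u" "smooth1 UNIV w"
  shows "locally_product I (\<lambda>t y. u t * w y)"
  unfolding locally_product_def
proof
  fix t0 assume "t0 \<in> I"
  then show "\<exists>J ua wa. open J \<and> t0 \<in> J \<and> J \<subseteq> I \<and> smooth1 J ua \<and> smooth1 UNIV wa \<and>
      (\<forall>t\<in>J. \<forall>y. u t * w y = ua t * wa y)"
    using assms by (intro exI[of _ I] exI[of _ u] exI[of _ w]) auto
qed

lemma dt_product: "smooth1 I u \<Longrightarrow> t \<in> I \<Longrightarrow> dt (\<lambda>t y. u t * w y) t y = deriv u t * w y"
  unfolding dt_def by (rule DERIV_imp_deriv[OF DERIV_cmult_right[OF smooth1_DERIV]])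

lemma dy_product: "(w has_real_derivative w') (at y) \<Longrightarrow> dy (\<lambda>t y. u t * w y) t y = u t * w'"
  unfolding dy_def by (rule DERIV_imp_deriv[OF DERIV_cmult])

definition signature :: "bool \<times> 'j \<Rightarrow> real"
  where "signature q = (if fst q then - 1 else 1)"

text \<open>
  The functions \<open>G q\<close> are the coordinates of a map of \<open>I \<times> \<real>\<close>, with coordinates \<open>(t, y)\<close>, into a semi-Euclidean
  space. It induces \<open>P(t) dt\<^sup>2 + \<eta>(t)\<^sup>2 dy\<^sup>2\<close>, and its squared length \<open>R(t)\<close> does not depend on \<open>y\<close>; the
  latter is what allows a combination of such maps to stay in a quadric.
\<close>

definition warped_line ::
  "real set \<Rightarrow> (real \<Rightarrow> real) \<Rightarrow> (bool \<times> 'j) set \<Rightarrow> (bool \<times> 'j \<Rightarrow> real \<Rightarrow> real \<Rightarrow> real)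
    \<Rightarrow> (real \<Rightarrow> real) \<Rightarrow> (real \<Rightarrow> real) \<Rightarrow> bool"
  where "warped_line I \<eta> Q G P R \<longleftrightarrow>
    finite Q \<and> (\<forall>q\<in>Q. locally_product I (G q)) \<and>
    (\<forall>t\<in>I. \<forall>y. (\<Sum>q\<in>Q. signature q * (dt (G q) t y)\<^sup>2) = P t \<and>
      (\<Sum>q\<in>Q. signature q * (dt (G q) t y * dy (G q) t y)) = 0 \<and>
      (\<Sum>q\<in>Q. signature q * (dy (G q) t y)\<^sup>2) = (\<eta> t)\<^sup>2 \<and>
      (\<Sum>q\<in>Q. signature q * (G q t y)\<^sup>2) = R t)"

text \<open>
  The counterpart of \<^const>\<open>recovers_parameter\<close> for the flat coordinate \<open>y\<close>, when \<open>t\<close> is already known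
  to converge. The points of the filter are the pairs \<open>(t, y)\<close>.
\<close>

definition recovers_line :: "real set \<Rightarrow> 'q set \<Rightarrow> ('q \<Rightarrow> real \<Rightarrow> real \<Rightarrow> real) \<Rightarrow> bool"
  where "recovers_line I Q G \<longleftrightarrow>
    (\<forall>F. \<forall>t0\<in>I. \<forall>y0. (fst \<longlongrightarrow> t0) F \<longrightarrow>
      (\<forall>q\<in>Q. ((\<lambda>z. G q (fst z) (snd z)) \<longlongrightarrow> G q t0 y0) F) \<longrightarrow> (snd \<longlongrightarrow> y0) F)"

text \<open>
  A hyperbola of radius \<open>\<eta>\<close> in the Lorentz plane. It adds the term \<open>-\<eta>'\<^sup>2 dt\<^sup>2\<close>, whose sign leaves more
  room for the profile curve, but its squared length \<open>-\<eta>\<^sup>2\<close> may be arbitrarily negative.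
\<close>

definition hyperbolic_line :: "(real \<Rightarrow> real) \<Rightarrow> bool \<times> 'j \<Rightarrow> real \<Rightarrow> real \<Rightarrow> real"
  where "hyperbolic_line \<eta> q t y = \<eta> t * (if fst q then cosh y else sinh y)"

lemma warped_line_hyperbolic:
  assumes "open I" "smooth1 I \<eta>"
  shows "warped_line I \<eta> (UNIV \<times> {j}) (hyperbolic_line \<eta>) (\<lambda>t. - (deriv \<eta> t)\<^sup>2) (\<lambda>t. - (\<eta> t)\<^sup>2)"
proof -
  have G: "hyperbolic_line \<eta> q = (\<lambda>t y. \<eta> t * (if fst q then cosh y else sinh y))" for q :: "bool \<times> 'a"
    by (simp add: hyperbolic_line_def fun_eq_iff)
  have "locally_product I (hyperbolic_line \<eta> q)" for q :: "bool \<times> 'a"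
    unfolding G
    by (rule product_locally_product[OF assms]) (cases "fst q", auto intro: smooth1_cosh smooth1_sinh)
  moreover have "dt (hyperbolic_line \<eta> q) t y = deriv \<eta> t * (if fst q then cosh y else sinh y)"
    if "t \<in> I" for q :: "bool \<times> 'a" and t y
    unfolding G by (rule dt_product[OF assms(2) that])
  moreover have "dy (hyperbolic_line \<eta> q) t y = \<eta> t * (if fst q then sinh y else cosh y)"
    for q :: "bool \<times> 'a" and t y
    unfolding G by (rule dy_product) (auto intro!: derivative_eq_intros)
  moreover have "(cosh y)\<^sup>2 = 1 + (sinh y)\<^sup>2" for y :: real by (simp add: cosh_square_eq)
  moreover have "(\<Sum>q\<in>UNIV \<times> {j}. f q) = f (True, j) + f (False, j)" for f :: "bool \<times> 'a \<Rightarrow> real"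
    by (simp add: UNIV_bool add.commute)
  ultimately show ?thesis
    by (auto simp: warped_line_def signature_def hyperbolic_line_def power_mult_distrib algebra_simps)
qed

lemma tendsto_cancel_factor:
  fixes g x :: "'z \<Rightarrow> real"
  assumes "((\<lambda>z. u (t z) * g z) \<longlongrightarrow> u t0 * l) F" "(t \<longlongrightarrow> t0) F"
    and u: "open J" "smooth1 J u" "t0 \<in> J" "u t0 \<noteq> 0"
  shows "(g \<longlongrightarrow> l) F"
proof -
  have ut: "((\<lambda>z. u (t z)) \<longlongrightarrow> u t0) F"
    by (rule isCont_tendsto_compose[OF smooth1_isCont[OF u(2,3)] assms(2)])
  have "((\<lambda>z. u (t z) * g z / u (t z)) \<longlongrightarrow> u t0 * l / u t0) F"
    by (rule tendsto_divide[OF assms(1) ut u(4)])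
  then have "((\<lambda>z. u (t z) * g z / u (t z)) \<longlongrightarrow> l) F" using u(4) by simp
  moreover have "\<forall>\<^sub>F z in F. u (t z) \<noteq> 0" using tendsto_imp_eventually_ne[OF ut u(4)] .
  then have "\<forall>\<^sub>F z in F. u (t z) * g z / u (t z) = g z" by eventually_elim simp
  ultimately show ?thesis by (rule Lim_transform_eventually)
qed

lemma recovers_line_hyperbolic:
  assumes I: "open I" and \<eta>: "smooth1 I \<eta>" "\<And>t. t \<in> I \<Longrightarrow> \<eta> t > 0"
  shows "recovers_line I (UNIV \<times> {j}) (hyperbolic_line \<eta>)"
  unfolding recovers_line_def
proof (intro allI ballI impI)
  fix F :: "(real \<times> real) filter" and t0 y0
  assume t0: "t0 \<in> I" and t: "(fst \<longlongrightarrow> t0) F"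
    and lim: "\<forall>q\<in>UNIV \<times> {j}. ((\<lambda>z. hyperbolic_line \<eta> q (fst z) (snd z)) \<longlongrightarrow> hyperbolic_line \<eta> q t0 y0) F"
  have "((\<lambda>z. sinh (snd z)) \<longlongrightarrow> sinh y0) F"
    by (rule tendsto_cancel_factor[where u = \<eta> and t = fst, OF _ t I \<eta>(1) t0])
      (use lim[THEN bspec, of "(False, j)"] \<eta>(2)[OF t0] in \<open>auto simp: hyperbolic_line_def\<close>)
  then show "(snd \<longlongrightarrow> y0) F"
    by (rule strict_mono_on_tendsto[OF open_UNIV, of sinh, rotated 3])
      (auto simp: strict_mono_on_def sinh_real_strict_mono)
qed

text \<open>
  A curve in the light cone, \<open>\<eta>\<close> times the null vector \<open>((1 + y\<^sup>2)/2; (1 - y\<^sup>2)/2, y)\<close>. Scaling a null vector costs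
  nothing, so this model induces exactly \<open>\<eta>\<^sup>2 dy\<^sup>2\<close> and has squared length 0, at the price of one more
  positive coordinate. This is the model for the target \<open>\<H>\<close>, where the length \<open>-\<eta>\<^sup>2\<close> of a hyperbola
  could exceed the available \<open>-1/c\<close>.
\<close>

definition horospheric_line :: "(real \<Rightarrow> real) \<Rightarrow> bool \<times> bool \<times> 'j \<Rightarrow> real \<Rightarrow> real \<Rightarrow> real"
  where "horospheric_line \<eta> q t y =
    \<eta> t * (if fst q then (1 + y\<^sup>2) / 2 else if fst (snd q) then (1 - y\<^sup>2) / 2 else y)"

lemma warped_line_horospheric:
  assumes "open I" "smooth1 I \<eta>"
  shows "warped_line I \<eta> {(True, False, j), (False, False, j), (False, True, j)} (horospheric_line \<eta>)
    (\<lambda>_. 0) (\<lambda>_. 0)"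
proof -
  define w where "w q y = (if fst q then (1 + y\<^sup>2) / 2 else if fst (snd q) then (1 - y\<^sup>2) / 2 else y)"
    for q :: "bool \<times> bool \<times> 'a" and y :: real
  define w' where "w' q y = (if fst q then y else if fst (snd q) then - y else 1)"
    for q :: "bool \<times> bool \<times> 'a" and y :: real
  have G: "horospheric_line \<eta> q = (\<lambda>t y. \<eta> t * w q y)" for q :: "bool \<times> bool \<times> 'a"
    by (simp add: horospheric_line_def fun_eq_iff w_def)
  have Dw: "(w q has_real_derivative w' q y) (at y)" for q :: "bool \<times> bool \<times> 'a" and y
  proof (cases "fst q")
    case True
    then show ?thesis unfolding w_def[abs_def] w'_def by (auto intro!: derivative_eq_intros)
  next
    case False
    then show ?thesis unfolding w_def[abs_def] w'_def
      by (cases "fst (snd q)") (auto intro!: derivative_eq_intros)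
  qed
  have sw: "smooth1 UNIV (w q)" for q :: "bool \<times> bool \<times> 'a"
  proof (rule smooth1I[OF Dw])
    show "smooth1 UNIV (w' q)"
      unfolding w'_def[abs_def] by (cases "fst q"; cases "fst (snd q)") (auto intro: smooth1_minus)
  qed
  have "locally_product I (horospheric_line \<eta> q)" for q :: "bool \<times> bool \<times> 'a"
    unfolding G by (rule product_locally_product[OF assms sw])
  moreover have "dt (horospheric_line \<eta> q) t y = deriv \<eta> t * w q y" if "t \<in> I"
    for q :: "bool \<times> bool \<times> 'a" and t y
    unfolding G by (rule dt_product[OF assms(2) that])
  moreover have "dy (horospheric_line \<eta> q) t y = \<eta> t * w' q y" for q :: "bool \<times> bool \<times> 'a" and t y
    unfolding G by (rule dy_product[OF Dw])
  ultimately show ?thesis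
    by (auto simp: warped_line_def signature_def G w_def w'_def power2_eq_square field_simps)
qed

lemma recovers_line_horospheric:
  assumes I: "open I" and \<eta>: "smooth1 I \<eta>" "\<And>t. t \<in> I \<Longrightarrow> \<eta> t > 0"
  shows "recovers_line I {(True, False, j), (False, False, j), (False, True, j)} (horospheric_line \<eta>)"
  unfolding recovers_line_def
proof (intro allI ballI impI)
  fix F :: "(real \<times> real) filter" and t0 y0
  assume t0: "t0 \<in> I" and t: "(fst \<longlongrightarrow> t0) F"
    and lim: "\<forall>q\<in>{(True, False, j), (False, False, j), (False, True, j)}.
      ((\<lambda>z. horospheric_line \<eta> q (fst z) (snd z)) \<longlongrightarrow> horospheric_line \<eta> q t0 y0) F"
  show "(snd \<longlongrightarrow> y0) F"
    by (rule tendsto_cancel_factor[where u = \<eta> and t = fst, OF _ t I \<eta>(1) t0])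
      (use lim[THEN bspec, of "(False, False, j)"] \<eta>(2)[OF t0] in \<open>auto simp: horospheric_line_def\<close>)
qed

definition blanusa_line ::
  "(nat \<Rightarrow> real \<Rightarrow> real) \<Rightarrow> (bool \<Rightarrow> real \<Rightarrow> real) \<Rightarrow> (bool \<Rightarrow> real \<Rightarrow> real) \<Rightarrow> bool \<times> bool \<times> nat
    \<Rightarrow> real \<Rightarrow> real \<Rightarrow> real"
  where "blanusa_line \<sigma> \<phi> S q t y =
    \<phi> (fst (snd q)) t * \<sigma> (snd (snd q)) (S (fst (snd q)) t * y)"

lemma dt_blanusa:
  assumes \<phi>: "smooth1 I \<phi>" and loc: "locally_zero_or_const I \<phi> S" and t: "t \<in> I"
  shows "dt (\<lambda>t y. \<phi> t * \<sigma> (S t * y)) t y = deriv \<phi> t * \<sigma> (S t * y)"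
proof -
  from loc[unfolded locally_zero_or_const_def, rule_format, OF t]
  obtain J where J: "open J" "t \<in> J" "(\<forall>t\<in>J. \<phi> t = 0) \<or> (\<exists>S0. \<forall>t\<in>J. S t = S0)"
    by (elim exE conjE)
  show ?thesis
    unfolding dt_def
  proof (rule DERIV_imp_deriv, rule has_field_derivative_transform_within_open[OF _ J(1,2)])
    show "((\<lambda>s. \<phi> s * \<sigma> (S t * y)) has_real_derivative deriv \<phi> t * \<sigma> (S t * y)) (at t)"
      by (rule DERIV_cmult_right[OF smooth1_DERIV[OF \<phi> t]])
    show "\<phi> x * \<sigma> (S t * y) = \<phi> x * \<sigma> (S x * y)" if "x \<in> J" for x
      using J(2,3) that by auto
  qed
qed

lemma locally_product_blanusa:
  assumes \<phi>: "smooth1 I \<phi>" and loc: "locally_zero_or_const I \<phi> S" and \<sigma>: "smooth1 UNIV \<sigma>"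
  shows "locally_product I (\<lambda>t y. \<phi> t * \<sigma> (S t * y))"
  unfolding locally_product_def
proof
  fix t0 assume "t0 \<in> I"
  from loc[unfolded locally_zero_or_const_def, rule_format, OF this]
  obtain J where J: "open J" "t0 \<in> J" "J \<subseteq> I" "(\<forall>t\<in>J. \<phi> t = 0) \<or> (\<exists>S0. \<forall>t\<in>J. S t = S0)"
    by (elim exE conjE)
  have "smooth1 J \<phi>" using \<phi> J(3) by (rule smooth1_subset)
  moreover have "\<exists>w. smooth1 UNIV w \<and> (\<forall>t\<in>J. \<forall>y. \<phi> t * \<sigma> (S t * y) = \<phi> t * w y)"
    using J(4)
  proof
    assume "\<forall>t\<in>J. \<phi> t = 0"
    then show ?thesis by (intro exI[of _ "\<lambda>_. 0"]) simp
  next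
    assume "\<exists>S0. \<forall>t\<in>J. S t = S0"
    then obtain S0 where "\<forall>t\<in>J. S t = S0" ..
    moreover have "smooth1 UNIV (\<lambda>y. \<sigma> (S0 * y))"
      by (rule smooth1_compose[OF \<sigma>]) (auto intro: smooth1_mult)
    ultimately show ?thesis by (intro exI[of _ "\<lambda>y. \<sigma> (S0 * y)"]) simp
  qed
  then obtain w where "smooth1 UNIV w" "\<forall>t\<in>J. \<forall>y. \<phi> t * \<sigma> (S t * y) = \<phi> t * w y" by blast
  ultimately show "\<exists>J u w. open J \<and> t0 \<in> J \<and> J \<subseteq> I \<and> smooth1 J u \<and> smooth1 UNIV w \<and>
      (\<forall>t\<in>J. \<forall>y. \<phi> t * \<sigma> (S t * y) = u t * w y)"
    using J(1-3) by (intro exI[of _ J] exI[of _ \<phi>] exI[of _ w]) simp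
qed

lemma warped_line_blanusa:
  assumes \<sigma>: "unit_sphere_curve N \<sigma>"
    and \<phi>: "\<And>b. smooth1 I (\<phi> b)" "\<And>b. locally_zero_or_const I (\<phi> b) (S b)"
    and \<eta>: "\<And>t. t \<in> I \<Longrightarrow> (\<Sum>b\<in>UNIV. (\<phi> b t)\<^sup>2 * (S b t)\<^sup>2) = (\<eta> t)\<^sup>2"
  shows "warped_line I \<eta> ({False} \<times> UNIV \<times> {..<N}) (blanusa_line \<sigma> \<phi> S)
    (\<lambda>t. \<Sum>b\<in>UNIV. (deriv (\<phi> b) t)\<^sup>2) (\<lambda>t. \<Sum>b\<in>UNIV. (\<phi> b t)\<^sup>2)"
proof -
  let ?Q = "{False} \<times> (UNIV :: bool set) \<times> {..<N}"
  have G: "blanusa_line \<sigma> \<phi> S (False, b, j) = (\<lambda>t y. \<phi> b t * \<sigma> j (S b t * y))" for b j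
    by (simp add: blanusa_line_def fun_eq_iff)
  have sum_Q: "(\<Sum>q\<in>?Q. f q) = (\<Sum>b\<in>UNIV. \<Sum>j<N. f (False, b, j))" for f :: "bool \<times> bool \<times> nat \<Rightarrow> real"
  proof -
    have "(\<Sum>q\<in>?Q. f q) = (\<Sum>r\<in>UNIV \<times> {..<N}. f (False, r))"
      by (rule sum.reindex_bij_witness[of _ "\<lambda>r. (False, r)" snd]) auto
    then show ?thesis by (simp add: sum.cartesian_product case_prod_unfold)
  qed
  have s\<sigma>: "smooth1 UNIV (\<sigma> j)" if "j < N" for j using \<sigma> that by (simp add: unit_sphere_curve_def)
  have dt: "dt (blanusa_line \<sigma> \<phi> S (False, b, j)) t y = deriv (\<phi> b) t * \<sigma> j (S b t * y)"
    if "t \<in> I" for b j t y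
    unfolding G by (rule dt_blanusa[OF \<phi> that])
  have dy: "dy (blanusa_line \<sigma> \<phi> S (False, b, j)) t y = \<phi> b t * S b t * deriv (\<sigma> j) (S b t * y)"
    if "j < N" for b j t y
    unfolding G dy_def
    by (rule DERIV_imp_deriv)
      (auto intro!: derivative_eq_intros DERIV_chain2[OF unit_sphere_curve_DERIV[OF \<sigma> that]])
  have unit: "(\<Sum>j<N. c * (\<sigma> j x)\<^sup>2) = c" "(\<Sum>j<N. c * (deriv (\<sigma> j) x)\<^sup>2) = c"
    "(\<Sum>j<N. c * (\<sigma> j x * deriv (\<sigma> j) x)) = 0" for c x
    using \<sigma> unit_sphere_curve_orthogonal[OF \<sigma>, of x]
    by (simp_all add: unit_sphere_curve_def flip: sum_distrib_left)
  show ?thesis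
    unfolding warped_line_def
  proof (intro conjI ballI allI)
    show "locally_product I (blanusa_line \<sigma> \<phi> S q)" if "q \<in> ?Q" for q
    proof -
      from that obtain b j where q: "q = (False, b, j)" "j < N" by auto
      show ?thesis unfolding q(1) G by (rule locally_product_blanusa[OF \<phi> s\<sigma>[OF q(2)]])
    qed
    fix t y assume t: "t \<in> I"
    show "(\<Sum>q\<in>?Q. signature q * (dt (blanusa_line \<sigma> \<phi> S q) t y)\<^sup>2) = (\<Sum>b\<in>UNIV. (deriv (\<phi> b) t)\<^sup>2)"
      unfolding sum_Q by (simp add: signature_def dt[OF t] power_mult_distrib unit)
    have "(\<Sum>q\<in>?Q. signature q * (dt (blanusa_line \<sigma> \<phi> S q) t y * dy (blanusa_line \<sigma> \<phi> S q) t y))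
        = (\<Sum>b\<in>UNIV. \<Sum>j<N. deriv (\<phi> b) t * \<phi> b t * S b t * (\<sigma> j (S b t * y) * deriv (\<sigma> j) (S b t * y)))"
      unfolding sum_Q by (intro sum.cong refl) (simp add: signature_def dt[OF t] dy)
    then show "(\<Sum>q\<in>?Q. signature q * (dt (blanusa_line \<sigma> \<phi> S q) t y * dy (blanusa_line \<sigma> \<phi> S q) t y)) = 0"
      unfolding unit by simp
    have "(\<Sum>q\<in>?Q. signature q * (dy (blanusa_line \<sigma> \<phi> S q) t y)\<^sup>2)
        = (\<Sum>b\<in>UNIV. \<Sum>j<N. (\<phi> b t)\<^sup>2 * (S b t)\<^sup>2 * (deriv (\<sigma> j) (S b t * y))\<^sup>2)"
      unfolding sum_Q by (intro sum.cong refl) (simp add: signature_def dy power_mult_distrib)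
    then show "(\<Sum>q\<in>?Q. signature q * (dy (blanusa_line \<sigma> \<phi> S q) t y)\<^sup>2) = (\<eta> t)\<^sup>2"
      unfolding unit \<eta>[OF t] .
    show "(\<Sum>q\<in>?Q. signature q * (blanusa_line \<sigma> \<phi> S q t y)\<^sup>2) = (\<Sum>b\<in>UNIV. (\<phi> b t)\<^sup>2)"
      unfolding sum_Q by (simp add: signature_def G power_mult_distrib unit)
  qed simp
qed

text \<open>
  At \<open>t\<^sub>0\<close> some \<open>\<phi>\<^sub>b\<close> is nonzero, because \<open>\<Sum>\<phi>\<^sub>b\<^sup>2 S\<^sub>b\<^sup>2 = \<eta>\<^sup>2 > 0\<close>. Then \<open>S\<^sub>b\<close> is constant near \<open>t\<^sub>0\<close>, and
  \<open>\<sigma>(S\<^sub>b y)\<close> is obtained by division by \<open>\<phi>\<^sub>b\<close>.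
\<close>

lemma recovers_line_blanusa:
  assumes I: "open I" and \<sigma>: "recovers_parameter UNIV {..<N} \<sigma>"
    and \<phi>: "\<And>b. smooth1 I (\<phi> b)" "\<And>b. locally_zero_or_const I (\<phi> b) (S b)" "\<And>b t. S b t > 0"
    and \<eta>: "\<And>t. t \<in> I \<Longrightarrow> (\<Sum>b\<in>UNIV. (\<phi> b t)\<^sup>2 * (S b t)\<^sup>2) = (\<eta> t)\<^sup>2" "\<And>t. t \<in> I \<Longrightarrow> \<eta> t > 0"
  shows "recovers_line I ({False} \<times> UNIV \<times> {..<N}) (blanusa_line \<sigma> \<phi> S)"
  unfolding recovers_line_def
proof (intro allI ballI impI)
  fix F :: "(real \<times> real) filter" and t0 y0
  assume t0: "t0 \<in> I" and t: "(fst \<longlongrightarrow> t0) F"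
    and lim: "\<forall>q\<in>{False} \<times> UNIV \<times> {..<N}.
      ((\<lambda>z. blanusa_line \<sigma> \<phi> S q (fst z) (snd z)) \<longlongrightarrow> blanusa_line \<sigma> \<phi> S q t0 y0) F"
  obtain b where b: "\<phi> b t0 \<noteq> 0"
    using \<eta>(1)[OF t0] \<eta>(2)[OF t0] by (fastforce simp: UNIV_bool)
  from \<phi>(2)[of b, unfolded locally_zero_or_const_def, rule_format, OF t0]
  obtain J where J: "open J" "t0 \<in> J" "(\<forall>t\<in>J. \<phi> b t = 0) \<or> (\<exists>S0. \<forall>t\<in>J. S b t = S0)"
    by (elim exE conjE)
  then have const: "\<forall>t\<in>J. S b t = S b t0" using b by auto
  have inJ: "\<forall>\<^sub>F z in F. fst z \<in> J" using topological_tendstoD[OF t J(1,2)] .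
  let ?x = "\<lambda>z :: real \<times> real. S b (fst z) * snd z"
  have "((\<lambda>z. \<sigma> j (?x z)) \<longlongrightarrow> \<sigma> j (S b t0 * y0)) F" if "j < N" for j
    by (rule tendsto_cancel_factor[where u = "\<phi> b" and t = fst, OF _ t I \<phi>(1) t0])
      (use lim[THEN bspec, of "(False, b, j)"] that b in \<open>auto simp: blanusa_line_def\<close>)
  then have "((\<lambda>x. x) \<longlongrightarrow> S b t0 * y0) (filtermap ?x F)"
    using \<sigma>[unfolded recovers_parameter_def, rule_format, of "S b t0 * y0" "filtermap ?x F"]
    by (simp add: filterlim_filtermap)
  then have "((\<lambda>z. ?x z / S b t0) \<longlongrightarrow> S b t0 * y0 / S b t0) F"
    using \<phi>(3)[of b t0] by (intro tendsto_divide tendsto_const) (auto simp: filterlim_filtermap)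
  then have "((\<lambda>z. ?x z / S b t0) \<longlongrightarrow> y0) F" using \<phi>(3)[of b t0] by simp
  moreover have "\<forall>\<^sub>F z in F. ?x z / S b t0 = snd z"
    using inJ by eventually_elim (use const \<phi>(3)[of b t0] in simp)
  ultimately show "(snd \<longlongrightarrow> y0) F" by (rule Lim_transform_eventually)
qed

section \<open>Profile curves\<close>

text \<open>
  The coordinates that depend on \<open>t\<close> only. They have to supply the part \<open>g(t) dt\<^sup>2\<close> of the metric that
  the flat directions leave over, and in a quadric also the missing squared length.
\<close>

definition profile_curve ::
  "real set \<Rightarrow> (real \<Rightarrow> real) \<Rightarrow> (bool \<times> 'j) set \<Rightarrow> (bool \<times> 'j \<Rightarrow> real \<Rightarrow> real) \<Rightarrow> (real \<Rightarrow> real) \<Rightarrow> bool"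
  where "profile_curve I g Q u R \<longleftrightarrow> finite Q \<and> (\<forall>q\<in>Q. smooth1 I (u q)) \<and>
    (\<forall>t\<in>I. (\<Sum>q\<in>Q. signature q * (deriv (u q) t)\<^sup>2) = g t \<and> (\<Sum>q\<in>Q. signature q * (u q t)\<^sup>2) = R t)"

lemma primitive_of_sqrt:
  assumes I: "open I" "is_interval I" and g: "smooth1 I g" "\<And>t. t \<in> I \<Longrightarrow> g t > 0"
  shows "\<exists>\<theta>. smooth1 I \<theta> \<and> (\<forall>t\<in>I. (deriv \<theta> t)\<^sup>2 = g t) \<and> strict_mono_on I \<theta>"
proof -
  have "smooth1 I (\<lambda>t. sqrt (g t))" by (rule smooth1_sqrt[OF g])
  from smooth1_antiderivative[OF I this]
  obtain \<theta> where \<theta>: "smooth1 I \<theta>" "\<And>t. t \<in> I \<Longrightarrow> (\<theta> has_real_derivative sqrt (g t)) (at t)"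
    by auto
  show ?thesis
  proof (intro exI[of _ \<theta>] conjI ballI \<theta>(1))
    show "(deriv \<theta> t)\<^sup>2 = g t" if "t \<in> I" for t
      using DERIV_imp_deriv[OF \<theta>(2)[OF that]] g(2)[OF that] by simp
    show "strict_mono_on I \<theta>"
      by (rule DERIV_pos_imp_strict_mono_on[OF I(2) \<theta>(2)]) (use g(2) in auto)
  qed
qed

lemma profile_curve_line:
  assumes I: "open I" "is_interval I" and g: "smooth1 I g" "\<And>t. t \<in> I \<Longrightarrow> g t > 0"
  shows "\<exists>u R. profile_curve I g {(False, j)} u R \<and> recovers_parameter I {(False, j)} u"
proof -
  obtain \<theta> where \<theta>: "smooth1 I \<theta>" "\<And>t. t \<in> I \<Longrightarrow> (deriv \<theta> t)\<^sup>2 = g t" "strict_mono_on I \<theta>"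
    using primitive_of_sqrt[OF I g] by auto
  have "profile_curve I g {(False, j)} (\<lambda>_. \<theta>) (\<lambda>t. (\<theta> t)\<^sup>2)"
    using \<theta>(1,2) by (simp add: profile_curve_def signature_def)
  moreover have "recovers_parameter I {(False, j)} (\<lambda>_. \<theta>)"
    unfolding recovers_parameter_def using strict_mono_on_tendsto[OF I(1) \<theta>(3)] by auto
  ultimately show ?thesis by blast
qed

lemma DERIV_spherical_factor:
  assumes "smooth1 I r" "smooth1 I \<theta>" "t \<in> I" "(w has_real_derivative w') (at (\<theta> t))"
  shows "deriv (\<lambda>t. r t * w (\<theta> t)) t = deriv r t * w (\<theta> t) + r t * deriv \<theta> t * w'"
  by (rule DERIV_imp_deriv)
    (use DERIV_mult[OF smooth1_DERIV[OF assms(1,3)] DERIV_chain2[OF assms(4) smooth1_DERIV[OF assms(2,3)]]]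
      in \<open>simp add: mult_ac\<close>)

text \<open>
  The curve \<open>r \<sigma>(\<theta>)\<close> has squared length \<open>r\<^sup>2\<close> and squared speed \<open>r'\<^sup>2 + r\<^sup>2 \<theta>'\<^sup>2\<close>, an equation that is
  solved for \<open>\<theta>'\<close>. For recovery, \<open>r\<close> is found as the length of the curve, then \<open>\<theta>\<close> from \<open>\<sigma>\<close>, then
  \<open>t\<close> by monotonicity.
\<close>

lemma profile_curve_spherical:
  assumes I: "open I" "is_interval I" and g: "smooth1 I g" and \<sigma>: "unit_sphere_curve N \<sigma>"
    and r: "smooth1 I r" "\<And>t. t \<in> I \<Longrightarrow> r t > 0" "\<And>t. t \<in> I \<Longrightarrow> g t - (deriv r t)\<^sup>2 > 0"
  shows "\<exists>u. profile_curve I g ({False} \<times> {b} \<times> {..<N}) u (\<lambda>t. (r t)\<^sup>2) \<and>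
    (recovers_parameter UNIV {..<N} \<sigma> \<longrightarrow> recovers_parameter I ({False} \<times> {b} \<times> {..<N}) u)"
proof -
  let ?Q = "{False} \<times> {b} \<times> {..<N}"
  have sm: "smooth1 I (\<lambda>t. (g t - (deriv r t)\<^sup>2) / (r t)\<^sup>2)"
    using r(2) by (intro smooth1_divide smooth1_diff smooth1_power smooth1_deriv I(1) g r(1)) force
  have "(g t - (deriv r t)\<^sup>2) / (r t)\<^sup>2 > 0" if "t \<in> I" for t
    using r(2,3)[OF that] by simp
  from primitive_of_sqrt[OF I sm this]
  obtain \<theta> where \<theta>: "smooth1 I \<theta>" "\<And>t. t \<in> I \<Longrightarrow> (deriv \<theta> t)\<^sup>2 = (g t - (deriv r t)\<^sup>2) / (r t)\<^sup>2"
      "strict_mono_on I \<theta>"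
    by auto
  define u where "u q t = r t * \<sigma> (snd (snd q)) (\<theta> t)" for q :: "bool \<times> 'a \<times> nat" and t
  have sum_Q: "(\<Sum>q\<in>?Q. f q) = (\<Sum>j<N. f (False, b, j))" for f :: "bool \<times> 'a \<times> nat \<Rightarrow> real"
    by (rule sum.reindex_bij_witness[of _ "\<lambda>j. (False, b, j)" "snd \<circ> snd"]) auto
  have du: "deriv (u (False, b, j)) t = deriv r t * \<sigma> j (\<theta> t) + r t * deriv \<theta> t * deriv (\<sigma> j) (\<theta> t)"
    if "t \<in> I" "j < N" for t j
    using DERIV_spherical_factor[OF r(1) \<theta>(1) that(1) unit_sphere_curve_DERIV[OF \<sigma> that(2)]]
    by (simp add: u_def[abs_def])
  have unit: "(\<Sum>j<N. c * (\<sigma> j x)\<^sup>2) = c" "(\<Sum>j<N. c * (deriv (\<sigma> j) x)\<^sup>2) = c"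
    "(\<Sum>j<N. c * (\<sigma> j x * deriv (\<sigma> j) x)) = 0" for c x
    using \<sigma> unit_sphere_curve_orthogonal[OF \<sigma>, of x]
    by (simp_all add: unit_sphere_curve_def flip: sum_distrib_left)
  have norm: "(\<Sum>j<N. (r t * \<sigma> j (\<theta> t))\<^sup>2) = (r t)\<^sup>2" for t
    by (simp add: power_mult_distrib unit)
  have "profile_curve I g ?Q u (\<lambda>t. (r t)\<^sup>2)"
    unfolding profile_curve_def
  proof (intro conjI ballI)
    show "smooth1 I (u q)" if "q \<in> ?Q" for q
    proof -
      have s: "smooth1 UNIV (\<sigma> (snd (snd q)))" using that \<sigma> by (auto simp: unit_sphere_curve_def)
      show ?thesis unfolding u_def[abs_def]
        by (intro smooth1_mult r(1)) (rule smooth1_compose[OF s \<theta>(1)], simp)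
    qed
    fix t assume t: "t \<in> I"
    have "(\<Sum>q\<in>?Q. signature q * (deriv (u q) t)\<^sup>2)
        = (\<Sum>j<N. (deriv r t)\<^sup>2 * (\<sigma> j (\<theta> t))\<^sup>2 + (r t * deriv \<theta> t)\<^sup>2 * (deriv (\<sigma> j) (\<theta> t))\<^sup>2
            + 2 * deriv r t * r t * deriv \<theta> t * (\<sigma> j (\<theta> t) * deriv (\<sigma> j) (\<theta> t)))"
      unfolding sum_Q by (intro sum.cong refl) (simp add: signature_def du[OF t] power2_eq_square algebra_simps)
    also have "\<dots> = (deriv r t)\<^sup>2 + (r t * deriv \<theta> t)\<^sup>2"
      by (simp only: sum.distrib unit)
    also have "\<dots> = g t"
      using r(2)[OF t] \<theta>(2)[OF t] by (simp add: power_mult_distrib)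
    finally show "(\<Sum>q\<in>?Q. signature q * (deriv (u q) t)\<^sup>2) = g t" .
    show "(\<Sum>q\<in>?Q. signature q * (u q t)\<^sup>2) = (r t)\<^sup>2"
      unfolding sum_Q by (simp add: signature_def u_def norm)
  qed simp
  moreover have "recovers_parameter I ?Q u" if rec: "recovers_parameter UNIV {..<N} \<sigma>"
    unfolding recovers_parameter_def
  proof (intro allI ballI impI)
    fix F :: "real filter" and t0
    assume t0: "t0 \<in> I" and inI: "\<forall>\<^sub>F t in F. t \<in> I" and lim: "\<forall>q\<in>?Q. (u q \<longlongrightarrow> u q t0) F"
    have lim': "((\<lambda>t. r t * \<sigma> j (\<theta> t)) \<longlongrightarrow> r t0 * \<sigma> j (\<theta> t0)) F" if "j < N" for j
      using lim[THEN bspec, of "(False, b, j)"] that by (simp add: u_def[abs_def])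
    have "((\<lambda>t. sqrt (\<Sum>j<N. (r t * \<sigma> j (\<theta> t))\<^sup>2)) \<longlongrightarrow> sqrt (\<Sum>j<N. (r t0 * \<sigma> j (\<theta> t0))\<^sup>2)) F"
      by (intro tendsto_real_sqrt tendsto_sum tendsto_power lim') simp
    then have "((\<lambda>t. \<bar>r t\<bar>) \<longlongrightarrow> r t0) F" using r(2)[OF t0] by (simp add: norm)
    then have rt: "(r \<longlongrightarrow> r t0) F"
      by (rule Lim_transform_eventually) (use inI in eventually_elim, use r(2) in force)
    have "((\<lambda>t. \<sigma> j (\<theta> t)) \<longlongrightarrow> \<sigma> j (\<theta> t0)) F" if "j < N" for j
    proof -
      have "((\<lambda>t. r t * \<sigma> j (\<theta> t) / r t) \<longlongrightarrow> r t0 * \<sigma> j (\<theta> t0) / r t0) F"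
        using r(2)[OF t0] by (intro tendsto_divide lim'[OF that] rt) simp
      then have "((\<lambda>t. r t * \<sigma> j (\<theta> t) / r t) \<longlongrightarrow> \<sigma> j (\<theta> t0)) F" using r(2)[OF t0] by simp
      then show ?thesis
        by (rule Lim_transform_eventually) (use inI in eventually_elim, use r(2) in force)
    qed
    then have "((\<lambda>x. x) \<longlongrightarrow> \<theta> t0) (filtermap \<theta> F)"
      using rec[unfolded recovers_parameter_def, rule_format, of "\<theta> t0" "filtermap \<theta> F"]
      by (simp add: filterlim_filtermap)
    then show "((\<lambda>t. t) \<longlongrightarrow> t0) F"
      using strict_mono_on_tendsto[OF I(1) \<theta>(3) t0, of "\<lambda>t. t" F] inI by (simp add: filterlim_filtermap)
  qed
  ultimately show ?thesis by blast
qed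

text \<open>
  As before, with \<open>(r cosh \<theta>; r sinh \<theta>)\<close> of squared speed \<open>-r'\<^sup>2 + r\<^sup>2 \<theta>'\<^sup>2\<close>. The quotient of the two
  coordinates is \<open>tanh \<theta>\<close>, a strictly increasing function of \<open>t\<close>.
\<close>

lemma profile_curve_hyperbolic:
  assumes I: "open I" "is_interval I" and g: "smooth1 I g"
    and r: "smooth1 I r" "\<And>t. t \<in> I \<Longrightarrow> r t > 0" "\<And>t. t \<in> I \<Longrightarrow> g t + (deriv r t)\<^sup>2 > 0"
  shows "\<exists>u. profile_curve I g (UNIV \<times> {j}) u (\<lambda>t. - (r t)\<^sup>2) \<and>
    recovers_parameter I (UNIV \<times> {j}) u"
proof -
  let ?Q = "(UNIV :: bool set) \<times> {j}"
  have sm: "smooth1 I (\<lambda>t. (g t + (deriv r t)\<^sup>2) / (r t)\<^sup>2)"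
    using r(2) by (intro smooth1_divide smooth1_add smooth1_power smooth1_deriv I(1) g r(1)) force
  have "(g t + (deriv r t)\<^sup>2) / (r t)\<^sup>2 > 0" if "t \<in> I" for t
    using r(2,3)[OF that] by simp
  from primitive_of_sqrt[OF I sm this]
  obtain \<theta> where \<theta>: "smooth1 I \<theta>" "\<And>t. t \<in> I \<Longrightarrow> (deriv \<theta> t)\<^sup>2 = (g t + (deriv r t)\<^sup>2) / (r t)\<^sup>2"
      "strict_mono_on I \<theta>"
    by auto
  define u where "u q t = r t * (if fst q then cosh (\<theta> t) else sinh (\<theta> t))" for q :: "bool \<times> 'a" and t
  have sum_Q: "(\<Sum>q\<in>?Q. f q) = f (True, j) + f (False, j)" for f :: "bool \<times> 'a \<Rightarrow> real"
    by (simp add: UNIV_bool add.commute)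
  have du: "deriv (u (True, j)) t = deriv r t * cosh (\<theta> t) + r t * deriv \<theta> t * sinh (\<theta> t)"
    "deriv (u (False, j)) t = deriv r t * sinh (\<theta> t) + r t * deriv \<theta> t * cosh (\<theta> t)"
    if "t \<in> I" for t
  proof -
    have "(cosh has_real_derivative sinh (\<theta> t)) (at (\<theta> t))" "(sinh has_real_derivative cosh (\<theta> t)) (at (\<theta> t))"
      by (auto intro!: derivative_eq_intros)
    from this[THEN DERIV_spherical_factor[OF r(1) \<theta>(1) that]]
    show "deriv (u (True, j)) t = deriv r t * cosh (\<theta> t) + r t * deriv \<theta> t * sinh (\<theta> t)"
      "deriv (u (False, j)) t = deriv r t * sinh (\<theta> t) + r t * deriv \<theta> t * cosh (\<theta> t)"
      by (simp_all add: u_def[abs_def])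
  qed
  have "profile_curve I g ?Q u (\<lambda>t. - (r t)\<^sup>2)"
    unfolding profile_curve_def
  proof (intro conjI ballI)
    show "smooth1 I (u q)" for q
      unfolding u_def[abs_def]
      by (cases "fst q") (auto intro!: smooth1_mult r(1) smooth1_cosh smooth1_sinh \<theta>(1))
    fix t assume t: "t \<in> I"
    have ch: "(cosh (\<theta> t))\<^sup>2 = 1 + (sinh (\<theta> t))\<^sup>2" by (simp add: cosh_square_eq)
    have "(\<Sum>q\<in>?Q. signature q * (deriv (u q) t)\<^sup>2) = (r t * deriv \<theta> t)\<^sup>2 - (deriv r t)\<^sup>2"
      unfolding sum_Q using ch by (simp add: signature_def du[OF t]) algebra
    also have "\<dots> = g t"
      using r(2)[OF t] \<theta>(2)[OF t] by (simp add: power_mult_distrib)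
    finally show "(\<Sum>q\<in>?Q. signature q * (deriv (u q) t)\<^sup>2) = g t" .
    show "(\<Sum>q\<in>?Q. signature q * (u q t)\<^sup>2) = - (r t)\<^sup>2"
      unfolding sum_Q using ch by (simp add: signature_def u_def power_mult_distrib algebra_simps)
  qed simp
  moreover have "recovers_parameter I ?Q u"
    unfolding recovers_parameter_def
  proof (intro allI ballI impI)
    fix F :: "real filter" and t0
    assume t0: "t0 \<in> I" and inI: "\<forall>\<^sub>F t in F. t \<in> I" and lim: "\<forall>q\<in>?Q. (u q \<longlongrightarrow> u q t0) F"
    have "((\<lambda>t. u (False, j) t / u (True, j) t) \<longlongrightarrow> u (False, j) t0 / u (True, j) t0) F"
    proof (rule tendsto_divide)
      show "u (True, j) t0 \<noteq> 0" using r(2)[OF t0] by (simp add: u_def)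
    qed (use lim in auto)
    then have "((\<lambda>t. u (False, j) t / u (True, j) t) \<longlongrightarrow> tanh (\<theta> t0)) F"
      using r(2)[OF t0] by (simp add: u_def tanh_def)
    then have "((\<lambda>t. tanh (\<theta> t)) \<longlongrightarrow> tanh (\<theta> t0)) F"
    proof (rule Lim_transform_eventually)
      show "\<forall>\<^sub>F t in F. u (False, j) t / u (True, j) t = tanh (\<theta> t)"
        using inI by eventually_elim (use r(2) in \<open>force simp: u_def tanh_def\<close>)
    qed
    moreover have "strict_mono_on I (\<lambda>t. tanh (\<theta> t))"
      using \<theta>(3) by (auto simp: strict_mono_on_def)
    ultimately show "((\<lambda>t. t) \<longlongrightarrow> t0) F"
      using strict_mono_on_tendsto[OF I(1) _ t0, of "\<lambda>t. tanh (\<theta> t)" "\<lambda>t. t" F] inI by simp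
  qed
  ultimately show ?thesis by blast
qed

section \<open>Composing with locally product functions\<close>

text \<open>
  The chain rule for \<open>G(t, Y)\<close>, where \<open>t\<close> is coordinate 0 of the chart of the warped product.
\<close>

lemma smooth_on_locally_product:
  assumes V: "openin (Euclidean_space d) V" "\<And>x. x \<in> V \<Longrightarrow> x 0 \<in> I"
    and G: "locally_product I G" and Y: "smooth_on d V Y"
  shows "smooth_on d V (\<lambda>x. G (x 0) (Y x))"
    and "\<And>x i. x \<in> V \<Longrightarrow> i < d \<Longrightarrow> partial_deriv i (\<lambda>x. G (x 0) (Y x)) x =
      dt G (x 0) (Y x) * (if i = 0 then 1 else 0) + dy G (x 0) (Y x) * partial_deriv i Y x"
proof -
  have Ck_Y: "Ck_on d r V Y" for r using Y by (simp add: smooth_on_def)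
  have local: "\<exists>W. openin (Euclidean_space d) W \<and> openin (top_of_set V) W \<and> x \<in> W \<and>
      (\<forall>r. Ck_on d r W (\<lambda>x. G (x 0) (Y x))) \<and>
      (\<forall>i<d. has_partial i (\<lambda>x. G (x 0) (Y x))
        (dt G (x 0) (Y x) * (if i = 0 then 1 else 0) + dy G (x 0) (Y x) * partial_deriv i Y x) x)"
    if x: "x \<in> V" for x
  proof -
    from locally_productE[OF G V(2)[OF x]]
    obtain J u w where J: "open J" "x 0 \<in> J" "J \<subseteq> I" "smooth1 J u" "smooth1 UNIV w"
      and eq: "\<And>t y. t \<in> J \<Longrightarrow> G t y = u t * w y"
        "\<And>t y. t \<in> J \<Longrightarrow> dt G t y = deriv u t * w y" "\<And>t y. t \<in> J \<Longrightarrow> dy G t y = u t * deriv w y"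
      by metis
    define T where "T = (\<lambda>x :: nat \<Rightarrow> real. x 0) -` J"
    define W where "W = V \<inter> T"
    have "open T"
      unfolding T_def using J(1) continuous_on_product_coordinates by (rule open_vimage)
    then have W: "openin (Euclidean_space d) W" "openin (top_of_set V) W"
      using V(1) by (auto simp: W_def Euclidean_space_eq_top_of_set intro: openin_Int_open)
    have inJ: "y 0 \<in> J" if "y \<in> W" for y using that by (simp add: W_def T_def)
    have xW: "x \<in> W" using x J(2) by (simp add: W_def T_def)
    have CkW: "Ck_on d r W Y" for r using Ck_Y by (rule Ck_on_subset) (simp add: W_def)
    have cu: "Ck_on d r W (\<lambda>x. u (x 0))" for r
      by (rule Ck_on_compose[OF W(1) Ck_on_coordinate[OF W(1)] inJ J(1,4)])
    have cw: "Ck_on d r W (\<lambda>x. w (Y x))" for r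
      by (rule Ck_on_compose[OF W(1) CkW _ open_UNIV J(5)]) simp
    have "Ck_on d r W (\<lambda>x. G (x 0) (Y x))" for r
      by (rule Ck_on_cong[OF W(1) _ Ck_on_mult[OF W(1) cu cw]]) (simp add: eq(1) inJ)
    moreover have "has_partial i (\<lambda>x. G (x 0) (Y x))
        (dt G (x 0) (Y x) * (if i = 0 then 1 else 0) + dy G (x 0) (Y x) * partial_deriv i Y x) x"
      if i: "i < d" for i
    proof -
      have pu: "has_partial i (\<lambda>x. u (x 0)) (deriv u (x 0) * (if i = 0 then 1 else 0)) x"
        by (rule has_partial_compose[where f = "\<lambda>x. x 0" and h = u, OF has_partial_coordinate[of i 0 x] smooth1_DERIV[OF J(4,2)]])
      have pw: "has_partial i (\<lambda>x. w (Y x)) (deriv w (Y x) * partial_deriv i Y x) x"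
        by (rule has_partial_compose[where f = Y and h = w, OF Ck_on_imp_has_partial[OF Ck_Y x i] smooth1_DERIV[OF J(5)]]) simp
      have "has_partial i (\<lambda>x. u (x 0) * w (Y x))
        (dt G (x 0) (Y x) * (if i = 0 then 1 else 0) + dy G (x 0) (Y x) * partial_deriv i Y x) x"
        using has_partial_mult[OF pu pw] by (simp add: eq J(2) mult_ac)
      then show ?thesis
        by (subst has_partial_cong[OF W(1) xW i, of _ "\<lambda>x. u (x 0) * w (Y x)"]) (simp_all add: eq(1) inJ)
    qed
    ultimately show ?thesis using W xW by blast
  qed
  show "smooth_on d V (\<lambda>x. G (x 0) (Y x))"
    unfolding smooth_on_def
  proof
    fix r show "Ck_on d r V (\<lambda>x. G (x 0) (Y x))"
    proof (rule Ck_on_local)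
      fix x assume "x \<in> V"
      from local[OF this] show "\<exists>W. openin (top_of_set V) W \<and> x \<in> W \<and> Ck_on d r W (\<lambda>x. G (x 0) (Y x))"
        by blast
    qed
  qed
  show "partial_deriv i (\<lambda>x. G (x 0) (Y x)) x =
      dt G (x 0) (Y x) * (if i = 0 then 1 else 0) + dy G (x 0) (Y x) * partial_deriv i Y x"
    if "x \<in> V" "i < d" for x i
    using local[OF that(1)] that(2) has_partial_imp_partial_deriv by blast
qed

lemma locally_product_continuous:
  assumes "open I" "locally_product I G"
  shows "continuous_on (I \<times> UNIV) (\<lambda>z. G (fst z) (snd z))"
proof (rule continuous_at_imp_continuous_on, rule ballI)
  fix z :: "real \<times> real" assume "z \<in> I \<times> UNIV"
  then have "fst z \<in> I" by auto
  from locally_productE[OF assms(2) this]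
  obtain J u w where J: "open J" "fst z \<in> J" "J \<subseteq> I" "smooth1 J u" "smooth1 UNIV w"
    and eq: "\<And>t y. t \<in> J \<Longrightarrow> G t y = u t * w y"
    by metis
  have "continuous_on (J \<times> UNIV) (\<lambda>z. u (fst z) * w (snd z))"
    by (intro continuous_intros continuous_on_compose2[OF smooth1_continuous_on[OF J(4)]]
        continuous_on_compose2[OF smooth1_continuous_on[OF J(5)]]) auto
  then have cont: "continuous_on (J \<times> UNIV) (\<lambda>z. G (fst z) (snd z))"
    by (rule continuous_on_eq) (auto simp: eq)
  have op: "open (J \<times> (UNIV :: real set))" using J(1) by (intro open_Times) auto
  have "z \<in> J \<times> UNIV" using J(2) by (simp add: mem_Times_iff)
  with cont show "isCont (\<lambda>z. G (fst z) (snd z)) z"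
    unfolding continuous_on_eq_continuous_at[OF op] by (rule bspec)
qed

section \<open>Isometric maps given by signed coordinate functions\<close>

lemma semi_inner_eq_sum:
  "a \<le> m \<Longrightarrow> semi_inner m a x y = (\<Sum>i<m. (if i < a then -1 else 1) * (x i * y i))"
proof -
  assume "a \<le> m"
  then have "{..<m} = {..<a} \<union> {a..<m}" by auto
  then have "(\<Sum>i<m. (if i < a then -1 else 1) * (x i * y i)) =
      (\<Sum>i<a. (if i < a then -1 else 1) * (x i * y i)) + (\<Sum>i=a..<m. (if i < a then -1 else 1) * (x i * y i))"
    by (simp add: sum.union_disjoint ivl_disj_int)
  then show ?thesis by (simp add: semi_inner_def sum_negf)
qed

lemma semi_euclidean_simps [simp]:
  "mdim (semi_euclidean m a) = m" "mtop (semi_euclidean m a) = Euclidean_space m"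
  "charts (semi_euclidean m a) = {()}" "cdom (semi_euclidean m a) u = topspace (Euclidean_space m)"
  "cmap (semi_euclidean m a) u x = x"
  by (simp_all add: semi_euclidean_def)

lemma metric_semi_euclidean:
  assumes "a \<le> m" "i < m" "j < m"
  shows "metric (semi_euclidean m a) u p i j = (if i = j then (if i < a then -1 else 1) else 0)"
proof -
  have "(if r < a then -1 else 1 :: real) * ((if r = i then 1 else 0) * (if r = j then 1 else 0)) =
      (if r = i then if i = j then if i < a then -1 else 1 else 0 else 0)" for r
    by auto
  then show ?thesis
    using assms by (simp add: semi_euclidean_def semi_inner_eq_sum)
qed

lemma pullback_metric_semi_euclidean:
  assumes "a \<le> m"
  shows "pullback_metric M (semi_euclidean m a) f \<alpha> \<beta> p i j =
    (\<Sum>r<m. (if r < a then -1 else 1) *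
      (jacobian M (semi_euclidean m a) f \<alpha> \<beta> p r i * jacobian M (semi_euclidean m a) f \<alpha> \<beta> p r j))"
  unfolding pullback_metric_def semi_euclidean_simps
proof (intro sum.cong refl)
  fix r assume r: "r \<in> {..<m}"
  let ?J = "jacobian M (semi_euclidean m a) f \<alpha> \<beta> p"
  have "(\<Sum>s<m. metric (semi_euclidean m a) \<beta> (f p) r s * ?J r i * ?J s j) =
      (\<Sum>s<m. if r = s then (if r < a then -1 else 1) * (?J r i * ?J r j) else 0)"
    using r by (intro sum.cong refl) (auto simp: metric_semi_euclidean[OF assms])
  then show "(\<Sum>s<m. metric (semi_euclidean m a) \<beta> (f p) r s * ?J r i * ?J s j) =
      (if r < a then -1 else 1) * (?J r i * ?J r j)"
    using r by simp
qed

text \<open>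
  An isometric map into a semi-Euclidean space whose coordinates are indexed by an arbitrary finite
  set; the index itself tells the sign of its coordinate. This postpones the arrangement of the
  coordinates, negative ones first, until only their numbers matter.
\<close>

definition signed_isometry ::
  "('a, 'i) metric_manifold \<Rightarrow> (bool \<times> 'r) set \<Rightarrow> (bool \<times> 'r \<Rightarrow> 'a \<Rightarrow> real) \<Rightarrow> bool"
  where "signed_isometry M R \<Phi> \<longleftrightarrow> finite R \<and>
    (\<forall>r\<in>R. continuous_map (mtop M) euclideanreal (\<Phi> r)) \<and>
    (\<forall>\<alpha>\<in>charts M. \<forall>r\<in>R. smooth_on (mdim M) (cmap M \<alpha> ` cdom M \<alpha>) (\<lambda>x. \<Phi> r (cinv M \<alpha> x))) \<and>
    (\<forall>\<alpha>\<in>charts M. \<forall>p\<in>cdom M \<alpha>. \<forall>i<mdim M. \<forall>j<mdim M.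
      (\<Sum>r\<in>R. signature r * (partial_deriv i (\<lambda>x. \<Phi> r (cinv M \<alpha> x)) (cmap M \<alpha> p) *
        partial_deriv j (\<lambda>x. \<Phi> r (cinv M \<alpha> x)) (cmap M \<alpha> p))) = metric M \<alpha> p i j)"

section \<open>Charts of a warped product\<close>

lemma block_start_Suc: "1 \<le> l \<Longrightarrow> block_start M (Suc l) = block_start M l + mdim (M l)"
  by (simp add: block_start_def atLeastLessThanSuc)

lemma block_start_mono: "l \<le> l' \<Longrightarrow> block_start M l \<le> block_start M l'"
  unfolding block_start_def by (intro add_left_mono sum_mono2) auto

lemma block_end_le: "1 \<le> l \<Longrightarrow> l < l' \<Longrightarrow> block_start M l + mdim (M l) \<le> block_start M l'"
  using block_start_mono[of "Suc l" l' M] by (simp add: block_start_Suc)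

lemma block_unique:
  assumes "1 \<le> l" "1 \<le> l'" "i \<in> block M l" "i \<in> block M l'"
  shows "l = l'"
  using assms block_end_le[of l l' M] block_end_le[of l' l M]
  by (cases l l' rule: linorder_cases) (auto simp: block_def)

lemma block_cover:
  assumes "1 \<le> i" "i < block_start M (Suc k)"
  obtains l where "l \<in> {1..k}" "i \<in> block M l"
  using assms
proof (induction k arbitrary: thesis)
  case 0
  then show ?case by (simp add: block_start_def)
next
  case (Suc k)
  show ?case
  proof (cases "i < block_start M (Suc k)")
    case True
    then show ?thesis using Suc by (metis atLeastAtMost_iff le_SucI)
  next
    case False
    then have "i \<in> block M (Suc k)"
      using Suc.prems(3) by (simp add: block_def block_start_Suc)
    then show ?thesis using Suc.prems(1)[of "Suc k"] by simp
  qed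
qed

text \<open>
  \<open>D\<close> below is the set of flat directions, the pairs of a factor \<open>l\<close> and a coordinate of \<open>\<real>\<^bsup>m l\<^esup>\<close>;
  \<open>Y \<alpha> d\<close> is the corresponding coordinate of \<open>f l\<close> in the chart \<open>\<alpha>\<close>.
\<close>

locale immersed_warped_product =
  fixes k :: nat and M :: "nat \<Rightarrow> ('a, 'i) metric_manifold" and m :: "nat \<Rightarrow> nat"
    and f :: "nat \<Rightarrow> 'a \<Rightarrow> nat \<Rightarrow> real" and I :: "real set"
    and \<rho> :: "real \<Rightarrow> real" and \<eta> :: "nat \<Rightarrow> real \<Rightarrow> real"
  assumes manifold: "\<And>l. l \<in> {1..k} \<Longrightarrow> smooth_manifold (M l)"
    and isometric: "\<And>l. l \<in> {1..k} \<Longrightarrow> isometric_immersion (M l) (semi_euclidean (m l) 0) (f l)"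
    and I: "open I" "is_interval I"
    and \<rho>: "smooth1 I \<rho>" "\<And>t. t \<in> I \<Longrightarrow> \<rho> t > 0"
    and \<eta>: "\<And>l. l \<in> {1..k} \<Longrightarrow> smooth1 I (\<eta> l)" "\<And>l t. l \<in> {1..k} \<Longrightarrow> t \<in> I \<Longrightarrow> \<eta> l t > 0"
begin

definition W where "W = warped_product I \<rho> k \<eta> M"

definition D where "D = Sigma {1..k} (\<lambda>l. {..<m l})"

definition factor_image where "factor_image \<alpha> l = cmap (M l) (\<alpha> l) ` cdom (M l) (\<alpha> l)"

definition blk where "blk l x = restrict_block (block_start M l) (mdim (M l)) x"

definition Y where "Y \<alpha> i x = f (fst i) (cinv (M (fst i)) (\<alpha> (fst i)) (blk (fst i) x)) (snd i)"

definition chart_image where "chart_image \<alpha> = cmap W \<alpha> ` cdom W \<alpha>"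

lemma finite_D: "finite D" by (simp add: D_def)

lemma mdim_W: "mdim W = block_start M (Suc k)"
  by (simp add: W_def warped_product_def block_start_def atLeastLessThanSuc_atLeastAtMost)

lemma charts_W: "\<alpha> \<in> charts W \<Longrightarrow> l \<in> {1..k} \<Longrightarrow> \<alpha> l \<in> charts (M l)"
  by (auto simp: W_def warped_product_def)

lemma cdom_W: "cdom W \<alpha> = I \<times> (\<Pi>\<^sub>E l\<in>{1..k}. cdom (M l) (\<alpha> l))"
  by (simp add: W_def warped_product_def)

lemma cmap_W: "cmap W \<alpha> (t, p) i = (if i = 0 then t
    else \<Sum>l=1..k. if i \<in> block M l then cmap (M l) (\<alpha> l) (p l) (i - block_start M l) else 0)"
  by (simp add: W_def warped_product_def)

lemma metric_W: "metric W \<alpha> (t, p) i j = (if i = 0 \<and> j = 0 then (\<rho> t)\<^sup>2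
    else \<Sum>l=1..k. if i \<in> block M l \<and> j \<in> block M l
      then (\<eta> l t)\<^sup>2 * metric (M l) (\<alpha> l) (p l) (i - block_start M l) (j - block_start M l) else 0)"
  by (simp add: W_def warped_product_def)

lemma mtop_W: "mtop W = prod_topology (top_of_set I) (product_topology (\<lambda>l. mtop (M l)) {1..k})"
  by (simp add: W_def warped_product_def)

lemma cmap_W_block:
  assumes "l \<in> {1..k}" "i \<in> block M l"
  shows "cmap W \<alpha> (t, p) i = cmap (M l) (\<alpha> l) (p l) (i - block_start M l)"
proof -
  have "i \<noteq> 0" using assms by (auto simp: block_def block_start_def)
  moreover have "(\<Sum>l'=1..k. if i \<in> block M l' then cmap (M l') (\<alpha> l') (p l') (i - block_start M l') else 0)
      = (\<Sum>l'=1..k. if l' = l then cmap (M l) (\<alpha> l) (p l) (i - block_start M l) else 0)"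
    using assms block_unique[of _ l i M] by (intro sum.cong refl) auto
  ultimately show ?thesis using assms(1) by (simp add: cmap_W)
qed

lemma block_subset_mdim: "l \<in> {1..k} \<Longrightarrow> i \<in> block M l \<Longrightarrow> 0 < i \<and> i < mdim W"
  using block_end_le[of l "Suc k" M] by (auto simp: block_def block_start_def mdim_W)

lemma factor_chart:
  assumes "\<alpha> \<in> charts W" "l \<in> {1..k}"
  shows "openin (Euclidean_space (mdim (M l))) (factor_image \<alpha> l)"
    "inj_on (cmap (M l) (\<alpha> l)) (cdom (M l) (\<alpha> l))"
    "openin (mtop (M l)) (cdom (M l) (\<alpha> l))"
proof -
  note ch = manifold[OF assms(2), unfolded smooth_manifold_def] charts_W[OF assms]
  then show op: "openin (Euclidean_space (mdim (M l))) (factor_image \<alpha> l)" "openin (mtop (M l)) (cdom (M l) (\<alpha> l))"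
    by (auto simp: factor_image_def)
  have "homeomorphic_map (subtopology (mtop (M l)) (cdom (M l) (\<alpha> l)))
      (subtopology (Euclidean_space (mdim (M l))) (factor_image \<alpha> l)) (cmap (M l) (\<alpha> l))"
    using ch by (auto simp: factor_image_def)
  then have "inj_on (cmap (M l) (\<alpha> l)) (topspace (subtopology (mtop (M l)) (cdom (M l) (\<alpha> l))))"
    by (rule homeomorphic_imp_injective_map)
  then show "inj_on (cmap (M l) (\<alpha> l)) (cdom (M l) (\<alpha> l))"
    using openin_subset[OF op(2)] by (simp add: Int_absorb1)
qed

lemma factor_image_zero:
  assumes "\<alpha> \<in> charts W" "l \<in> {1..k}" "y \<in> factor_image \<alpha> l" "mdim (M l) \<le> j"
  shows "y j = 0"
  using openin_subset[OF factor_chart(1)[OF assms(1,2)]] assms(3,4)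
  by (auto simp: topspace_Euclidean_space)

lemma cinv_factor:
  assumes "\<alpha> \<in> charts W" "l \<in> {1..k}"
  shows "p \<in> cdom (M l) (\<alpha> l) \<Longrightarrow> cinv (M l) (\<alpha> l) (cmap (M l) (\<alpha> l) p) = p"
    and "y \<in> factor_image \<alpha> l \<Longrightarrow> cinv (M l) (\<alpha> l) y \<in> cdom (M l) (\<alpha> l)"
    and "y \<in> factor_image \<alpha> l \<Longrightarrow> cmap (M l) (\<alpha> l) (cinv (M l) (\<alpha> l) y) = y"
  using factor_chart(2)[OF assms]
  by (auto simp: cinv_def factor_image_def inv_into_into f_inv_into_f)

lemma blk_cmap_W:
  assumes "\<alpha> \<in> charts W" "l \<in> {1..k}" "p l \<in> cdom (M l) (\<alpha> l)"
  shows "blk l (cmap W \<alpha> (t, p)) = cmap (M l) (\<alpha> l) (p l)"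
proof
  fix j
  show "blk l (cmap W \<alpha> (t, p)) j = cmap (M l) (\<alpha> l) (p l) j"
  proof (cases "j < mdim (M l)")
    case True
    then show ?thesis
      using cmap_W_block[OF assms(2), of "block_start M l + j"]
      by (simp add: blk_def restrict_block_def block_def)
  next
    case False
    then show ?thesis
      using factor_image_zero[OF assms(1,2), of "cmap (M l) (\<alpha> l) (p l)" j] assms(3)
      by (simp add: blk_def restrict_block_def factor_image_def)
  qed
qed

text \<open>
  \<^const>\<open>cinv\<close> is an inverse chosen on the image only, so its formula as a product of inverse charts
  can be claimed only there.
\<close>

lemma chart_image_eq:
  assumes "\<alpha> \<in> charts W"
  shows "chart_image \<alpha> = {x. (\<forall>i\<ge>mdim W. x i = 0) \<and> x 0 \<in> I \<and> (\<forall>l\<in>{1..k}. blk l x \<in> factor_image \<alpha> l)}"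
    (is "_ = ?R")
    and "\<And>x. x \<in> chart_image \<alpha> \<Longrightarrow>
      cinv W \<alpha> x = (x 0, \<lambda>l\<in>{1..k}. cinv (M l) (\<alpha> l) (blk l x))"
proof -
  have inverse: "(x 0, \<lambda>l\<in>{1..k}. cinv (M l) (\<alpha> l) (blk l x)) \<in> cdom W \<alpha> \<and>
      cmap W \<alpha> (x 0, \<lambda>l\<in>{1..k}. cinv (M l) (\<alpha> l) (blk l x)) = x" if x: "x \<in> ?R" for x
  proof
    show "(x 0, \<lambda>l\<in>{1..k}. cinv (M l) (\<alpha> l) (blk l x)) \<in> cdom W \<alpha>"
      using x cinv_factor(2)[OF assms] by (auto simp: cdom_W)
    show "cmap W \<alpha> (x 0, \<lambda>l\<in>{1..k}. cinv (M l) (\<alpha> l) (blk l x)) = x"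
    proof
      fix i
      consider "i = 0" | "i \<ge> mdim W" | l where "l \<in> {1..k}" "i \<in> block M l"
        using block_cover[of i M k] by (metis less_one mdim_W not_le)
      then show "cmap W \<alpha> (x 0, \<lambda>l\<in>{1..k}. cinv (M l) (\<alpha> l) (blk l x)) i = x i"
      proof cases
        case 1
        then show ?thesis by (simp add: cmap_W)
      next
        case 2
        have "i \<noteq> 0" using 2 by (simp add: mdim_W block_start_def)
        moreover have "i \<notin> block M l" if "l \<in> {1..k}" for l
          using block_subset_mdim[OF that, of i] 2 by auto
        ultimately show ?thesis using x 2 by (simp add: cmap_W)
      next
        case 3
        then have "cmap W \<alpha> (x 0, \<lambda>l\<in>{1..k}. cinv (M l) (\<alpha> l) (blk l x)) i = blk l x (i - block_start M l)"
          using cmap_W_block[OF 3] cinv_factor(3)[OF assms 3(1), of "blk l x"] x by simp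
        moreover have "blk l x (i - block_start M l) = x i"
          using 3(2) by (auto simp: blk_def restrict_block_def block_def)
        ultimately show ?thesis by simp
      qed
    qed
  qed
  have direct: "cmap W \<alpha> z \<in> ?R \<and> z = (cmap W \<alpha> z 0, \<lambda>l\<in>{1..k}. cinv (M l) (\<alpha> l) (blk l (cmap W \<alpha> z)))"
    if z: "z \<in> cdom W \<alpha>" for z
  proof -
    obtain t p where tp: "z = (t, p)" "t \<in> I" "p \<in> (\<Pi>\<^sub>E l\<in>{1..k}. cdom (M l) (\<alpha> l))"
      using z by (auto simp: cdom_W)
    have b: "blk l (cmap W \<alpha> z) = cmap (M l) (\<alpha> l) (p l)" if "l \<in> {1..k}" for l
      unfolding tp(1) using tp(3) that by (intro blk_cmap_W[OF assms that]) auto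
    have zero: "cmap W \<alpha> z i = 0" if "i \<ge> mdim W" for i
    proof -
      have "i \<noteq> 0" using that by (simp add: mdim_W block_start_def)
      moreover have "i \<notin> block M l" if "l \<in> {1..k}" for l
        using block_subset_mdim[OF that, of i] \<open>i \<ge> mdim W\<close> by auto
      ultimately show ?thesis by (simp add: cmap_W tp(1))
    qed
    have t: "cmap W \<alpha> z 0 = t" by (simp add: cmap_W tp(1))
    have p: "(\<lambda>l\<in>{1..k}. cinv (M l) (\<alpha> l) (blk l (cmap W \<alpha> z))) = p"
      using tp(3) by (intro ext) (auto simp: b cinv_factor(1)[OF assms] PiE_iff extensional_def)
    have "blk l (cmap W \<alpha> z) \<in> factor_image \<alpha> l" if "l \<in> {1..k}" for l
      using tp(3) that by (auto simp: b factor_image_def)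
    with zero tp(2) show ?thesis unfolding p t by (simp add: cmap_W tp(1))
  qed
  show eq: "chart_image \<alpha> = ?R"
  proof
    show "chart_image \<alpha> \<subseteq> ?R" using direct by (auto simp: chart_image_def)
    show "?R \<subseteq> chart_image \<alpha>"
    proof
      fix x assume "x \<in> ?R"
      note inv = inverse[OF this]
      show "x \<in> chart_image \<alpha>"
        unfolding chart_image_def 
        by (rule image_eqI[where f = "cmap W \<alpha>", OF inv[THEN conjunct2, symmetric] inv[THEN conjunct1]])
    qed
  qed
  have inj: "inj_on (cmap W \<alpha>) (cdom W \<alpha>)"
    by (rule inj_on_inverseI[where g = "\<lambda>x. (x 0, \<lambda>l\<in>{1..k}. cinv (M l) (\<alpha> l) (blk l x))",
          OF direct[THEN conjunct2, symmetric]])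
  show "cinv W \<alpha> x = (x 0, \<lambda>l\<in>{1..k}. cinv (M l) (\<alpha> l) (blk l x))" if "x \<in> chart_image \<alpha>" for x
  proof -
    have "x \<in> ?R" using that eq by simp
    note inv = inverse[OF this]
    show ?thesis
      unfolding cinv_def[of W] by (rule inv_into_f_eq[OF inj inv[THEN conjunct1] inv[THEN conjunct2]])
  qed
qed

lemma open_chart_image:
  assumes "\<alpha> \<in> charts W"
  shows "openin (Euclidean_space (mdim W)) (chart_image \<alpha>)"
proof -
  have "\<exists>T. open T \<and> factor_image \<alpha> l = {x. \<forall>i\<ge>mdim (M l). x i = 0} \<inter> T" if "l \<in> {1..k}" for l
    using factor_chart(1)[OF assms that] by (simp add: Euclidean_space_eq_top_of_set openin_open)
  then have "\<forall>l\<in>{1..k}. \<exists>T. open T \<and> factor_image \<alpha> l = {x. \<forall>i\<ge>mdim (M l). x i = 0} \<inter> T" by blast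
  from bchoice[OF this] obtain T
    where "\<forall>l\<in>{1..k}. open (T l) \<and> factor_image \<alpha> l = {x. \<forall>i\<ge>mdim (M l). x i = 0} \<inter> T l"
    by blast
  then have T: "open (T l)" "factor_image \<alpha> l = {x. \<forall>i\<ge>mdim (M l). x i = 0} \<inter> T l"
    if "l \<in> {1..k}" for l
    using that by blast+
  have "open (blk l -` T l)" if "l \<in> {1..k}" for l
    unfolding blk_def[abs_def] using T(1)[OF that] continuous_on_restrict_block by (rule open_vimage)
  then have "open (\<Inter>l\<in>{1..k}. blk l -` T l)" by (intro open_INT) auto
  moreover have "open ((\<lambda>x :: nat \<Rightarrow> real. x 0) -` I)"
    using I(1) continuous_on_product_coordinates by (rule open_vimage)
  ultimately have "open ((\<lambda>x. x 0) -` I \<inter> (\<Inter>l\<in>{1..k}. blk l -` T l))" by (rule open_Int[rotated])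
  moreover have "chart_image \<alpha> = {x. \<forall>i\<ge>mdim W. x i = 0} \<inter> ((\<lambda>x. x 0) -` I \<inter> (\<Inter>l\<in>{1..k}. blk l -` T l))"
    unfolding chart_image_eq(1)[OF assms] using T(2) by (auto simp: blk_def restrict_block_def)
  ultimately show ?thesis by (auto simp: Euclidean_space_eq_top_of_set openin_open)
qed

end

section \<open>Coordinates on the warped product\<close>

definition definite_metric :: "('a, 'i) metric_manifold \<Rightarrow> bool"
  where "definite_metric M \<longleftrightarrow> (\<forall>\<alpha>\<in>charts M. \<forall>p\<in>cdom M \<alpha>. \<forall>v.
    (\<Sum>i<mdim M. \<Sum>j<mdim M. metric M \<alpha> p i j * v i * v j) = 0 \<longrightarrow> (\<forall>i<mdim M. v i = 0))"

lemma smooth_on_cong: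
  assumes "openin (Euclidean_space d) V" "\<And>x. x \<in> V \<Longrightarrow> f x = g x" "smooth_on d V f"
  shows "smooth_on d V g"
  unfolding smooth_on_def
proof
  fix r show "Ck_on d r V g"
    using assms(3) by (intro Ck_on_cong[OF assms(1,2)]) (auto simp: smooth_on_def)
qed

definition index_set :: "'o set \<Rightarrow> ('o \<Rightarrow> (bool \<times> 'j) set) \<Rightarrow> (bool \<times> 'o \<times> 'j) set"
  where "index_set A Q = (\<lambda>(i, q). (fst q, (i, snd q))) ` Sigma A Q"

lemma sum_index_set:
  assumes "finite A" "\<And>i. i \<in> A \<Longrightarrow> finite (Q i)"
  shows "(\<Sum>r\<in>index_set A Q. F r) = (\<Sum>i\<in>A. \<Sum>q\<in>Q i. F (fst q, (i, snd q)))"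
proof -
  have "inj_on (\<lambda>(i, q). (fst q, (i, snd q))) (Sigma A Q)"
    by (auto simp: inj_on_def)
  then have "(\<Sum>r\<in>index_set A Q. F r) = (\<Sum>z\<in>Sigma A Q. F (fst (snd z), (fst z, snd (snd z))))"
    unfolding index_set_def by (subst sum.reindex) (auto simp: o_def case_prod_unfold)
  then show ?thesis using assms by (simp add: sum.Sigma case_prod_unfold)
qed

lemma sum_index_set_option:
  assumes "finite D" "finite (Q None)" "\<And>d. d \<in> D \<Longrightarrow> finite (Q (Some d))"
  shows "(\<Sum>r\<in>index_set (insert None (Some ` D)) Q. F r) =
    (\<Sum>q\<in>Q None. F (fst q, (None, snd q))) + (\<Sum>d\<in>D. \<Sum>q\<in>Q (Some d). F (fst q, (Some d, snd q)))"
proof -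
  have "(\<Sum>r\<in>index_set (insert None (Some ` D)) Q. F r) =
      (\<Sum>i\<in>insert None (Some ` D). \<Sum>q\<in>Q i. F (fst q, (i, snd q)))"
    by (rule sum_index_set) (use assms in auto)
  also have "\<dots> = (\<Sum>q\<in>Q None. F (fst q, (None, snd q))) +
      (\<Sum>i\<in>Some ` D. \<Sum>q\<in>Q i. F (fst q, (i, snd q)))"
    using assms(1) by (subst sum.insert) auto
  also have "(\<Sum>i\<in>Some ` D. \<Sum>q\<in>Q i. F (fst q, (i, snd q))) =
      (\<Sum>d\<in>D. \<Sum>q\<in>Q (Some d). F (fst q, (Some d, snd q)))"
    by (subst sum.reindex) auto
  finally show ?thesis .
qed

lemma index_set_optionE:
  assumes "r \<in> index_set (insert None (Some ` D)) Q"
  obtains q where "q \<in> Q None" "r = (fst q, None, snd q)"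
    | d q where "d \<in> D" "q \<in> Q (Some d)" "r = (fst q, Some d, snd q)"
  using assms by (auto simp: index_set_def)

lemma signature_pair: "signature (fst q, x) = signature q"
  by (simp add: signature_def)

text \<open>
  The recovery condition for the given embeddings: convergence of the coordinates of \<open>f\<close> is
  convergence in the image, and the inverse of \<open>f\<close> is continuous there.
\<close>

lemma limitin_of_embedding:
  assumes emb: "embedding_map X (Euclidean_space n) f" and p0: "p0 \<in> topspace X"
    and ev: "\<forall>\<^sub>F z in F. g z \<in> topspace X"
    and lim: "\<And>i. i < n \<Longrightarrow> ((\<lambda>z. f (g z) i) \<longlongrightarrow> f p0 i) F"
  shows "limitin X g p0 F"
proof -
  let ?Y = "subtopology (Euclidean_space n) (f ` topspace X)"
  have hom: "homeomorphic_map X ?Y f" using emb by (simp add: embedding_map_def)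
  then obtain h where h: "homeomorphic_maps X ?Y f h" by (auto simp: homeomorphic_map_maps)
  have img: "f p \<in> topspace (Euclidean_space n)" if "p \<in> topspace X" for p
    using homeomorphic_imp_surjective_map[OF hom] that by auto
  have zero: "f p i = 0" if "p \<in> topspace X" "\<not> i < n" for p i
    using img[OF that(1)] that(2) by (simp add: topspace_Euclidean_space)
  have "((\<lambda>z. f (g z) i) \<longlongrightarrow> f p0 i) F" for i
  proof (cases "i < n")
    case False
    have "\<forall>\<^sub>F z in F. 0 = f (g z) i" using ev by eventually_elim (use zero False in auto)
    then show ?thesis
      using zero[OF p0 False] by (auto intro: Lim_transform_eventually[OF tendsto_const])
  qed (rule lim)
  then have "limitin (powertop_real UNIV) (f \<circ> g) (f p0) F"
    by (simp add: limitin_componentwise)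
  moreover have "\<forall>\<^sub>F z in F. (f \<circ> g) z \<in> topspace (Euclidean_space n) \<inter> f ` topspace X"
    using ev by eventually_elim (use img in auto)
  ultimately have "limitin ?Y (f \<circ> g) (f p0) F"
    using p0 img[OF p0]
    by (auto simp: Euclidean_space_def limitin_subtopology topspace_Euclidean_space elim: eventually_mono)
  then have "limitin X (h \<circ> (f \<circ> g)) (h (f p0)) F"
    using h continuous_map_limit[of ?Y X h] unfolding homeomorphic_maps_def by blast
  moreover have hf: "h (f p) = p" if "p \<in> topspace X" for p
    using h that by (simp add: homeomorphic_maps_def)
  moreover have "\<forall>\<^sub>F z in F. (h \<circ> (f \<circ> g)) z = g z"
    using ev by eventually_elim (use hf in auto)
  ultimately show ?thesis
    using p0 by (auto elim: limitin_transform_eventually[rotated])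
qed

context immersed_warped_product
begin

definition rep where "rep \<alpha> l i y = f l (cinv (M l) (\<alpha> l) y) i"

lemma Y_eq: "Y \<alpha> (l, i) = (\<lambda>x. rep \<alpha> l i (blk l x))"
  by (simp add: Y_def rep_def fun_eq_iff)

lemma factor_continuous:
  assumes "l \<in> {1..k}"
  shows "continuous_map (mtop (M l)) (Euclidean_space (m l)) (f l)"
  using isometric[OF assms] by (simp add: isometric_immersion_def immersion_def smooth_map_def)

lemma cdom_subset:
  assumes "\<alpha> \<in> charts W" "l \<in> {1..k}"
  shows "cdom (M l) (\<alpha> l) \<subseteq> topspace (mtop (M l))"
  using factor_chart(3)[OF assms] by (rule openin_subset)

lemma f_in_space:
  "\<alpha> \<in> charts W \<Longrightarrow> l \<in> {1..k} \<Longrightarrow> p \<in> cdom (M l) (\<alpha> l) \<Longrightarrow> f l p \<in> topspace (Euclidean_space (m l))"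
  using factor_continuous[of l] cdom_subset by (fastforce simp: continuous_map_def)

lemma smooth_rep:
  assumes "\<alpha> \<in> charts W" "l \<in> {1..k}" "i < m l"
  shows "smooth_on (mdim (M l)) (factor_image \<alpha> l) (rep \<alpha> l i)"
proof -
  have "{p \<in> cdom (M l) (\<alpha> l). f l p \<in> topspace (Euclidean_space (m l))} = cdom (M l) (\<alpha> l)"
    using f_in_space[OF assms(1,2)] by auto
  moreover have "smooth_on (mdim (M l)) (cmap (M l) (\<alpha> l) ` {p \<in> cdom (M l) (\<alpha> l). f l p \<in> topspace (Euclidean_space (m l))})
      (\<lambda>x. local_rep (M l) (semi_euclidean (m l) 0) (f l) (\<alpha> l) () x i)"
    using isometric[OF assms(2)] charts_W[OF assms(1,2)] assms(3)
    by (simp add: isometric_immersion_def immersion_def smooth_map_def)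
  ultimately show ?thesis
    by (simp add: factor_image_def local_rep_def rep_def[abs_def])
qed

lemma jacobian_factor:
  "jacobian (M l) (semi_euclidean (m l) 0) (f l) (\<alpha> l) () p r j = partial_deriv j (rep \<alpha> l r) (cmap (M l) (\<alpha> l) p)"
  by (simp add: jacobian_def local_rep_def rep_def[abs_def])

lemma factor_metric:
  assumes "\<alpha> \<in> charts W" "l \<in> {1..k}" "p \<in> cdom (M l) (\<alpha> l)" "i < mdim (M l)" "j < mdim (M l)"
  shows "metric (M l) (\<alpha> l) p i j =
    (\<Sum>r<m l. partial_deriv i (rep \<alpha> l r) (cmap (M l) (\<alpha> l) p) * partial_deriv j (rep \<alpha> l r) (cmap (M l) (\<alpha> l) p))"
proof -
  have "metric (M l) (\<alpha> l) p i j = pullback_metric (M l) (semi_euclidean (m l) 0) (f l) (\<alpha> l) () p i j"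
    using isometric[OF assms(2)] charts_W[OF assms(1,2)] assms(3-5) f_in_space[OF assms(1-3)]
    by (simp add: isometric_immersion_def)
  then show ?thesis by (simp add: pullback_metric_semi_euclidean jacobian_factor)
qed

lemma factor_kernel:
  assumes "\<alpha> \<in> charts W" "l \<in> {1..k}" "p \<in> cdom (M l) (\<alpha> l)"
    "\<And>r. r < m l \<Longrightarrow> (\<Sum>i<mdim (M l). partial_deriv i (rep \<alpha> l r) (cmap (M l) (\<alpha> l) p) * v i) = 0"
    "i < mdim (M l)"
  shows "v i = 0"
  using isometric[OF assms(2)] charts_W[OF assms(1,2)] assms(3-5) f_in_space[OF assms(1-3)]
  by (simp add: isometric_immersion_def immersion_def jacobian_factor)

lemma blk_in_factor_image:
  "\<alpha> \<in> charts W \<Longrightarrow> l \<in> {1..k} \<Longrightarrow> x \<in> chart_image \<alpha> \<Longrightarrow> blk l x \<in> factor_image \<alpha> l"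
  by (simp add: chart_image_eq(1))

lemma smooth_Y:
  assumes "\<alpha> \<in> charts W" "d \<in> D"
  shows "smooth_on (mdim W) (chart_image \<alpha>) (Y \<alpha> d)"
proof -
  obtain l i where d: "d = (l, i)" "l \<in> {1..k}" "i < m l" using assms(2) by (auto simp: D_def)
  show ?thesis
    unfolding smooth_on_def d Y_eq blk_def
  proof
    fix r
    have "Ck_on (mdim (M l)) r (factor_image \<alpha> l) (rep \<alpha> l i)"
      using smooth_rep[OF assms(1) d(2,3)] by (simp add: smooth_on_def)
    then show "Ck_on (mdim W) r (chart_image \<alpha>) (\<lambda>x. rep \<alpha> l i (restrict_block (block_start M l) (mdim (M l)) x))"
      by (intro Ck_on_restrict_block[where f = "rep \<alpha> l i" and W = "factor_image \<alpha> l"]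
          open_chart_image assms(1) blk_in_factor_image[OF assms(1) d(2), unfolded blk_def])
  qed
qed

lemma partial_Y:
  assumes "\<alpha> \<in> charts W" "l \<in> {1..k}" "i < m l" "x \<in> chart_image \<alpha>"
  shows "partial_deriv j (Y \<alpha> (l, i)) x =
    (if j \<in> block M l then partial_deriv (j - block_start M l) (rep \<alpha> l i) (blk l x) else 0)"
proof -
  have Ck: "Ck_on (mdim (M l)) (Suc 0) (factor_image \<alpha> l) (rep \<alpha> l i)"
    using smooth_rep[OF assms(1-3)] unfolding smooth_on_def by blast
  have "has_partial (j - block_start M l) (rep \<alpha> l i)
      (partial_deriv (j - block_start M l) (rep \<alpha> l i) (blk l x)) (blk l x)"
    if "j \<in> block M l"
    by (rule Ck_on_imp_has_partial[OF Ck blk_in_factor_image[OF assms(1,2,4)]])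
      (use that in \<open>auto simp: block_def\<close>)
  then show ?thesis
    unfolding Y_eq blk_def block_def
    by (intro has_partial_imp_partial_deriv has_partial_restrict_block) blast
qed

text \<open>
  The reduction to flat fibres: as each \<open>f l\<close> is isometric, the warped product metric is the pullback of
  \<open>\<rho>\<^sup>2 dt\<^sup>2 + \<Sum> \<eta>\<^sup>2 dy\<^sub>d\<^sup>2\<close> under \<open>(t, Y)\<close>.
\<close>

lemma metric_W_eq:
  assumes \<alpha>: "\<alpha> \<in> charts W" and z: "z \<in> cdom W \<alpha>"
  shows "metric W \<alpha> z i j = (\<rho> (fst z))\<^sup>2 * (if i = 0 then 1 else 0) * (if j = 0 then 1 else 0)
    + (\<Sum>d\<in>D. (\<eta> (fst d) (fst z))\<^sup>2 *
        (partial_deriv i (Y \<alpha> d) (cmap W \<alpha> z) * partial_deriv j (Y \<alpha> d) (cmap W \<alpha> z)))"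
proof -
  obtain t p where tp: "z = (t, p)" "t \<in> I" "p \<in> (\<Pi>\<^sub>E l\<in>{1..k}. cdom (M l) (\<alpha> l))"
    using z by (auto simp: cdom_W)
  let ?x = "cmap W \<alpha> z"
  have x: "?x \<in> chart_image \<alpha>" using z by (simp add: chart_image_def)
  have zero: "0 \<notin> block M l" for l by (simp add: block_def block_start_def)
  have fac: "(\<Sum>r<m l. (\<eta> l t)\<^sup>2 * (partial_deriv i (Y \<alpha> (l, r)) ?x * partial_deriv j (Y \<alpha> (l, r)) ?x)) =
      (if i \<in> block M l \<and> j \<in> block M l then
        (\<eta> l t)\<^sup>2 * metric (M l) (\<alpha> l) (p l) (i - block_start M l) (j - block_start M l) else 0)"
    if l: "l \<in> {1..k}" for l
  proof -
    have pl: "p l \<in> cdom (M l) (\<alpha> l)" using tp(3) l by auto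
    have b: "blk l ?x = cmap (M l) (\<alpha> l) (p l)" unfolding tp(1) by (rule blk_cmap_W[where p = p, OF \<alpha> l pl])
    have "i - block_start M l < mdim (M l)" if "i \<in> block M l" for i
      using that by (auto simp: block_def)
    then show ?thesis
      by (auto simp: partial_Y[OF \<alpha> l _ x] b factor_metric[OF \<alpha> l pl] sum_distrib_left)
  qed
  have "(\<Sum>d\<in>D. (\<eta> (fst d) t)\<^sup>2 * (partial_deriv i (Y \<alpha> d) ?x * partial_deriv j (Y \<alpha> d) ?x)) =
      (\<Sum>l=1..k. \<Sum>r<m l. (\<eta> l t)\<^sup>2 * (partial_deriv i (Y \<alpha> (l, r)) ?x * partial_deriv j (Y \<alpha> (l, r)) ?x))"
    unfolding D_def by (subst sum.Sigma) (auto simp: case_prod_unfold)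
  also have "\<dots> = (\<Sum>l=1..k. if i \<in> block M l \<and> j \<in> block M l then
        (\<eta> l t)\<^sup>2 * metric (M l) (\<alpha> l) (p l) (i - block_start M l) (j - block_start M l) else 0)"
    by (intro sum.cong refl fac)
  finally show ?thesis
    unfolding tp(1) by (auto simp: metric_W zero)
qed

lemma sum_over_block:
  assumes "l \<in> {1..k}"
  shows "(\<Sum>i<mdim W. if i \<in> block M l then g (i - block_start M l) * v i else 0) =
    (\<Sum>j<mdim (M l). g j * (v (block_start M l + j) :: real))"
proof -
  have "(\<Sum>i<mdim W. if i \<in> block M l then g (i - block_start M l) * v i else 0) =
      (\<Sum>i\<in>block M l. g (i - block_start M l) * v i)"
    using block_subset_mdim[OF assms] by (subst sum.inter_restrict[symmetric]) (auto intro!: sum.cong)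
  also have "\<dots> = (\<Sum>j<mdim (M l). g j * v (block_start M l + j))"
    by (rule sum.reindex_bij_witness[of _ "\<lambda>j. block_start M l + j" "\<lambda>i. i - block_start M l"])
      (auto simp: block_def)
  finally show ?thesis .
qed

text \<open>
  A vector of length 0 has no \<open>t\<close>-component and is annihilated by the differential of each \<open>Y d\<close>, hence lies in
  the kernels of the differentials of the immersions \<open>f l\<close>.
\<close>

lemma definite_W: "definite_metric W"
  unfolding definite_metric_def
proof (intro ballI allI impI)
  fix \<alpha> z v i
  assume \<alpha>: "\<alpha> \<in> charts W" and z: "z \<in> cdom W \<alpha>" and i: "i < mdim W"
    and null: "(\<Sum>i<mdim W. \<Sum>j<mdim W. metric W \<alpha> z i j * v i * v j) = 0"
  let ?x = "cmap W \<alpha> z"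
  define V where "V d = (\<Sum>i<mdim W. partial_deriv i (Y \<alpha> d) ?x * v i)" for d
  have x: "?x \<in> chart_image \<alpha>" using z by (simp add: chart_image_def)
  obtain t p where tp: "z = (t, p)" "t \<in> I" "p \<in> (\<Pi>\<^sub>E l\<in>{1..k}. cdom (M l) (\<alpha> l))"
    using z by (auto simp: cdom_W)
  have ft: "fst z = t" by (simp add: tp(1))
  have d0: "0 < mdim W" by (simp add: mdim_W block_start_def)
  have v0: "(\<Sum>i<mdim W. (if i = 0 then 1 else 0) * v i) = v 0"
  proof -
    have "(\<Sum>i<mdim W. (if i = 0 then 1 else 0) * v i) = (\<Sum>i<mdim W. if i = 0 then v 0 else 0)"
      by (rule sum.cong) auto
    then show ?thesis using d0 by simp
  qed
  have "(\<Sum>i<mdim W. \<Sum>j<mdim W. metric W \<alpha> z i j * v i * v j) =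
      (\<Sum>i<mdim W. \<Sum>j<mdim W. (\<rho> t)\<^sup>2 * (((if i = 0 then 1 else 0) * v i) * ((if j = 0 then 1 else 0) * v j))
        + (\<Sum>d\<in>D. (\<eta> (fst d) t)\<^sup>2 *
          ((partial_deriv i (Y \<alpha> d) ?x * v i) * (partial_deriv j (Y \<alpha> d) ?x * v j))))"
    by (intro sum.cong refl) (simp only: metric_W_eq[OF \<alpha> z] ft distrib_right sum_distrib_right, simp only: mult_ac)
  also have "\<dots> = (\<rho> t)\<^sup>2 * (v 0 * v 0) + (\<Sum>d\<in>D. (\<eta> (fst d) t)\<^sup>2 * (V d * V d))"
  proof -
    have sw: "(\<Sum>i<mdim W. \<Sum>j<mdim W. \<Sum>d\<in>D. h d i j) = (\<Sum>d\<in>D. \<Sum>i<mdim W. \<Sum>j<mdim W. h d i j)"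
      for h :: "nat \<times> nat \<Rightarrow> nat \<Rightarrow> nat \<Rightarrow> real"
      by (subst sum.swap[of _ D]) (simp add: sum.swap[of _ D])
    have pr: "(\<Sum>i<mdim W. \<Sum>j<mdim W. c * (g i * g j)) = c * (sum g {..<mdim W} * sum g {..<mdim W})"
      for c :: real and g :: "nat \<Rightarrow> real"
      by (simp only: sum_product) (simp only: sum_distrib_left)
    show ?thesis
      unfolding sum.distrib sw pr v0 V_def by simp
  qed
  finally have eq: "(\<rho> t)\<^sup>2 * (v 0 * v 0) + (\<Sum>d\<in>D. (\<eta> (fst d) t)\<^sup>2 * (V d * V d)) = 0"
    using null by simp
  have nn: "(\<Sum>d\<in>D. (\<eta> (fst d) t)\<^sup>2 * (V d * V d)) \<ge> 0" by (intro sum_nonneg) auto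
  moreover have "(\<rho> t)\<^sup>2 * (v 0 * v 0) \<ge> 0" by simp
  ultimately have "(\<rho> t)\<^sup>2 * (v 0 * v 0) = 0" and S0: "(\<Sum>d\<in>D. (\<eta> (fst d) t)\<^sup>2 * (V d * V d)) = 0"
    using eq by linarith+
  then have v_0: "v 0 = 0" using \<rho>(2)[OF tp(2)] by auto
  have "(\<eta> (fst d) t)\<^sup>2 * (V d * V d) = 0" if "d \<in> D" for d
    using S0 that finite_D by (subst (asm) sum_nonneg_eq_0_iff) auto
  then have V0: "V d = 0" if "d \<in> D" for d
    using that \<eta>(2)[of "fst d", OF _ tp(2)] by (force simp: D_def)
  show "v i = 0"
  proof (cases "i = 0")
    case False
    then obtain l where l: "l \<in> {1..k}" "i \<in> block M l"
      using block_cover[of i M k] i by (auto simp: mdim_W)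
    have pl: "p l \<in> cdom (M l) (\<alpha> l)" using tp(3) l(1) by auto
    have b: "blk l ?x = cmap (M l) (\<alpha> l) (p l)" unfolding tp(1) by (rule blk_cmap_W[where p = p, OF \<alpha> l(1) pl])
    have "(\<Sum>j<mdim (M l). partial_deriv j (rep \<alpha> l r) (cmap (M l) (\<alpha> l) (p l)) * v (block_start M l + j)) = 0"
      if r: "r < m l" for r
    proof -
      have "V (l, r) = (\<Sum>i<mdim W. if i \<in> block M l
          then partial_deriv (i - block_start M l) (rep \<alpha> l r) (blk l ?x) * v i else 0)"
        unfolding V_def by (intro sum.cong refl) (simp add: partial_Y[OF \<alpha> l(1) r x])
      also have "\<dots> = (\<Sum>j<mdim (M l). partial_deriv j (rep \<alpha> l r) (blk l ?x) * v (block_start M l + j))"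
        by (rule sum_over_block[OF l(1)])
      finally show ?thesis using V0[of "(l, r)"] l(1) r by (simp add: D_def b)
    qed
    from factor_kernel[OF \<alpha> l(1) pl this, of "i - block_start M l"]
    show ?thesis using l(2) by (auto simp: block_def)
  qed (simp add: v_0)
qed

definition coords ::
  "(nat \<times> nat \<Rightarrow> bool \<times> 'j \<Rightarrow> real \<Rightarrow> real \<Rightarrow> real) \<Rightarrow> (bool \<times> 'j \<Rightarrow> real \<Rightarrow> real)
    \<Rightarrow> bool \<times> (nat \<times> nat) option \<times> 'j \<Rightarrow> real \<times> (nat \<Rightarrow> 'a) \<Rightarrow> real"
  where "coords G u r z = (case fst (snd r) of None \<Rightarrow> u (fst r, snd (snd r)) (fst z)
    | Some d \<Rightarrow> G d (fst r, snd (snd r)) (fst z) (f (fst d) (snd z (fst d)) (snd d)))"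

lemma coords_simps [simp]:
  "coords G u (fst q, None, snd q) z = u q (fst z)"
  "coords G u (fst q, Some d, snd q) z = G d q (fst z) (f (fst d) (snd z (fst d)) (snd d))"
  by (simp_all add: coords_def)

lemma coords_eq:
  "coords G u (fst q, None, snd q) = (\<lambda>z. u q (fst z))"
  "coords G u (fst q, Some d, snd q) = (\<lambda>z. G d q (fst z) (f (fst d) (snd z (fst d)) (snd d)))"
  by (simp_all add: fun_eq_iff)

lemma coords_cinv:
  assumes "\<alpha> \<in> charts W" "x \<in> chart_image \<alpha>"
  shows "coords G u (fst q, None, snd q) (cinv W \<alpha> x) = u q (x 0)"
    and "d \<in> D \<Longrightarrow> coords G u (fst q, Some d, snd q) (cinv W \<alpha> x) = G d q (x 0) (Y \<alpha> d x)"
  using chart_image_eq(2)[OF assms] by (auto simp: D_def Y_def)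

lemma continuous_flat_coordinate:
  assumes "d \<in> D"
  shows "continuous_map (mtop W) euclideanreal (\<lambda>z. f (fst d) (snd z (fst d)) (snd d))"
proof -
  have l: "fst d \<in> {1..k}" using assms by (auto simp: D_def)
  have "continuous_map (Euclidean_space (m (fst d))) euclideanreal (\<lambda>x. x (snd d))"
    unfolding Euclidean_space_def
    by (intro continuous_map_from_subtopology continuous_map_product_projection) simp
  with factor_continuous[OF l]
  have "continuous_map (mtop (M (fst d))) euclideanreal ((\<lambda>x. x (snd d)) \<circ> f (fst d))"
    by (rule continuous_map_compose)
  moreover have "continuous_map (mtop W) (mtop (M (fst d))) ((\<lambda>p. p (fst d)) \<circ> snd)"
    unfolding mtop_W
    by (rule continuous_map_compose[OF continuous_map_snd continuous_map_product_projection[OF l]])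
  ultimately have "continuous_map (mtop W) euclideanreal (((\<lambda>x. x (snd d)) \<circ> f (fst d)) \<circ> ((\<lambda>p. p (fst d)) \<circ> snd))"
    by (rule continuous_map_compose[rotated])
  then show ?thesis by (simp add: o_def)
qed

lemma continuous_parameter: "continuous_map (mtop W) (top_of_set I) fst"
  unfolding mtop_W by (rule continuous_map_fst)

lemma continuous_coords:
  assumes "r \<in> index_set (insert None (Some ` D)) Q"
    and "\<And>q. q \<in> Q None \<Longrightarrow> smooth1 I (u q)"
    and "\<And>d q. d \<in> D \<Longrightarrow> q \<in> Q (Some d) \<Longrightarrow> locally_product I (G d q)"
  shows "continuous_map (mtop W) euclideanreal (coords G u r)"
proof -
  from assms(1) show ?thesis
  proof (cases rule: index_set_optionE)
    case (1 q)
    have "continuous_map (top_of_set I) euclideanreal (u q)"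
      using smooth1_continuous_on[OF assms(2)[OF 1(1)]] by simp
    from continuous_map_compose[OF continuous_parameter this] show ?thesis
      unfolding 1(2) coords_eq by (simp add: o_def)
  next
    case (2 d q)
    have pm: "continuous_map (mtop W) (prod_topology (top_of_set I) euclideanreal)
        (\<lambda>z. (fst z, f (fst d) (snd z (fst d)) (snd d)))"
      by (simp add: continuous_map_pairedI continuous_parameter continuous_flat_coordinate[OF 2(1)])
    have eq: "prod_topology (top_of_set I) euclideanreal = top_of_set (I \<times> UNIV)"
      by (metis prod_topology_subtopology_eu subtopology_UNIV)
    have cg: "continuous_map (top_of_set (I \<times> UNIV)) euclideanreal (\<lambda>z. G d q (fst z) (snd z))"
      using locally_product_continuous[OF I(1) assms(3)[OF 2(1,2)]] by simp
    have "continuous_map (mtop W) euclideanreal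
        ((\<lambda>z. G d q (fst z) (snd z)) \<circ> (\<lambda>z. (fst z, f (fst d) (snd z (fst d)) (snd d))))"
      by (rule continuous_map_compose[OF pm[unfolded eq] cg])
    then show ?thesis unfolding 2(3) coords_eq by (simp add: o_def)
  qed
qed

text \<open>
  By the chain rule and the relations of \<^const>\<open>warped_line\<close>, the coordinates of the direction \<open>d\<close> contribute
  \<open>P\<^sub>d dt\<^sup>2 + \<eta>\<^sup>2 dy\<^sub>d\<^sup>2\<close> and those of the profile curve \<open>g dt\<^sup>2\<close>.
\<close>

theorem signed_isometry_coords:
  fixes G :: "nat \<times> nat \<Rightarrow> bool \<times> 'j \<Rightarrow> real \<Rightarrow> real \<Rightarrow> real"
  assumes line: "\<And>d. d \<in> D \<Longrightarrow> warped_line I (\<eta> (fst d)) (Q (Some d)) (G d) (P d) (R d)"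
    and prof: "profile_curve I g (Q None) u R0"
    and g: "\<And>t. t \<in> I \<Longrightarrow> g t + (\<Sum>d\<in>D. P d t) = (\<rho> t)\<^sup>2"
  shows "signed_isometry W (index_set (insert None (Some ` D)) Q) (coords G u)"
    and "\<And>z. z \<in> topspace (mtop W) \<Longrightarrow>
      (\<Sum>r\<in>index_set (insert None (Some ` D)) Q. signature r * (coords G u r z)\<^sup>2) = R0 (fst z) + (\<Sum>d\<in>D. R d (fst z))"
proof -
  let ?R = "index_set (insert None (Some ` D)) Q"
  have finQ: "finite (Q None)" "\<And>d. d \<in> D \<Longrightarrow> finite (Q (Some d))"
    using prof line by (simp_all add: profile_curve_def warped_line_def)
  have sum_R: "(\<Sum>r\<in>?R. F r) = (\<Sum>q\<in>Q None. F (fst q, (None, snd q))) +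
      (\<Sum>d\<in>D. \<Sum>q\<in>Q (Some d). F (fst q, (Some d, snd q)))" for F :: "_ \<Rightarrow> real"
    by (rule sum_index_set_option) (use finite_D finQ in auto)
  have su: "smooth1 I (u q)" if "q \<in> Q None" for q using prof that by (simp add: profile_curve_def)
  have lp: "locally_product I (G d q)" if "d \<in> D" "q \<in> Q (Some d)" for d q
    using line[OF that(1)] that(2) by (simp add: warped_line_def)
  have x0: "x 0 \<in> I" if "\<alpha> \<in> charts W" "x \<in> chart_image \<alpha>" for \<alpha> x
    using that by (simp add: chart_image_eq(1))
  have lpu: "locally_product I (\<lambda>t y. u q t * 1)" if "q \<in> Q None" for q
    by (rule product_locally_product[OF I(1) su[OF that]]) simp
  have None: "smooth_on (mdim W) (chart_image \<alpha>) (\<lambda>x. coords G u (fst q, None, snd q) (cinv W \<alpha> x))"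
    "\<And>x i. x \<in> chart_image \<alpha> \<Longrightarrow> i < mdim W \<Longrightarrow>
      partial_deriv i (\<lambda>x. coords G u (fst q, None, snd q) (cinv W \<alpha> x)) x = deriv (u q) (x 0) * (if i = 0 then 1 else 0)"
    if \<alpha>: "\<alpha> \<in> charts W" and q: "q \<in> Q None" for \<alpha> q
  proof -
    note V = open_chart_image[OF \<alpha>]
    have s0: "smooth_on (mdim W) (chart_image \<alpha>) (\<lambda>_. 0)" by (simp add: smooth_on_def Ck_on_const)
    have lpr: "smooth_on (mdim W) (chart_image \<alpha>) (\<lambda>x. u q (x 0) * 1)"
      "\<And>x i. x \<in> chart_image \<alpha> \<Longrightarrow> i < mdim W \<Longrightarrow> partial_deriv i (\<lambda>x. u q (x 0) * 1) x =
        dt (\<lambda>t y. u q t * 1) (x 0) 0 * (if i = 0 then 1 else 0) + dy (\<lambda>t y. u q t * 1) (x 0) 0 * partial_deriv i (\<lambda>_. 0) x"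
      by (rule smooth_on_locally_product[where G = "\<lambda>t y. u q t * 1" and Y = "\<lambda>_. 0", OF V _ lpu[OF q] s0];
          use x0[OF \<alpha>] in simp)+
    have eq: "u q (x 0) * 1 = coords G u (fst q, None, snd q) (cinv W \<alpha> x)" if "x \<in> chart_image \<alpha>" for x
      by (simp only: coords_cinv(1)[OF \<alpha> that] mult_1_right)
    show "smooth_on (mdim W) (chart_image \<alpha>) (\<lambda>x. coords G u (fst q, None, snd q) (cinv W \<alpha> x))"
      by (rule smooth_on_cong[where f = "\<lambda>x. u q (x 0) * 1", OF V _ lpr(1)]) (rule eq)
    fix x i assume x: "x \<in> chart_image \<alpha>" and i: "i < mdim W"
    have "partial_deriv i (\<lambda>x. coords G u (fst q, None, snd q) (cinv W \<alpha> x)) x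
        = dt (\<lambda>t y. u q t * 1) (x 0) 0 * (if i = 0 then 1 else 0) + dy (\<lambda>t y. u q t * 1) (x 0) 0 * partial_deriv i (\<lambda>_. 0) x"
    proof -
      have pc: "partial_deriv i (\<lambda>x. u q (x 0) * 1) x
          = partial_deriv i (\<lambda>x. coords G u (fst q, None, snd q) (cinv W \<alpha> x)) x"
        by (rule partial_deriv_cong[OF V x i]) (rule eq)
      show ?thesis unfolding pc[symmetric] by (rule lpr(2)[OF x i])
    qed
    also have "\<dots> = deriv (u q) (x 0) * (if i = 0 then 1 else 0)"
      using dt_product[where w = "\<lambda>_. 1", OF su[OF q] x0[OF \<alpha> x]] by (simp add: partial_deriv_def)
    finally show "partial_deriv i (\<lambda>x. coords G u (fst q, None, snd q) (cinv W \<alpha> x)) x =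
      deriv (u q) (x 0) * (if i = 0 then 1 else 0)" .
  qed
  have Some: "smooth_on (mdim W) (chart_image \<alpha>) (\<lambda>x. coords G u (fst q, Some d, snd q) (cinv W \<alpha> x))"
    "\<And>x i. x \<in> chart_image \<alpha> \<Longrightarrow> i < mdim W \<Longrightarrow>
      partial_deriv i (\<lambda>x. coords G u (fst q, Some d, snd q) (cinv W \<alpha> x)) x =
      dt (G d q) (x 0) (Y \<alpha> d x) * (if i = 0 then 1 else 0) + dy (G d q) (x 0) (Y \<alpha> d x) * partial_deriv i (Y \<alpha> d) x"
    if \<alpha>: "\<alpha> \<in> charts W" and d: "d \<in> D" and q: "q \<in> Q (Some d)" for \<alpha> d q
  proof -
    note V = open_chart_image[OF \<alpha>]
    note lpr = smooth_on_locally_product[where G = "G d q" and Y = "Y \<alpha> d",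
        OF V _ lp[OF d q] smooth_Y[OF \<alpha> d]]
    have eq: "G d q (x 0) (Y \<alpha> d x) = coords G u (fst q, Some d, snd q) (cinv W \<alpha> x)" if "x \<in> chart_image \<alpha>" for x
      by (simp only: coords_cinv(2)[OF \<alpha> that d])
    show "smooth_on (mdim W) (chart_image \<alpha>) (\<lambda>x. coords G u (fst q, Some d, snd q) (cinv W \<alpha> x))"
      by (rule smooth_on_cong[where f = "\<lambda>x. G d q (x 0) (Y \<alpha> d x)", OF V _ lpr(1)]) (simp_all only: eq x0[OF \<alpha>])
    show "partial_deriv i (\<lambda>x. coords G u (fst q, Some d, snd q) (cinv W \<alpha> x)) x =
      dt (G d q) (x 0) (Y \<alpha> d x) * (if i = 0 then 1 else 0) + dy (G d q) (x 0) (Y \<alpha> d x) * partial_deriv i (Y \<alpha> d) x"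
      if "x \<in> chart_image \<alpha>" "i < mdim W" for x i
    proof -
      have pc: "partial_deriv i (\<lambda>x. G d q (x 0) (Y \<alpha> d x)) x
          = partial_deriv i (\<lambda>x. coords G u (fst q, Some d, snd q) (cinv W \<alpha> x)) x"
        by (rule partial_deriv_cong[OF V that]) (rule eq)
      show ?thesis unfolding pc[symmetric] by (rule lpr(2)) (simp_all add: that x0[OF \<alpha>])
    qed
  qed
  show "signed_isometry W ?R (coords G u)"
    unfolding signed_isometry_def
  proof (intro conjI ballI allI impI)
    show "finite ?R" unfolding index_set_def using finite_D finQ by (intro finite_imageI finite_SigmaI) auto
    show "continuous_map (mtop W) euclideanreal (coords G u r)" if "r \<in> ?R" for r
      by (rule continuous_coords[OF that su lp])
    show "smooth_on (mdim W) (cmap W \<alpha> ` cdom W \<alpha>) (\<lambda>x. coords G u r (cinv W \<alpha> x))"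
      if \<alpha>: "\<alpha> \<in> charts W" and r: "r \<in> ?R" for \<alpha> r
      using r
    proof (cases rule: index_set_optionE)
      case (1 q)
      then show ?thesis using None(1)[OF \<alpha>] by (simp only: chart_image_def)
    next
      case (2 d q)
      then show ?thesis using Some(1)[OF \<alpha>] by (simp only: chart_image_def)
    qed
    fix \<alpha> z i j
    assume \<alpha>: "\<alpha> \<in> charts W" and z: "z \<in> cdom W \<alpha>" and i: "i < mdim W" and j: "j < mdim W"
    let ?x = "cmap W \<alpha> z"
    let ?e = "\<lambda>i :: nat. if i = 0 then 1 else 0 :: real"
    have x: "?x \<in> chart_image \<alpha>" using z by (simp add: chart_image_def)
    have t: "?x 0 = fst z" using z by (auto simp: cdom_W cmap_W)
    have tI: "fst z \<in> I" using z by (auto simp: cdom_W)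
    have N: "(\<Sum>q\<in>Q None. signature q * (deriv (u q) (fst z) * ?e i * (deriv (u q) (fst z) * ?e j))) = g (fst z) * (?e i * ?e j)"
    proof -
      have "(\<Sum>q\<in>Q None. signature q * (deriv (u q) (fst z) * ?e i * (deriv (u q) (fst z) * ?e j)))
          = (\<Sum>q\<in>Q None. signature q * (deriv (u q) (fst z))\<^sup>2) * (?e i * ?e j)"
        unfolding sum_distrib_right by (intro sum.cong refl) (simp only: power2_eq_square mult_ac)
      then show ?thesis using prof tI by (simp add: profile_curve_def)
    qed
    have S: "(\<Sum>q\<in>Q (Some d). signature q *
        ((dt (G d q) (fst z) y * ?e i + dy (G d q) (fst z) y * a) * (dt (G d q) (fst z) y * ?e j + dy (G d q) (fst z) y * b)))
        = P d (fst z) * (?e i * ?e j) + (\<eta> (fst d) (fst z))\<^sup>2 * (a * b)" if d: "d \<in> D" for d y a b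
    proof -
      have "(\<Sum>q\<in>Q (Some d). signature q *
        ((dt (G d q) (fst z) y * ?e i + dy (G d q) (fst z) y * a) * (dt (G d q) (fst z) y * ?e j + dy (G d q) (fst z) y * b)))
        = (\<Sum>q\<in>Q (Some d). signature q * (dt (G d q) (fst z) y)\<^sup>2) * (?e i * ?e j)
        + (\<Sum>q\<in>Q (Some d). signature q * (dt (G d q) (fst z) y * dy (G d q) (fst z) y)) * (?e i * b + a * ?e j)
        + (\<Sum>q\<in>Q (Some d). signature q * (dy (G d q) (fst z) y)\<^sup>2) * (a * b)"
        unfolding sum_distrib_right sum.distrib[symmetric]
        by (intro sum.cong refl) (simp only: power2_eq_square ring_distribs mult_ac add_ac)
      then show ?thesis using line[OF d] tI by (simp add: warped_line_def)
    qed
    have "(\<Sum>r\<in>?R. signature r * (partial_deriv i (\<lambda>x. coords G u r (cinv W \<alpha> x)) ?x *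
        partial_deriv j (\<lambda>x. coords G u r (cinv W \<alpha> x)) ?x)) =
      (\<Sum>q\<in>Q None. signature q * (deriv (u q) (fst z) * ?e i * (deriv (u q) (fst z) * ?e j))) +
      (\<Sum>d\<in>D. \<Sum>q\<in>Q (Some d). signature q *
        ((dt (G d q) (fst z) (Y \<alpha> d ?x) * ?e i + dy (G d q) (fst z) (Y \<alpha> d ?x) * partial_deriv i (Y \<alpha> d) ?x) *
         (dt (G d q) (fst z) (Y \<alpha> d ?x) * ?e j + dy (G d q) (fst z) (Y \<alpha> d ?x) * partial_deriv j (Y \<alpha> d) ?x)))"
      unfolding sum_R
    proof (rule arg_cong2[where f = "(+)"], goal_cases)
      case 1
      show ?case
        by (rule sum.cong[OF refl]) (simp only: signature_pair None(2)[OF \<alpha> _ x i] None(2)[OF \<alpha> _ x j] t)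
    next
      case 2
      show ?case
        by (rule sum.cong[OF refl], rule sum.cong[OF refl])
          (simp only: signature_pair Some(2)[OF \<alpha> _ _ x i] Some(2)[OF \<alpha> _ _ x j] t)
    qed
    also have "\<dots> = g (fst z) * (?e i * ?e j) + (\<Sum>d\<in>D. P d (fst z) * (?e i * ?e j) +
        (\<eta> (fst d) (fst z))\<^sup>2 * (partial_deriv i (Y \<alpha> d) ?x * partial_deriv j (Y \<alpha> d) ?x))"
      unfolding N by (intro arg_cong2[where f = "(+)"] sum.cong refl S)
    also have "\<dots> = (g (fst z) + (\<Sum>d\<in>D. P d (fst z))) * (?e i * ?e j) +
        (\<Sum>d\<in>D. (\<eta> (fst d) (fst z))\<^sup>2 * (partial_deriv i (Y \<alpha> d) ?x * partial_deriv j (Y \<alpha> d) ?x))"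
      by (simp only: sum.distrib sum_distrib_right[symmetric] ring_distribs add.assoc)
    also have "\<dots> = metric W \<alpha> z i j"
      unfolding g[OF tI] metric_W_eq[OF \<alpha> z] by (simp only: mult.assoc)
    finally show "(\<Sum>r\<in>?R. signature r * (partial_deriv i (\<lambda>x. coords G u r (cinv W \<alpha> x)) ?x *
        partial_deriv j (\<lambda>x. coords G u r (cinv W \<alpha> x)) ?x)) = metric W \<alpha> z i j" .
  qed
  show "(\<Sum>r\<in>?R. signature r * (coords G u r z)\<^sup>2) = R0 (fst z) + (\<Sum>d\<in>D. R d (fst z))"
    if "z \<in> topspace (mtop W)" for z
  proof -
    have tI: "fst z \<in> I" using that by (auto simp: mtop_W)
    show ?thesis
      unfolding sum_R coords_simps signature_pair
      using prof line tI by (intro arg_cong2[where f = "(+)"] sum.cong refl)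
        (simp_all add: profile_curve_def warped_line_def)
  qed
qed

text \<open>
  Recovery in stages: first \<open>t\<close> from the profile curve, then each flat coordinate, then the point of
  each factor, because \<open>f l\<close> is an embedding.
\<close>

theorem coords_recover:
  assumes emb: "\<And>l. l \<in> {1..k} \<Longrightarrow> embedding_map (mtop (M l)) (Euclidean_space (m l)) (f l)"
    and line: "\<And>d. d \<in> D \<Longrightarrow> recovers_line I (Q (Some d)) (G d)"
    and prof: "recovers_parameter I (Q None) u"
    and z0: "z0 \<in> topspace (mtop W)" and ev: "\<forall>\<^sub>F z in F. z \<in> topspace (mtop W)"
    and lim: "\<And>r. r \<in> index_set (insert None (Some ` D)) Q \<Longrightarrow> (coords G u r \<longlongrightarrow> coords G u r z0) F"
  shows "limitin (mtop W) (\<lambda>z. z) z0 F"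
proof -
  have t0: "fst z0 \<in> I" using z0 by (auto simp: mtop_W)
  have inI: "\<forall>\<^sub>F z in F. fst z \<in> I" using ev by eventually_elim (auto simp: mtop_W)
  have "((\<lambda>z. u q (fst z)) \<longlongrightarrow> u q (fst z0)) F" if "q \<in> Q None" for q
    using lim[of "(fst q, None, snd q)"] that by (force simp: index_set_def coords_def[abs_def])
  then have t: "(fst \<longlongrightarrow> fst z0) F"
    using prof[unfolded recovers_parameter_def, rule_format, OF t0, of "filtermap fst F"] inI
    by (simp add: filterlim_filtermap eventually_filtermap)
  have y: "((\<lambda>z. f (fst d) (snd z (fst d)) (snd d)) \<longlongrightarrow> f (fst d) (snd z0 (fst d)) (snd d)) F" if d: "d \<in> D" for d
  proof -
    let ?h = "\<lambda>z. (fst z, f (fst d) (snd z (fst d)) (snd d))"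
    have "((\<lambda>z. G d q (fst z) (f (fst d) (snd z (fst d)) (snd d))) \<longlongrightarrow>
        G d q (fst z0) (f (fst d) (snd z0 (fst d)) (snd d))) F" if "q \<in> Q (Some d)" for q
      using lim[of "(fst q, Some d, snd q)"] that d by (force simp: index_set_def coords_def[abs_def])
    then show ?thesis
      using line[OF d, unfolded recovers_line_def, rule_format, OF t0, of "filtermap ?h F"
          "f (fst d) (snd z0 (fst d)) (snd d)"] t
      by (simp add: filterlim_filtermap)
  qed
  have "limitin (mtop (M l)) (\<lambda>z. snd z l) (snd z0 l) F" if l: "l \<in> {1..k}" for l
  proof (rule limitin_of_embedding[OF emb[OF l]])
    show "snd z0 l \<in> topspace (mtop (M l))" using z0 l by (auto simp: mtop_W)
    show "\<forall>\<^sub>F z in F. snd z l \<in> topspace (mtop (M l))"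
      using ev by eventually_elim (use l in \<open>auto simp: mtop_W\<close>)
    show "((\<lambda>z. f l (snd z l) i) \<longlongrightarrow> f l (snd z0 l) i) F" if "i < m l" for i
      using y[of "(l, i)"] l that by (simp add: D_def)
  qed
  moreover have "snd z0 \<in> extensional {1..k}" using z0 by (auto simp: mtop_W PiE_def)
  moreover have "\<forall>\<^sub>F z in F. snd z \<in> topspace (product_topology (\<lambda>l. mtop (M l)) {1..k})"
    using ev by eventually_elim (auto simp: mtop_W)
  moreover have "limitin (top_of_set I) fst (fst z0) F"
    using t inI t0 by (simp add: limitin_subtopology)
  ultimately show ?thesis
    unfolding mtop_W limitin_pairwise by (simp add: o_def limitin_componentwise)
qed

end

section \<open>Isometric immersions into semi-Euclidean spaces and quadrics\<close>

definition coordinate_isometry ::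
  "('a, 'i) metric_manifold \<Rightarrow> nat \<Rightarrow> nat \<Rightarrow> ('a \<Rightarrow> nat \<Rightarrow> real) \<Rightarrow> bool"
  where "coordinate_isometry M n a F \<longleftrightarrow> (\<forall>p. \<forall>s\<ge>n. F p s = 0) \<and>
    (\<forall>s. continuous_map (mtop M) euclideanreal (\<lambda>p. F p s)) \<and>
    (\<forall>\<alpha>\<in>charts M. \<forall>s. smooth_on (mdim M) (cmap M \<alpha> ` cdom M \<alpha>) (\<lambda>x. F (cinv M \<alpha> x) s)) \<and>
    (\<forall>\<alpha>\<in>charts M. \<forall>p\<in>cdom M \<alpha>. \<forall>i<mdim M. \<forall>j<mdim M.
      (\<Sum>s<n. (if s < a then -1 else 1) * (partial_deriv i (\<lambda>x. F (cinv M \<alpha> x) s) (cmap M \<alpha> p) *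
        partial_deriv j (\<lambda>x. F (cinv M \<alpha> x) s) (cmap M \<alpha> p))) = metric M \<alpha> p i j)"

text \<open>
  Any injection of the index set that puts the negative indices below \<open>a\<close> will do; unused places are
  filled with 0, so the numbers of coordinates only have to be bounded.
\<close>

lemma coordinate_isometry_of_signed:
  assumes iso: "signed_isometry M R \<Phi>"
    and neg: "card {r \<in> R. fst r} \<le> a" and pos: "card {r \<in> R. \<not> fst r} \<le> n - a" and an: "a \<le> n"
  obtains F where "coordinate_isometry M n a F"
    "\<forall>p. semi_inner n a (F p) (F p) = (\<Sum>r\<in>R. signature r * (\<Phi> r p)\<^sup>2)"
    "\<forall>r\<in>R. \<exists>s. \<forall>p. F p s = \<Phi> r p"
proof -
  have fin: "finite R" using iso by (simp add: signed_isometry_def)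
  obtain e1 where e1: "inj_on e1 {r \<in> R. fst r}" "e1 ` {r \<in> R. fst r} \<subseteq> {..<a}"
    using inj_on_iff_card_le[of "{r \<in> R. fst r}" "{..<a}"] fin neg by auto
  obtain e2 where e2: "inj_on e2 {r \<in> R. \<not> fst r}" "e2 ` {r \<in> R. \<not> fst r} \<subseteq> {a..<n}"
    using inj_on_iff_card_le[of "{r \<in> R. \<not> fst r}" "{a..<n}"] fin pos by auto
  define e where "e r = (if fst r then e1 r else e2 r)" for r
  have "e r < a" if "r \<in> R" "fst r" for r
    using subsetD[OF e1(2), of "e1 r"] that by (simp add: e_def)
  moreover have "a \<le> e r \<and> e r < n" if "r \<in> R" "\<not> fst r" for r
    using subsetD[OF e2(2), of "e2 r"] that by (simp add: e_def)
  ultimately have e_neg: "e r < a \<longleftrightarrow> fst r" and e_n: "e r < n" if "r \<in> R" for r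
    using that an by (cases "fst r"; fastforce)+
  have inj: "inj_on e R"
  proof (rule inj_onI)
    fix r r' assume rr: "r \<in> R" "r' \<in> R" "e r = e r'"
    then have "fst r = fst r'" using e_neg by metis
    then show "r = r'"
      using rr inj_onD[OF e1(1), of r r'] inj_onD[OF e2(1), of r r'] by (cases "fst r") (auto simp: e_def)
  qed
  define F where "F p s = (if s \<in> e ` R then \<Phi> (inv_into R e s) p else 0)" for p s
  have Fe: "F p (e r) = \<Phi> r p" if "r \<in> R" for r p
    using that by (simp add: F_def inv_into_f_f[OF inj])
  have F0: "F p s = 0" if "s \<notin> e ` R" for p s
    using that by (simp add: F_def)
  have sum_e: "(\<Sum>s<n. (if s < a then -1 else 1) * h s) = (\<Sum>r\<in>R. signature r * h (e r))"
    if "\<And>s. s \<notin> e ` R \<Longrightarrow> h s = 0" for h :: "nat \<Rightarrow> real"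
  proof -
    have "(\<Sum>s<n. (if s < a then -1 else 1) * h s) = (\<Sum>s\<in>e ` R. (if s < a then -1 else 1) * h s)"
      by (rule sum.mono_neutral_right) (use e_n that in auto)
    also have "\<dots> = (\<Sum>r\<in>R. (if e r < a then -1 else 1) * h (e r))"
      by (simp add: sum.reindex[OF inj])
    also have "\<dots> = (\<Sum>r\<in>R. signature r * h (e r))"
      by (intro sum.cong refl) (simp add: e_neg signature_def)
    finally show ?thesis .
  qed
  have pd0: "partial_deriv i (\<lambda>x. F (cinv M \<alpha> x) s) x = 0" if "s \<notin> e ` R" for i \<alpha> s x
    by (simp add: F0[OF that] partial_deriv_def)
  show thesis
  proof
    show "coordinate_isometry M n a F"
      unfolding coordinate_isometry_def
    proof (intro conjI ballI allI impI)
      show "F p s = 0" if "n \<le> s" for p s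
        using e_n that by (intro F0) force
      show "continuous_map (mtop M) euclideanreal (\<lambda>p. F p s)" for s
      proof (cases "s \<in> e ` R")
        case True
        then obtain r where "r \<in> R" "s = e r" by blast
        then show ?thesis using iso by (simp add: Fe signed_isometry_def)
      qed (simp add: F0)
      show "smooth_on (mdim M) (cmap M \<alpha> ` cdom M \<alpha>) (\<lambda>x. F (cinv M \<alpha> x) s)"
        if "\<alpha> \<in> charts M" for \<alpha> s
      proof (cases "s \<in> e ` R")
        case True
        then obtain r where "r \<in> R" "s = e r" by blast
        then show ?thesis using iso that by (simp add: Fe signed_isometry_def)
      qed (simp add: F0 smooth_on_def Ck_on_const)
      fix \<alpha> p i j assume *: "\<alpha> \<in> charts M" "p \<in> cdom M \<alpha>" "i < mdim M" "j < mdim M"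
      have "(\<Sum>s<n. (if s < a then -1 else 1) * (partial_deriv i (\<lambda>x. F (cinv M \<alpha> x) s) (cmap M \<alpha> p) *
        partial_deriv j (\<lambda>x. F (cinv M \<alpha> x) s) (cmap M \<alpha> p))) =
        (\<Sum>r\<in>R. signature r * (partial_deriv i (\<lambda>x. F (cinv M \<alpha> x) (e r)) (cmap M \<alpha> p) *
        partial_deriv j (\<lambda>x. F (cinv M \<alpha> x) (e r)) (cmap M \<alpha> p)))"
        by (rule sum_e) (simp add: pd0)
      also have "\<dots> = metric M \<alpha> p i j"
        using iso * by (simp add: Fe signed_isometry_def cong: sum.cong)
      finally show "(\<Sum>s<n. (if s < a then -1 else 1) * (partial_deriv i (\<lambda>x. F (cinv M \<alpha> x) s) (cmap M \<alpha> p) *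
        partial_deriv j (\<lambda>x. F (cinv M \<alpha> x) s) (cmap M \<alpha> p))) = metric M \<alpha> p i j" .
    qed
    show "\<forall>p. semi_inner n a (F p) (F p) = (\<Sum>r\<in>R. signature r * (\<Phi> r p)\<^sup>2)"
    proof
      fix p
      have "semi_inner n a (F p) (F p) = (\<Sum>r\<in>R. signature r * (F p (e r) * F p (e r)))"
        unfolding semi_inner_eq_sum[OF an] by (rule sum_e) (simp add: F0)
      then show "semi_inner n a (F p) (F p) = (\<Sum>r\<in>R. signature r * (\<Phi> r p)\<^sup>2)"
        by (simp add: Fe power2_eq_square cong: sum.cong)
    qed
    show "\<forall>r\<in>R. \<exists>s. \<forall>p. F p s = \<Phi> r p"
      using Fe by blast
  qed
qed

text \<open>
  A vector in the kernel of the differential has length 0 in the induced metric, so an isometric map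
  is an immersion.
\<close>

lemma isometric_immersionI:
  assumes smooth: "smooth_map M N F" and definite: "definite_metric M"
    and pullback: "\<And>\<alpha> \<beta> p i j. \<alpha> \<in> charts M \<Longrightarrow> \<beta> \<in> charts N \<Longrightarrow> p \<in> cdom M \<alpha> \<Longrightarrow> F p \<in> cdom N \<beta> \<Longrightarrow>
      i < mdim M \<Longrightarrow> j < mdim M \<Longrightarrow> pullback_metric M N F \<alpha> \<beta> p i j = metric M \<alpha> p i j"
  shows "isometric_immersion M N F"
  unfolding isometric_immersion_def immersion_def
proof (intro conjI ballI impI allI)
  fix \<alpha> \<beta> p v i
  assume *: "\<alpha> \<in> charts M" "\<beta> \<in> charts N" "p \<in> cdom M \<alpha>" "F p \<in> cdom N \<beta>"
    and ker: "\<forall>r<mdim N. (\<Sum>i<mdim M. jacobian M N F \<alpha> \<beta> p r i * v i) = 0" and i: "i < mdim M"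
  let ?J = "jacobian M N F \<alpha> \<beta> p"
  \<comment> \<open>\<open>g(v,v) = h(df(v), df(v))\<close>, in coordinates and with the four sums rearranged.\<close>
  have "(\<Sum>i<mdim M. \<Sum>j<mdim M. metric M \<alpha> p i j * v i * v j) =
      (\<Sum>i<mdim M. \<Sum>j<mdim M. \<Sum>r<mdim N. \<Sum>s<mdim N. metric N \<beta> (F p) r s * ((?J r i * v i) * (?J s j * v j)))"
    by (intro sum.cong refl)
      (simp add: pullback[OF *, symmetric] pullback_metric_def sum_distrib_right, simp add: mult_ac)
  also have "\<dots> = (\<Sum>r<mdim N. \<Sum>s<mdim N. \<Sum>i<mdim M. \<Sum>j<mdim M. metric N \<beta> (F p) r s * ((?J r i * v i) * (?J s j * v j)))"
  proof -
    have "(\<Sum>i<mdim M. \<Sum>j<mdim M. \<Sum>r<mdim N. \<Sum>s<mdim N. h i j r s)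
        = (\<Sum>r<mdim N. \<Sum>s<mdim N. \<Sum>i<mdim M. \<Sum>j<mdim M. h i j r s)" for h :: "nat \<Rightarrow> nat \<Rightarrow> nat \<Rightarrow> nat \<Rightarrow> real"
    proof -
      have "(\<Sum>(i, j)\<in>{..<mdim M} \<times> {..<mdim M}. \<Sum>(r, s)\<in>{..<mdim N} \<times> {..<mdim N}. h i j r s)
        = (\<Sum>(r, s)\<in>{..<mdim N} \<times> {..<mdim N}. \<Sum>(i, j)\<in>{..<mdim M} \<times> {..<mdim M}. h i j r s)"
        unfolding case_prod_unfold by (rule sum.swap)
      then show ?thesis by (simp add: sum.cartesian_product[symmetric])
    qed
    then show ?thesis .
  qed
  also have "\<dots> = (\<Sum>r<mdim N. \<Sum>s<mdim N. metric N \<beta> (F p) r s *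
      ((\<Sum>i<mdim M. ?J r i * v i) * (\<Sum>j<mdim M. ?J s j * v j)))"
    by (simp only: sum_product) (simp only: sum_distrib_left)
  also have "\<dots> = 0" using ker by simp
  finally show "v i = 0"
    using definite * i unfolding definite_metric_def by blast
qed (use smooth pullback in auto)

lemma smooth_on_subset: "smooth_on d V f \<Longrightarrow> U \<subseteq> V \<Longrightarrow> smooth_on d U f"
  unfolding smooth_on_def using Ck_on_subset by metis

lemma coordinate_isometry_continuous:
  assumes "coordinate_isometry M n a F"
  shows "continuous_map (mtop M) (Euclidean_space n) F"
proof -
  have "F = (\<lambda>p i. if i < n then F p i else 0)"
    using assms by (auto simp: coordinate_isometry_def fun_eq_iff)
  moreover have "continuous_map (mtop M) (Euclidean_space n) (\<lambda>p i. if i < n then F p i else 0)"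
    using assms by (simp add: continuous_map_componentwise_Euclidean_space coordinate_isometry_def)
  ultimately show ?thesis by simp
qed

lemma isometric_immersion_semi_euclidean:
  assumes F: "coordinate_isometry M n a F" and an: "a \<le> n" and definite: "definite_metric M"
  shows "isometric_immersion M (semi_euclidean n a) F"
proof (rule isometric_immersionI[OF _ definite])
  have rep: "local_rep M (semi_euclidean n a) F \<alpha> \<beta> x r = F (cinv M \<alpha> x) r" for \<alpha> \<beta> x r
    by (simp add: local_rep_def)
  show "smooth_map M (semi_euclidean n a) F"
    unfolding smooth_map_def
  proof (intro conjI ballI allI impI)
    show "continuous_map (mtop M) (mtop (semi_euclidean n a)) F"
      using coordinate_isometry_continuous[OF F] by simp
    fix \<alpha> \<beta> r assume "\<alpha> \<in> charts M"
    then have "smooth_on (mdim M) (cmap M \<alpha> ` cdom M \<alpha>) (\<lambda>x. F (cinv M \<alpha> x) r)"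
      using F by (simp add: coordinate_isometry_def)
    then show "smooth_on (mdim M) (cmap M \<alpha> ` {p \<in> cdom M \<alpha>. F p \<in> cdom (semi_euclidean n a) \<beta>})
        (\<lambda>x. local_rep M (semi_euclidean n a) F \<alpha> \<beta> x r)"
      unfolding rep by (rule smooth_on_subset) auto
  qed
  show "pullback_metric M (semi_euclidean n a) F \<alpha> \<beta> p i j = metric M \<alpha> p i j"
    if "\<alpha> \<in> charts M" "p \<in> cdom M \<alpha>" "i < mdim M" "j < mdim M" for \<alpha> \<beta> p i j
    using F that unfolding pullback_metric_semi_euclidean[OF an] jacobian_def rep
    by (simp add: coordinate_isometry_def)
qed

subsection \<open>The coordinate tangent vectors of a quadric\<close>

text \<open>
  The enumeration of the ambient coordinates other than \<open>j\<close>, i.e. of the coordinates of the chart that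
  projects along the \<open>j\<close>-th axis.
\<close>

definition skip :: "nat \<Rightarrow> nat \<Rightarrow> nat"
  where "skip j r = (if r < j then r else Suc r)"

lemma drop_coord_skip: "drop_coord j x r = x (skip j r)"
  by (simp add: drop_coord_def skip_def)

lemma sum_skip:
  fixes g :: "nat \<Rightarrow> real"
  assumes "j \<le> n"
  shows "(\<Sum>l<Suc n. g l) = g j + (\<Sum>r<n. g (skip j r))"
proof -
  have "(\<Sum>l<Suc n. g l) = g j + (\<Sum>l\<in>{..<Suc n} - {j}. g l)"
    using assms by (intro sum.remove) auto
  also have "(\<Sum>l\<in>{..<Suc n} - {j}. g l) = (\<Sum>r<n. g (skip j r))"
    by (rule sum.reindex_bij_witness[of _ "skip j" "\<lambda>l. if l < j then l else l - 1"])
      (use assms in \<open>auto simp: skip_def\<close>)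
  finally show ?thesis .
qed

lemma has_partial_sum:
  "(\<And>r. r \<in> A \<Longrightarrow> has_partial i (f r) (D r) x) \<Longrightarrow> has_partial i (\<lambda>x. \<Sum>r\<in>A. f r x) (\<Sum>r\<in>A. D r) x"
  unfolding has_partial_def by (rule DERIV_sum)

text \<open>
  Near the point the inverse chart is explicit: the missing coordinate is \<open>\<plusminus>\<surd>h\<close>, where \<open>h\<close> is the equation
  of the quadric solved for its square. Its derivative is that of the implicit function.
\<close>

lemma coord_tangent_eq:
  assumes j: "j \<le> n" and b: "b \<le> Suc n" and x: "x \<in> half_quadric n b q (j, pos)" and r: "r < n"
  shows "coord_tangent n b q (j, pos) x r s =
    (if s = j then - (if j < b then -1 else 1) * (if skip j r < b then -1 else 1) * x (skip j r) / x j
     else if s = skip j r then 1 else 0)"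
proof -
  define \<epsilon> where "\<epsilon> l = (if l < b then -1 else 1 :: real)" for l
  \<comment> \<open>\<open>lift\<close> is the inverse chart: \<open>h\<close> is the square of the missing coordinate, \<open>sg\<close> its sign on this half.\<close>
  define sg where "sg = (if pos then 1 else -1 :: real)"
  define h where "h y = \<epsilon> j * (q - (\<Sum>r<n. \<epsilon> (skip j r) * (y r * y r)))" for y :: "nat \<Rightarrow> real"
  define lift where "lift y = (\<lambda>s. if s < j then y s else if s = j then sg * sqrt (h y) else y (s - 1))"
    for y :: "nat \<Rightarrow> real"
  have \<epsilon>2: "\<epsilon> l * \<epsilon> l = 1" for l by (simp add: \<epsilon>_def)
  have sg2: "sg * sg = 1" by (simp add: sg_def)
  have drop_lift: "drop_coord j (lift y) = y" for y
    by (auto simp: drop_coord_def lift_def fun_eq_iff)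
  have quad: "semi_inner (Suc n) b z z = \<epsilon> j * (z j * z j) + (\<Sum>r<n. \<epsilon> (skip j r) * (z (skip j r) * z (skip j r)))" for z
    unfolding semi_inner_eq_sum[OF b] by (subst sum_skip[OF j]) (simp add: \<epsilon>_def)
  have on: "h (drop_coord j z) = z j * z j \<and> sg * z j > 0" if "z \<in> half_quadric n b q (j, pos)" for z
  proof -
    have "semi_inner (Suc n) b z z = q" using that by (simp add: half_quadric_def quadric_def)
    then have "q - (\<Sum>r<n. \<epsilon> (skip j r) * (z (skip j r) * z (skip j r))) = \<epsilon> j * (z j * z j)"
      unfolding quad by linarith
    then have "\<epsilon> j * (q - (\<Sum>r<n. \<epsilon> (skip j r) * (z (skip j r) * z (skip j r)))) = (\<epsilon> j * \<epsilon> j) * (z j * z j)"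
      by (simp only: mult.assoc)
    then show ?thesis
      using that by (auto simp: h_def drop_coord_skip \<epsilon>2 half_quadric_def sg_def split: if_splits)
  qed
  have lift_drop: "lift (drop_coord j z) = z" if z: "z \<in> half_quadric n b q (j, pos)" for z
  proof
    fix s
    have "sg * sqrt (z j * z j) = z j"
      using on[OF z] by (auto simp: sg_def split: if_splits)
    then show "lift (drop_coord j z) s = z s"
      using on[OF z] by (auto simp: lift_def drop_coord_def)
  qed
  have inj: "inj_on (drop_coord j) (half_quadric n b q (j, pos))"
    by (rule inj_on_inverseI[where g = lift, OF lift_drop])
  have lift_in: "lift y \<in> half_quadric n b q (j, pos)" if "\<forall>i\<ge>n. y i = 0" "h y > 0" for y
  proof -
    have lj: "lift y j * lift y j = h y"
      using that(2) sg2 by (simp add: lift_def mult_ac)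
    have "semi_inner (Suc n) b (lift y) (lift y) = \<epsilon> j * h y + (\<Sum>r<n. \<epsilon> (skip j r) * (y r * y r))"
      unfolding quad lj using drop_lift[of y] by (metis (no_types, lifting) drop_coord_skip)
    also have "\<epsilon> j * h y = (\<epsilon> j * \<epsilon> j) * (q - (\<Sum>r<n. \<epsilon> (skip j r) * (y r * y r)))"
      by (simp add: h_def)
    finally have "semi_inner (Suc n) b (lift y) (lift y) = q" by (simp add: \<epsilon>2)
    moreover have "lift y i = 0" if "i \<ge> Suc n" for i
      using that j \<open>\<forall>i\<ge>n. y i = 0\<close> by (simp add: lift_def)
    moreover have "if pos then lift y j > 0 else lift y j < 0"
      using that(2) by (auto simp: lift_def sg_def)
    ultimately show ?thesis
      by (simp add: half_quadric_def quadric_def topspace_Euclidean_space)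
  qed
  define y0 where "y0 = drop_coord j x"
  have y0: "\<forall>i\<ge>n. y0 i = 0"
    using x j by (auto simp: y0_def half_quadric_def quadric_def topspace_Euclidean_space drop_coord_def)
  have hy0: "h y0 = x j * x j" "sg * x j > 0" using on[OF x] by (auto simp: y0_def)
  then have pos0: "h y0 > 0" by (metis mult_eq_0_iff less_irrefl not_square_less_zero linorder_neqE_linordered_idom)
  have ph: "has_partial r h (- 2 * (\<epsilon> j * \<epsilon> (skip j r) * y0 r)) y0"
  proof -
    have "has_partial r (\<lambda>y. \<epsilon> (skip j r') * (y r' * y r')) (if r' = r then 2 * (\<epsilon> (skip j r) * y0 r) else 0) y0" for r'
    proof -
      have c: "has_partial r (\<lambda>y. y r') (if r = r' then 1 else 0) y0" by (rule has_partial_coordinate)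
      from DERIV_cmult[OF has_partial_mult[OF c c, unfolded has_partial_def], of "\<epsilon> (skip j r')"]
      show ?thesis unfolding has_partial_def by (cases "r = r'") (simp_all add: algebra_simps)
    qed
    then have "has_partial r (\<lambda>y. \<Sum>r'<n. \<epsilon> (skip j r') * (y r' * y r'))
        (\<Sum>r'<n. if r' = r then 2 * (\<epsilon> (skip j r) * y0 r) else 0) y0"
      by (intro has_partial_sum)
    then have "has_partial r (\<lambda>y. \<Sum>r'<n. \<epsilon> (skip j r') * (y r' * y r')) (2 * (\<epsilon> (skip j r) * y0 r)) y0"
      using r by simp
    from DERIV_cmult[OF DERIV_diff[OF DERIV_const this[unfolded has_partial_def]], of "\<epsilon> j" q]
    show ?thesis
      unfolding has_partial_def h_def by (simp only: mult_minus_left mult_minus_right diff_0 mult_ac)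
  qed
  have "isCont (\<lambda>t. h (y0(r := t))) (y0 r)"
    using ph unfolding has_partial_def by (rule DERIV_isCont)
  then have "((\<lambda>t. h (y0(r := t))) \<longlongrightarrow> h y0) (nhds (y0 r))"
    using tendsto_at_iff_tendsto_nhds[of "\<lambda>t. h (y0(r := t))" "y0 r"] by (simp add: continuous_within)
  then have "\<forall>\<^sub>F t in nhds (y0 r). h (y0(r := t)) > 0"
    using pos0 by (rule order_tendstoD(1))
  then have ev: "\<forall>\<^sub>F t in nhds (y0 r). inv_into (half_quadric n b q (j, pos)) (drop_coord j) (y0(r := t)) s = lift (y0(r := t)) s"
  proof eventually_elim
    case (elim t)
    have "lift (y0(r := t)) \<in> half_quadric n b q (j, pos)"
      by (rule lift_in) (use y0 r elim in auto)
    then have "inv_into (half_quadric n b q (j, pos)) (drop_coord j) (y0(r := t)) = lift (y0(r := t))"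
      by (intro inv_into_f_eq inj drop_lift)
    then show ?case by simp
  qed
  have "coord_tangent n b q (j, pos) x r s = partial_deriv r (\<lambda>y. lift y s) y0"
    unfolding coord_tangent_def partial_deriv_def y0_def[symmetric] fst_conv
    by (rule deriv_cong_ev[OF ev refl])
  also have "\<dots> = (if s = j then - \<epsilon> j * \<epsilon> (skip j r) * x (skip j r) / x j else if s = skip j r then 1 else 0)"
  proof (rule has_partial_imp_partial_deriv)
    consider "s = j" | "s < j" | "s > j" by linarith
    then show "has_partial r (\<lambda>y. lift y s)
        (if s = j then - \<epsilon> j * \<epsilon> (skip j r) * x (skip j r) / x j else if s = skip j r then 1 else 0) y0"
    proof cases
      case 1
      have "((\<lambda>v. sg * sqrt v) has_real_derivative sg * (inverse (sqrt (h y0)) / 2)) (at (h y0))"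
        by (rule DERIV_cmult[OF DERIV_real_sqrt[OF pos0]])
      from has_partial_compose[OF ph this]
      have "has_partial r (\<lambda>y. sg * sqrt (h y)) (sg * (inverse (sqrt (h y0)) / 2) * (- 2 * (\<epsilon> j * \<epsilon> (skip j r) * y0 r))) y0" .
      moreover have "sqrt (h y0) = sg * x j"
        using hy0 by (auto simp: sg_def split: if_splits)
      moreover have "y0 r = x (skip j r)" by (simp add: y0_def drop_coord_skip)
      ultimately show ?thesis
        using 1 by (auto simp: lift_def sg_def field_simps split: if_splits)
    next
      case 2
      have "has_partial r (\<lambda>y. y s) (if r = s then 1 else 0) y0" by (rule has_partial_coordinate)
      then show ?thesis using 2 by (auto simp: lift_def skip_def split: if_splits)
    next
      case 3
      have "has_partial r (\<lambda>y. y (s - 1)) (if r = s - 1 then 1 else 0) y0" by (rule has_partial_coordinate)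
      moreover have "s = skip j r \<longleftrightarrow> r = s - 1" using 3 by (auto simp: skip_def)
      ultimately show ?thesis using 3 by (auto simp: lift_def split: if_splits)
    qed
  qed
  finally show ?thesis by (simp only: \<epsilon>_def)
qed

lemma hyperquadric_simps [simp]:
  "mdim (hyperquadric n b q) = n"
  "mtop (hyperquadric n b q) = subtopology (Euclidean_space (Suc n)) (quadric n b q)"
  "charts (hyperquadric n b q) = {..n} \<times> UNIV"
  "cdom (hyperquadric n b q) \<kappa> = half_quadric n b q \<kappa>"
  "cmap (hyperquadric n b q) \<kappa> = drop_coord (fst \<kappa>)"
  "metric (hyperquadric n b q) \<kappa> p i j =
    semi_inner (Suc n) b (coord_tangent n b q \<kappa> p i) (coord_tangent n b q \<kappa> p j)"
  by (simp_all add: hyperquadric_def)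

definition open_charts :: "('a, 'i) metric_manifold \<Rightarrow> bool"
  where "open_charts M \<longleftrightarrow> (\<forall>\<alpha>\<in>charts M. openin (Euclidean_space (mdim M)) (cmap M \<alpha> ` cdom M \<alpha>) \<and>
    inj_on (cmap M \<alpha>) (cdom M \<alpha>) \<and> cdom M \<alpha> \<subseteq> topspace (mtop M))"

text \<open>
  The tangent vector of \<open>F\<close> in the ambient space is the combination of the coordinate tangent vectors
  with the entries of the Jacobian as coefficients. For the coordinates of the chart this is trivial.
  For the coordinate \<open>j\<close> that was projected away it is the equation obtained by differentiating
  \<open>\<langle>F,F\<rangle> = q\<close>. Thus the metric of the quadric pulls back to what the ambient inner product induces.
\<close>

lemma isometric_immersion_hyperquadric:
  assumes F: "coordinate_isometry M (Suc n) b F" and b: "b \<le> Suc n" and definite: "definite_metric M"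
    and op: "open_charts M"
    and q: "\<And>p. p \<in> topspace (mtop M) \<Longrightarrow> semi_inner (Suc n) b (F p) (F p) = q"
  shows "isometric_immersion M (hyperquadric n b q) F"
proof (rule isometric_immersionI[OF _ definite])
  have rep: "local_rep M (hyperquadric n b q) F \<alpha> \<kappa> x r = F (cinv M \<alpha> x) (skip (fst \<kappa>) r)" for \<alpha> \<kappa> x r
    by (simp add: local_rep_def drop_coord_skip)
  have smooth: "smooth_on (mdim M) (cmap M \<alpha> ` cdom M \<alpha>) (\<lambda>x. F (cinv M \<alpha> x) s)" if "\<alpha> \<in> charts M" for \<alpha> s
    using F that by (simp add: coordinate_isometry_def)
  show "smooth_map M (hyperquadric n b q) F"
    unfolding smooth_map_def
  proof (intro conjI ballI allI impI)
    have "F p \<in> quadric n b q" if "p \<in> topspace (mtop M)" for p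
      using F q[OF that] by (simp add: coordinate_isometry_def quadric_def topspace_Euclidean_space)
    then show "continuous_map (mtop M) (mtop (hyperquadric n b q)) F"
      using coordinate_isometry_continuous[OF F] by (auto simp: continuous_map_in_subtopology)
    fix \<alpha> \<kappa> r assume "\<alpha> \<in> charts M"
    from smooth[OF this, of "skip (fst \<kappa>) r"]
    show "smooth_on (mdim M) (cmap M \<alpha> ` {p \<in> cdom M \<alpha>. F p \<in> cdom (hyperquadric n b q) \<kappa>})
        (\<lambda>x. local_rep M (hyperquadric n b q) F \<alpha> \<kappa> x r)"
      unfolding rep by (rule smooth_on_subset) auto
  qed
  fix \<alpha> \<kappa> p i k
  assume \<alpha>: "\<alpha> \<in> charts M" and \<kappa>: "\<kappa> \<in> charts (hyperquadric n b q)" and p: "p \<in> cdom M \<alpha>"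
    and Fp: "F p \<in> cdom (hyperquadric n b q) \<kappa>" and i: "i < mdim M" and k: "k < mdim M"
  obtain j pos where \<kappa>_eq: "\<kappa> = (j, pos)" "j \<le> n" using \<kappa> by (cases \<kappa>) auto
  let ?x = "cmap M \<alpha> p"
  let ?\<epsilon> = "\<lambda>l. if l < b then -1 else 1 :: real"
  define dF where "dF i s = partial_deriv i (\<lambda>x. F (cinv M \<alpha> x) s) ?x" for i s
  have V: "openin (Euclidean_space (mdim M)) (cmap M \<alpha> ` cdom M \<alpha>)" "inj_on (cmap M \<alpha>) (cdom M \<alpha>)"
    "cdom M \<alpha> \<subseteq> topspace (mtop M)"
    using op \<alpha> by (auto simp: open_charts_def)
  have x: "?x \<in> cmap M \<alpha> ` cdom M \<alpha>" using p by simp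
  have cinv_x: "cinv M \<alpha> ?x = p" using V(2) p by (simp add: cinv_def)
  have J: "jacobian M (hyperquadric n b q) F \<alpha> \<kappa> p r i = dF i (skip j r)" for r i
    by (simp add: jacobian_def rep dF_def \<kappa>_eq(1))
  have Fj: "F p j \<noteq> 0" using Fp by (auto simp: \<kappa>_eq(1) half_quadric_def split: if_splits)
  \<comment> \<open>The equation \<open>\<langle>F,F\<rangle> = q\<close> differentiated in the \<open>i\<close>-th direction of the chart.\<close>
  have null: "(\<Sum>l<Suc n. ?\<epsilon> l * (F p l * dF i l)) = 0" if i: "i < mdim M" for i
  proof -
    have hp: "has_partial i (\<lambda>x. F (cinv M \<alpha> x) l) (dF i l) ?x" for l
    proof -
      have "Ck_on (mdim M) (Suc 0) (cmap M \<alpha> ` cdom M \<alpha>) (\<lambda>x. F (cinv M \<alpha> x) l)"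
        using smooth[OF \<alpha>] unfolding smooth_on_def by blast
      from Ck_on_imp_has_partial[OF this x i] show ?thesis unfolding dF_def .
    qed
    have "has_partial i (\<lambda>x. \<Sum>l<Suc n. ?\<epsilon> l * (F (cinv M \<alpha> x) l * F (cinv M \<alpha> x) l))
        (\<Sum>l<Suc n. ?\<epsilon> l * (dF i l * F p l + dF i l * F p l)) ?x"
    proof (rule has_partial_sum)
      fix l
      show "has_partial i (\<lambda>x. ?\<epsilon> l * (F (cinv M \<alpha> x) l * F (cinv M \<alpha> x) l)) (?\<epsilon> l * (dF i l * F p l + dF i l * F p l)) ?x"
        using has_partial_mult[OF hp hp, of l l] DERIV_cmult unfolding has_partial_def cinv_x by blast
    qed
    moreover have "has_partial i (\<lambda>x. \<Sum>l<Suc n. ?\<epsilon> l * (F (cinv M \<alpha> x) l * F (cinv M \<alpha> x) l)) 0 ?x"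
    proof (subst has_partial_cong[OF V(1) x i])
      show "has_partial i (\<lambda>_. q) 0 ?x" by (simp add: has_partial_def)
      fix y assume "y \<in> cmap M \<alpha> ` cdom M \<alpha>"
      then have "cinv M \<alpha> y \<in> topspace (mtop M)" using V(2,3) by (auto simp: cinv_def)
      from q[OF this] show "(\<Sum>l<Suc n. ?\<epsilon> l * (F (cinv M \<alpha> y) l * F (cinv M \<alpha> y) l)) = q"
        unfolding semi_inner_eq_sum[OF b] .
    qed
    ultimately have "(\<Sum>l<Suc n. ?\<epsilon> l * (dF i l * F p l + dF i l * F p l)) = 0"
      unfolding has_partial_def by (rule DERIV_unique)
    moreover have "(\<Sum>l<Suc n. ?\<epsilon> l * (dF i l * F p l + dF i l * F p l)) = 2 * (\<Sum>l<Suc n. ?\<epsilon> l * (F p l * dF i l))"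
      unfolding sum_distrib_left by (intro sum.cong refl) (simp add: algebra_simps)
    ultimately show ?thesis by simp
  qed
  define T where "T r = coord_tangent n b q \<kappa> (F p) r" for r
  have T: "T r s = (if s = j then - ?\<epsilon> j * ?\<epsilon> (skip j r) * F p (skip j r) / F p j
      else if s = skip j r then 1 else 0)" if "r < n" for r s
    unfolding T_def \<kappa>_eq(1) by (rule coord_tangent_eq[OF \<kappa>_eq(2) b _ that]) (use Fp in \<open>simp add: \<kappa>_eq(1)\<close>)
  have push: "(\<Sum>r<n. T r l * dF i (skip j r)) = dF i l" if l: "l < Suc n" and i: "i < mdim M" for l i
  proof (cases "l = j")
    case True
    have "(\<Sum>r<n. T r l * dF i (skip j r)) =
        (\<Sum>r<n. - ?\<epsilon> j / F p j * (?\<epsilon> (skip j r) * (F p (skip j r) * dF i (skip j r))))"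
      by (intro sum.cong refl) (simp add: T True)
    also have "\<dots> = - ?\<epsilon> j / F p j * (\<Sum>r<n. ?\<epsilon> (skip j r) * (F p (skip j r) * dF i (skip j r)))"
      by (simp only: sum_distrib_left)
    also have "(\<Sum>r<n. ?\<epsilon> (skip j r) * (F p (skip j r) * dF i (skip j r))) = - (?\<epsilon> j * (F p j * dF i j))"
      using null[OF i] unfolding sum_skip[OF \<kappa>_eq(2)] by linarith
    finally show ?thesis using Fj True by auto
  next
    case False
    define r0 where "r0 = (if l < j then l else l - 1)"
    have r0: "r0 < n" "skip j r0 = l" "\<And>r. skip j r = l \<longleftrightarrow> r = r0"
      using False l \<kappa>_eq(2) by (auto simp: r0_def skip_def split: if_splits)
    have "(\<Sum>r<n. T r l * dF i (skip j r)) = (\<Sum>r<n. if r = r0 then dF i l else 0)"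
    proof (rule sum.cong[OF refl])
      fix r assume "r \<in> {..<n}"
      then have "T r l = (if l = skip j r then 1 else 0)" using False by (subst T) simp_all
      moreover have "l = skip j r \<longleftrightarrow> r = r0" using r0(3)[of r] by metis
      ultimately show "T r l * dF i (skip j r) = (if r = r0 then dF i l else 0)"
        by (cases "r = r0") (simp_all add: r0(2))
    qed
    then show ?thesis using r0(1) by simp
  qed
  have "pullback_metric M (hyperquadric n b q) F \<alpha> \<kappa> p i k =
      (\<Sum>r<n. \<Sum>s<n. (\<Sum>l<Suc n. ?\<epsilon> l * (T r l * T s l)) * dF i (skip j r) * dF k (skip j s))"
    by (simp add: pullback_metric_def J semi_inner_eq_sum[OF b] T_def)
  also have "\<dots> = (\<Sum>r<n. \<Sum>s<n. \<Sum>l<Suc n. ?\<epsilon> l * ((T r l * dF i (skip j r)) * (T s l * dF k (skip j s))))"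
    unfolding sum_distrib_right by (intro sum.cong refl) (simp only: mult_ac)
  also have "\<dots> = (\<Sum>l<Suc n. \<Sum>r<n. \<Sum>s<n. ?\<epsilon> l * ((T r l * dF i (skip j r)) * (T s l * dF k (skip j s))))"
  proof -
    have "(\<Sum>r<n. \<Sum>s<n. \<Sum>l<Suc n. g r s l) = (\<Sum>l<Suc n. \<Sum>r<n. \<Sum>s<n. g r s l)" for g :: "nat \<Rightarrow> nat \<Rightarrow> nat \<Rightarrow> real"
      by (subst sum.swap[of _ "{..<Suc n}" "{..<n}"]) (rule sum.swap[of _ "{..<Suc n}" "{..<n}"])
    then show ?thesis .
  qed
  also have "\<dots> = (\<Sum>l<Suc n. ?\<epsilon> l * ((\<Sum>r<n. T r l * dF i (skip j r)) * (\<Sum>s<n. T s l * dF k (skip j s))))"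
    by (simp only: sum_product) (simp only: sum_distrib_left)
  also have "\<dots> = (\<Sum>l<Suc n. ?\<epsilon> l * (dF i l * dF k l))"
    by (intro sum.cong refl) (simp only: push[OF _ i] push[OF _ k] lessThan_iff)
  also have "\<dots> = metric M \<alpha> p i k"
    using F \<alpha> p i k by (simp add: coordinate_isometry_def dF_def)
  finally show "pullback_metric M (hyperquadric n b q) F \<alpha> \<kappa> p i k = metric M \<alpha> p i k" .
qed

section \<open>Embeddings\<close>

text \<open>
  For an open set \<open>U\<close> around \<open>p\<^sub>0\<close>, apply recovery to the filter of neighbourhoods of \<open>F p\<^sub>0\<close> pulled back
  by \<open>F\<close>: the points mapped close to \<open>F p\<^sub>0\<close> lie in \<open>U\<close>, so \<open>F\<close> is open onto its image. The principal
  filter of a point with the same image gives injectivity.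
\<close>

lemma embedding_map_of_recovery:
  assumes cont: "continuous_map X (Euclidean_space n) F" and haus: "Hausdorff_space X"
    and rec: "\<And>p0 L. p0 \<in> topspace X \<Longrightarrow> \<forall>\<^sub>F p in L. p \<in> topspace X \<Longrightarrow>
      (\<And>s. ((\<lambda>p. F p s) \<longlongrightarrow> F p0 s) L) \<Longrightarrow> limitin X (\<lambda>p. p) p0 L"
  shows "embedding_map X (Euclidean_space n) F"
  unfolding embedding_map_def
proof (rule bijective_open_imp_homeomorphic_map)
  let ?Y = "subtopology (Euclidean_space n) (F ` topspace X)"
  have img: "F ` topspace X \<subseteq> topspace (Euclidean_space n)"
    using cont by (auto simp: continuous_map_def)
  show "continuous_map X ?Y F" using cont by (auto simp: continuous_map_in_subtopology)
  show "F ` topspace X = topspace ?Y" using img by auto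
  show "inj_on F (topspace X)"
  proof (rule inj_onI)
    fix p p' assume pp: "p \<in> topspace X" "p' \<in> topspace X" "F p = F p'"
    have "limitin X (\<lambda>p. p) p0 (principal {p'})" if "p0 \<in> topspace X" "F p0 = F p'" for p0
      using that pp(2) by (intro rec) (auto simp: eventually_principal tendsto_def)
    from this[OF pp(1,3)] this[OF pp(2) refl] show "p = p'"
      by (rule limitin_Hausdorff_unique) (use haus in \<open>simp_all add: principal_eq_bot_iff\<close>)
  qed
  show "open_map X ?Y F"
    unfolding open_map_def
  proof (intro allI impI)
    fix U assume U: "openin X U"
    show "openin ?Y (F ` U)"
    proof (subst openin_subopen, rule ballI)
      fix y assume "y \<in> F ` U"
      then obtain p0 where p0: "p0 \<in> U" "y = F p0" by blast
      have p0X: "p0 \<in> topspace X" using openin_subset[OF U] p0(1) by blast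
      let ?L = "inf (filtercomap F (nhds (F p0))) (principal (topspace X))"
      have lim: "(F \<longlongrightarrow> F p0) ?L"
        by (rule filterlim_mono[OF filterlim_filtercomap order_refl inf_le1])
      have "((\<lambda>p. F p s) \<longlongrightarrow> F p0 s) ?L" for s
        by (rule continuous_on_tendsto_compose[OF continuous_on_product_coordinates lim]) simp_all
      then have "limitin X (\<lambda>p. p) p0 ?L"
        by (intro rec p0X) (auto simp: eventually_inf_principal)
      then have "\<forall>\<^sub>F p in ?L. p \<in> U" using U p0(1) by (simp add: limitin_def)
      then obtain T where T: "open T" "F p0 \<in> T" "\<And>p. p \<in> topspace X \<Longrightarrow> F p \<in> T \<Longrightarrow> p \<in> U"
        by (auto simp: eventually_inf_principal eventually_filtercomap_nhds)
      have "openin ?Y (F ` topspace X \<inter> T)"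
        using T(1) img by (auto simp: openin_subtopology Euclidean_space_eq_top_of_set openin_open)
      then show "\<exists>T. openin ?Y T \<and> y \<in> T \<and> T \<subseteq> F ` U"
        using T(2,3) p0 p0X by (intro exI[of _ "F ` topspace X \<inter> T"]) auto
    qed
  qed
qed

context immersed_warped_product
begin

lemma inj_cmap_W:
  assumes "\<alpha> \<in> charts W"
  shows "inj_on (cmap W \<alpha>) (cdom W \<alpha>)"
proof (rule inj_onI)
  fix z z' assume zz: "z \<in> cdom W \<alpha>" "z' \<in> cdom W \<alpha>" "cmap W \<alpha> z = cmap W \<alpha> z'"
  obtain t p t' p' where tp: "z = (t, p)" "z' = (t', p')"
    "p \<in> (\<Pi>\<^sub>E l\<in>{1..k}. cdom (M l) (\<alpha> l))" "p' \<in> (\<Pi>\<^sub>E l\<in>{1..k}. cdom (M l) (\<alpha> l))"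
    using zz(1,2) by (auto simp: cdom_W)
  have "t = t'" using fun_cong[OF zz(3), of 0] by (simp add: tp cmap_W)
  moreover have "p l = p' l" if l: "l \<in> {1..k}" for l
  proof -
    have pl: "p l \<in> cdom (M l) (\<alpha> l)" "p' l \<in> cdom (M l) (\<alpha> l)" using tp(3,4) l by auto
    have "cmap (M l) (\<alpha> l) (p l) = cmap (M l) (\<alpha> l) (p' l)"
      using blk_cmap_W[where p = p and t = t, OF assms l pl(1)]
        blk_cmap_W[where p = p' and t = t', OF assms l pl(2)] zz(3) tp(1,2) by simp
    then show ?thesis using inj_onD[OF factor_chart(2)[OF assms l] _ pl] by blast
  qed
  then have "p = p'" using tp(3,4) by (intro PiE_ext) auto
  ultimately show "z = z'" by (simp add: tp)
qed

lemma open_charts_W: "open_charts W"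
  unfolding open_charts_def
proof (intro ballI conjI)
  fix \<alpha> assume \<alpha>: "\<alpha> \<in> charts W"
  show "openin (Euclidean_space (mdim W)) (cmap W \<alpha> ` cdom W \<alpha>)"
    using open_chart_image[OF \<alpha>] by (simp add: chart_image_def)
  show "inj_on (cmap W \<alpha>) (cdom W \<alpha>)" by (rule inj_cmap_W[OF \<alpha>])
  show "cdom W \<alpha> \<subseteq> topspace (mtop W)"
    using subsetD[OF cdom_subset[OF \<alpha>]] by (auto simp: cdom_W mtop_W PiE_iff)
qed

lemma Hausdorff_W: "Hausdorff_space (mtop W)"
  using manifold
  by (auto simp: mtop_W smooth_manifold_def Hausdorff_space_prod_topology Hausdorff_space_product_topology
      Hausdorff_space_subtopology)

end

section \<open>Models in the three target spaces\<close>

lemma card_filter_eq_sum: "finite X \<Longrightarrow> card {x \<in> X. T x} = (\<Sum>x\<in>X. if T x then 1 else 0)"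
  by (simp flip: sum.inter_filter)

lemma card_index_set:
  assumes "finite D" "finite (Q None)" "\<And>d. d \<in> D \<Longrightarrow> finite (Q (Some d))"
  shows "card {r \<in> index_set (insert None (Some ` D)) Q. T (fst r)} =
    card {q \<in> Q None. T (fst q)} + (\<Sum>d\<in>D. card {q \<in> Q (Some d). T (fst q)})"
proof -
  have "finite (index_set (insert None (Some ` D)) Q)"
    unfolding index_set_def using assms by (intro finite_imageI finite_SigmaI) auto
  then show ?thesis
    using assms sum_index_set_option[where Q = Q, OF assms, of "\<lambda>r. if T (fst r) then 1 else 0 :: nat"]
    by (simp add: card_filter_eq_sum)
qed

lemma sum_if_subset:
  assumes "finite D" "A \<subseteq> D"
  shows "(\<Sum>d\<in>D. if d \<in> A then x else (y :: nat)) = card A * x + (card D - card A) * y"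
proof -
  have "(\<Sum>d\<in>D. if d \<in> A then x else y) = (\<Sum>d\<in>A. x) + (\<Sum>d\<in>D - A. y)"
    using assms by (simp add: sum.If_cases Int_absorb1 Diff_eq)
  then show ?thesis using assms by (simp add: card_Diff_subset finite_subset)
qed

text \<open>
  The index sets of the coordinates that replace one flat direction. A direction that has to use up
  a negative coordinate takes the signature \<open>(-,+)\<close> of the hyperbolic model or, in the horospheric
  case, the signature \<open>(-,+,+)\<close>; every other direction takes \<open>2N\<close> positive coordinates. These
  are the numbers that produce the dimensions in the theorem: \<open>N = 2\<close> for immersions,
  \<open>N = 4\<close> for embeddings.
\<close>

definition negative_slots :: "bool \<Rightarrow> (bool \<times> bool \<times> nat) set"
  where "negative_slots horo = (if horo then {(True, False, 0), (False, False, 0), (False, True, 0)}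
    else UNIV \<times> {(False, 0)})"

definition positive_slots :: "nat \<Rightarrow> (bool \<times> bool \<times> nat) set"
  where "positive_slots N = {False} \<times> UNIV \<times> {..<N}"

lemma card_negative_slots:
  "card {q \<in> negative_slots horo. fst q} = 1"
  "card {q \<in> negative_slots horo. \<not> fst q} = (if horo then 2 else 1)"
proof -
  have "{q \<in> negative_slots horo. fst q} = {(True, False, 0)}"
    by (auto simp: negative_slots_def)
  then show "card {q \<in> negative_slots horo. fst q} = 1" by simp
  have "{q \<in> negative_slots horo. \<not> fst q} = (if horo then {(False, False, 0), (False, True, 0)} else {(False, False, 0)})"
    by (auto simp: negative_slots_def)
  then show "card {q \<in> negative_slots horo. \<not> fst q} = (if horo then 2 else 1)" by simp
qed

lemma card_positive_slots:
  "card {q \<in> positive_slots N. fst q} = 0"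
  "card {q \<in> positive_slots N. \<not> fst q} = 2 * N"
proof -
  have "{q \<in> positive_slots N. fst q} = {}" "{q \<in> positive_slots N. \<not> fst q} = positive_slots N"
    by (auto simp: positive_slots_def)
  then show "card {q \<in> positive_slots N. fst q} = 0" "card {q \<in> positive_slots N. \<not> fst q} = 2 * N"
    by (simp_all add: positive_slots_def card_cartesian_product)
qed

context immersed_warped_product
begin

text \<open>
  The coefficient of the squared amplitudes of a direction in the two sums over all directions, the
  squared length and the \<open>dt\<^sup>2\<close> part: the sign of the model, or 0 for a curve in the light cone.
\<close>

definition weight :: "(nat \<times> nat) set \<Rightarrow> bool \<Rightarrow> nat \<times> nat \<Rightarrow> real"
  where "weight A horo d = (if d \<in> A then if horo then 0 else - 1 else 1)"

definition slots where "slots A horo N d = (if d \<in> A then negative_slots horo else positive_slots N)"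

definition norm2 :: "(nat \<times> nat \<Rightarrow> bool \<Rightarrow> real \<Rightarrow> real) \<Rightarrow> nat \<times> nat \<Rightarrow> real \<Rightarrow> real"
  where "norm2 v d t = (\<Sum>b\<in>UNIV. (v d b t)\<^sup>2)"

definition speed2 :: "(nat \<times> nat \<Rightarrow> bool \<Rightarrow> real \<Rightarrow> real) \<Rightarrow> nat \<times> nat \<Rightarrow> real \<Rightarrow> real"
  where "speed2 v d t = (\<Sum>b\<in>UNIV. (deriv (v d b) t)\<^sup>2)"

text \<open>
  The part of the construction that does not depend on the target: a model with amplitudes \<open>v\<close> for each
  flat direction, such that all directions outside \<open>A\<close> together use up less than half of \<open>\<rho>\<^sup>2\<close> and less
  than half of the squared length \<open>1/c\<close> of a quadric.
\<close>

definition flat_system where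
  "flat_system A horo N c G v \<longleftrightarrow> (\<forall>d\<in>D. \<forall>b. smooth1 I (v d b)) \<and>
    (\<forall>d\<in>D. warped_line I (\<eta> (fst d)) (slots A horo N d) (G d)
      (\<lambda>t. weight A horo d * speed2 v d t) (\<lambda>t. weight A horo d * norm2 v d t)) \<and>
    (\<forall>t\<in>I. (\<Sum>d\<in>D - A. norm2 v d t) < 1 / (2 * c) \<and> (\<Sum>d\<in>D - A. speed2 v d t) < (\<rho> t)\<^sup>2 / 2)"

lemma small_total:
  assumes A: "A \<subseteq> D" and e: "e > 0" and w: "\<And>d. d \<in> D - A \<Longrightarrow> w d < e / (real (card D) + 1)"
  shows "(\<Sum>d\<in>D - A. w d) < (e :: real)"
proof -
  have "(\<Sum>d\<in>D - A. w d) \<le> (\<Sum>d\<in>D - A. e / (real (card D) + 1))"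
    by (intro sum_mono less_imp_le w)
  also have "\<dots> = real (card (D - A)) * (e / (real (card D) + 1))" by simp
  also have "\<dots> \<le> real (card D) * (e / (real (card D) + 1))"
    using e card_mono[OF finite_D, of "D - A"] by (intro mult_right_mono) auto
  also have "\<dots> < e" using e by (simp add: field_simps)
  finally show ?thesis .
qed

lemma sum_weighted:
  assumes A: "A \<subseteq> D"
  shows "(\<Sum>d\<in>D. (if d \<in> A then x else 1) * w d) = x * (\<Sum>d\<in>A. w d) + (\<Sum>d\<in>D - A. w d :: real)"
proof -
  have "(\<Sum>d\<in>D. (if d \<in> A then x else 1) * w d) = (\<Sum>d\<in>D. if d \<in> A then x * w d else w d)"
    by (intro sum.cong refl) simp
  then show ?thesis
    using A finite_D by (simp add: sum.If_cases Int_absorb1 Diff_eq sum_distrib_left)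
qed

lemma sum_weight:
  assumes A: "A \<subseteq> D"
  shows "(\<Sum>d\<in>D. weight A horo d * w d) =
    (if horo then 0 else - (\<Sum>d\<in>A. w d)) + (\<Sum>d\<in>D - A. w d)"
proof -
  have "(\<Sum>d\<in>D. weight A horo d * w d) = (\<Sum>d\<in>D. (if d \<in> A then if horo then 0 else - 1 else 1) * w d)"
    by (intro sum.cong refl) (simp add: weight_def)
  then show ?thesis unfolding sum_weighted[OF A] by simp
qed

text \<open>
  The bound for one direction; the factor \<open>card D + 1\<close> turns it into a bound for the sum over all of them.
\<close>

definition tolerance where "tolerance c t = min (1 / (2 * c)) ((\<rho> t)\<^sup>2 / 2) / (real (card D) + 1)"

lemma tolerance_props:
  assumes "c > 0"
  shows "continuous_on I (tolerance c)" "\<forall>t\<in>I. tolerance c t > 0"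
    "A \<subseteq> D \<Longrightarrow> t \<in> I \<Longrightarrow> (\<And>d. d \<in> D - A \<Longrightarrow> w d < tolerance c t) \<Longrightarrow> (\<Sum>d\<in>D - A. w d) < 1 / (2 * c)"
    "A \<subseteq> D \<Longrightarrow> t \<in> I \<Longrightarrow> (\<And>d. d \<in> D - A \<Longrightarrow> w d < tolerance c t) \<Longrightarrow> (\<Sum>d\<in>D - A. w d) < (\<rho> t)\<^sup>2 / 2"
proof -
  show "continuous_on I (tolerance c)"
    unfolding tolerance_def[abs_def] by (intro continuous_intros smooth1_continuous_on \<rho>(1)) auto
  have pos: "min (1 / (2 * c)) ((\<rho> t)\<^sup>2 / 2) > 0" if "t \<in> I" for t
    using assms \<rho>(2)[OF that] by simp
  then show "\<forall>t\<in>I. tolerance c t > 0"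
    unfolding tolerance_def by (intro ballI divide_pos_pos) auto
  show "A \<subseteq> D \<Longrightarrow> t \<in> I \<Longrightarrow> (\<And>d. d \<in> D - A \<Longrightarrow> w d < tolerance c t) \<Longrightarrow> (\<Sum>d\<in>D - A. w d) < 1 / (2 * c)"
    "A \<subseteq> D \<Longrightarrow> t \<in> I \<Longrightarrow> (\<And>d. d \<in> D - A \<Longrightarrow> w d < tolerance c t) \<Longrightarrow> (\<Sum>d\<in>D - A. w d) < (\<rho> t)\<^sup>2 / 2"
    using small_total[OF _ pos, of A t w] unfolding tolerance_def by fastforce+
qed

text \<open>
  The two amplitudes \<open>v\<close> of a direction are \<open>\<eta>\<close> and 0 if it lies in \<open>A\<close>, and those of Blanusa's model
  otherwise.
\<close>

lemma flat_system_exists: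
  assumes A: "A \<subseteq> D" and \<sigma>: "unit_sphere_curve N \<sigma>" and c: "c > 0"
  obtains G v where "flat_system A horo N c G v"
    "recovers_parameter UNIV {..<N} \<sigma> \<longrightarrow> (\<forall>d\<in>D. recovers_line I (slots A horo N d) (G d))"
proof -
  define good where "good d \<phi>S \<longleftrightarrow> (\<forall>b. smooth1 I (fst \<phi>S b)) \<and> (\<forall>b t. snd \<phi>S b t > 0) \<and>
      (\<forall>b. locally_zero_or_const I (fst \<phi>S b) (snd \<phi>S b)) \<and>
      (\<forall>t\<in>I. (\<Sum>b\<in>UNIV. (fst \<phi>S b t)\<^sup>2 * (snd \<phi>S b t)\<^sup>2) = (\<eta> (fst d) t)\<^sup>2) \<and>
      (\<forall>t\<in>I. (\<Sum>b\<in>UNIV. (fst \<phi>S b t)\<^sup>2) < tolerance c t) \<and> (\<forall>t\<in>I. (\<Sum>b\<in>UNIV. (deriv (fst \<phi>S b) t)\<^sup>2) < tolerance c t)"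
    for d :: "nat \<times> nat" and \<phi>S :: "(bool \<Rightarrow> real \<Rightarrow> real) \<times> (bool \<Rightarrow> real \<Rightarrow> real)"
  have "\<forall>d\<in>D. \<exists>\<phi>S. good d \<phi>S"
  proof
    fix d assume "d \<in> D"
    then have l: "fst d \<in> {1..k}" by (auto simp: D_def)
    show "\<exists>\<phi>S. good d \<phi>S"
    proof (rule blanusa_amplitudes[OF I \<eta>(1)[OF l] _ tolerance_props(1)[OF c]])
      fix \<phi> S :: "bool \<Rightarrow> real \<Rightarrow> real"
      assume *: "\<And>b. smooth1 I (\<phi> b)" "\<And>b t. S b t > 0" "\<And>b. locally_zero_or_const I (\<phi> b) (S b)"
        "\<And>t. t \<in> I \<Longrightarrow> (\<Sum>b\<in>UNIV. (\<phi> b t)\<^sup>2 * (S b t)\<^sup>2) = (\<eta> (fst d) t)\<^sup>2"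
        "\<And>t. t \<in> I \<Longrightarrow> (\<Sum>b\<in>UNIV. (\<phi> b t)\<^sup>2) < tolerance c t"
        "\<And>t. t \<in> I \<Longrightarrow> (\<Sum>b\<in>UNIV. (deriv (\<phi> b) t)\<^sup>2) < tolerance c t"
      show ?thesis by (rule exI[of _ "(\<phi>, S)"]) (use * in \<open>simp add: good_def\<close>)
    qed (use \<eta>(2)[OF l] tolerance_props(2)[OF c] in auto)
  qed
  from bchoice[OF this] obtain \<phi>S where \<phi>S: "\<forall>d\<in>D. good d (\<phi>S d)" ..
  define \<phi> where "\<phi> d = fst (\<phi>S d)" for d
  define S where "S d = snd (\<phi>S d)" for d
  have \<phi>: "smooth1 I (\<phi> d b)" "S d b t > 0" "locally_zero_or_const I (\<phi> d b) (S d b)" if "d \<in> D" for d b t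
    using bspec[OF \<phi>S that] unfolding good_def \<phi>_def S_def by blast+
  have \<phi>t: "(\<Sum>b\<in>UNIV. (\<phi> d b t)\<^sup>2 * (S d b t)\<^sup>2) = (\<eta> (fst d) t)\<^sup>2"
    "(\<Sum>b\<in>UNIV. (\<phi> d b t)\<^sup>2) < tolerance c t" "(\<Sum>b\<in>UNIV. (deriv (\<phi> d b) t)\<^sup>2) < tolerance c t" if "d \<in> D" "t \<in> I" for d t
    using bspec[OF \<phi>S that(1)] that(2) unfolding good_def \<phi>_def S_def by blast+
  define v where "v d b = (if d \<in> A then if b then \<eta> (fst d) else (\<lambda>_. 0) else \<phi> d b)" for d b
  define G where "G d = (if d \<in> A then if horo then horospheric_line (\<eta> (fst d)) else hyperbolic_line (\<eta> (fst d))
    else blanusa_line \<sigma> (\<phi> d) (S d))" for d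
  have l: "fst d \<in> {1..k}" if "d \<in> D" for d using that by (auto simp: D_def)
  have "warped_line I (\<eta> (fst d)) (slots A horo N d) (G d)
      (\<lambda>t. weight A horo d * speed2 v d t) (\<lambda>t. weight A horo d * norm2 v d t)"
    if d: "d \<in> D" for d
  proof (cases "d \<in> A")
    case True
    have vs: "norm2 v d t = (\<eta> (fst d) t)\<^sup>2" "speed2 v d t = (deriv (\<eta> (fst d)) t)\<^sup>2" for t
      by (simp_all add: norm2_def speed2_def v_def True UNIV_bool)
    from True show ?thesis
      using warped_line_horospheric[OF I(1) \<eta>(1)[OF l[OF d]], of "0 :: nat"]
        warped_line_hyperbolic[OF I(1) \<eta>(1)[OF l[OF d]], of "(False, 0 :: nat)"]
      by (simp add: slots_def negative_slots_def G_def weight_def vs)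
  next
    case False
    have "warped_line I (\<eta> (fst d)) ({False} \<times> UNIV \<times> {..<N}) (blanusa_line \<sigma> (\<phi> d) (S d))
      (\<lambda>t. \<Sum>b\<in>UNIV. (deriv (\<phi> d b) t)\<^sup>2) (\<lambda>t. \<Sum>b\<in>UNIV. (\<phi> d b t)\<^sup>2)"
      by (rule warped_line_blanusa[OF \<sigma> \<phi>(1)[OF d] \<phi>(3)[OF d] \<phi>t(1)[OF d]])
    then show ?thesis using False by (simp add: slots_def positive_slots_def G_def v_def weight_def norm2_def speed2_def)
  qed
  moreover have "recovers_line I (slots A horo N d) (G d)" if \<sigma>: "recovers_parameter UNIV {..<N} \<sigma>" and d: "d \<in> D" for d
  proof (cases "d \<in> A")
    case True
    then show ?thesis
      using recovers_line_horospheric[OF I(1) \<eta>(1)[OF l[OF d]] \<eta>(2)[OF l[OF d]], of "0 :: nat"]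
        recovers_line_hyperbolic[OF I(1) \<eta>(1)[OF l[OF d]] \<eta>(2)[OF l[OF d]], of "(False, 0 :: nat)"]
      by (simp add: slots_def negative_slots_def G_def)
  next
    case False
    have "recovers_line I ({False} \<times> UNIV \<times> {..<N}) (blanusa_line \<sigma> (\<phi> d) (S d))"
      by (rule recovers_line_blanusa[OF I(1) \<sigma> \<phi>(1)[OF d] \<phi>(3)[OF d] \<phi>(2)[OF d] \<phi>t(1)[OF d] \<eta>(2)[OF l[OF d]]])
    then show ?thesis using False by (simp add: slots_def positive_slots_def G_def)
  qed
  moreover have "smooth1 I (v d b)" if "d \<in> D" for d b
    using \<phi>(1)[OF that] \<eta>(1)[OF l[OF that]] by (simp add: v_def)
  moreover have "(\<Sum>d\<in>D - A. norm2 v d t) < 1 / (2 * c)" "(\<Sum>d\<in>D - A. speed2 v d t) < (\<rho> t)\<^sup>2 / 2"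
    if t: "t \<in> I" for t
    by (rule tolerance_props(3)[OF c A t], use \<phi>t(2) t in \<open>simp add: norm2_def v_def\<close>)
      (rule tolerance_props(4)[OF c A t], use \<phi>t(3) t in \<open>simp add: speed2_def v_def\<close>)
  ultimately show thesis using that[of G v] by (simp add: flat_system_def)
qed

text \<open>What is left of \<open>\<rho>\<^sup>2 dt\<^sup>2\<close> for a profile curve once the flat directions have taken their share.\<close>

definition residual where "residual A horo v t = (\<rho> t)\<^sup>2 - (\<Sum>d\<in>D. weight A horo d * speed2 v d t)"

lemma norm2_nonneg: "norm2 v d t \<ge> 0" and speed2_nonneg: "speed2 v d t \<ge> 0"
  by (auto simp: norm2_def speed2_def intro: sum_nonneg)

lemma flat_system_smooth:
  assumes "flat_system A horo N c G v"
  shows "smooth1 I (residual A horo v)" "smooth1 I (\<lambda>t. \<Sum>d\<in>D. weight A horo d * norm2 v d t)"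
proof -
  have v: "smooth1 I (v d b)" if "d \<in> D" for d b
    using assms that by (simp add: flat_system_def)
  show "smooth1 I (residual A horo v)" "smooth1 I (\<lambda>t. \<Sum>d\<in>D. weight A horo d * norm2 v d t)"
    unfolding residual_def[abs_def] norm2_def speed2_def
    by (intro smooth1_diff smooth1_power smooth1_sum smooth1_mult smooth1_const smooth1_deriv I(1) \<rho>(1) v;
        assumption)+
qed

lemma residual_eq:
  "A \<subseteq> D \<Longrightarrow> residual A horo v t =
    (\<rho> t)\<^sup>2 + (if horo then 0 else \<Sum>d\<in>A. speed2 v d t) - (\<Sum>d\<in>D - A. speed2 v d t)"
  by (simp add: residual_def sum_weight)

lemma residual_pos:
  assumes A: "A \<subseteq> D" and v: "flat_system A horo N c G v" and t: "t \<in> I"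
  shows "residual A horo v t > 0"
proof -
  have "(\<Sum>d\<in>D - A. speed2 v d t) < (\<rho> t)\<^sup>2 / 2" using v t by (simp add: flat_system_def)
  moreover have "(\<Sum>d\<in>A. speed2 v d t) \<ge> 0" by (intro sum_nonneg speed2_nonneg)
  moreover have "(\<rho> t)\<^sup>2 \<ge> 0" by simp
  ultimately show ?thesis
    unfolding residual_eq[OF A] by (cases horo; simp only: if_True if_False; linarith)
qed

abbreviation all_embeddings where
  "all_embeddings \<equiv> \<forall>l\<in>{1..k}. embedding_map (mtop (M l)) (Euclidean_space (m l)) (f l)"

text \<open>
  The flat directions and a profile curve for the residual metric together, with the count of
  negative and positive coordinates.
\<close>

lemma coordinate_isometry_exists:
  fixes Q0 :: "(bool \<times> bool \<times> nat) set"
  assumes A: "A \<subseteq> D" and sys: "flat_system A horo N c G v"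
    and prof: "profile_curve I (residual A horo v) Q0 u R0"
    and neg: "card {q \<in> Q0. fst q} + card A \<le> b"
    and pos: "card {q \<in> Q0. \<not> fst q} + card A * (if horo then 2 else 1) + (card D - card A) * (2 * N) \<le> n - b"
    and b: "b \<le> n"
  obtains F where "coordinate_isometry W n b F"
    "\<forall>z\<in>topspace (mtop W). semi_inner n b (F z) (F z) = R0 (fst z) + (\<Sum>d\<in>D. weight A horo d * norm2 v d (fst z))"
    "recovers_parameter I Q0 u \<and> (\<forall>d\<in>D. recovers_line I (slots A horo N d) (G d)) \<and> all_embeddings \<longrightarrow>
      embedding_map (mtop W) (Euclidean_space n) F"
proof -
  define P where "P d t = weight A horo d * speed2 v d t" for d t
  define R where "R d t = weight A horo d * norm2 v d t" for d t
  have line: "warped_line I (\<eta> (fst d)) (slots A horo N d) (G d) (P d) (R d)" if "d \<in> D" for d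
    using sys that unfolding flat_system_def P_def[abs_def] R_def[abs_def] by blast
  have g: "residual A horo v t + (\<Sum>d\<in>D. P d t) = (\<rho> t)\<^sup>2" for t by (simp add: residual_def P_def)
  define Q where "Q = case_option Q0 (slots A horo N)"
  have Q: "Q None = Q0" "Q (Some d) = slots A horo N d" for d by (simp_all add: Q_def)
  let ?R = "index_set (insert None (Some ` D)) Q"
  have fin: "finite (Q None)" "\<And>d. finite (Q (Some d))"
    using prof by (simp_all add: Q profile_curve_def slots_def negative_slots_def positive_slots_def)
  have iso: "signed_isometry W ?R (coords G u)"
    by (rule signed_isometry_coords(1)[where P = P and R = R and g = "residual A horo v" and ?R0.0 = R0])
      (use line prof g in \<open>simp_all add: Q\<close>)
  have norm: "(\<Sum>r\<in>?R. signature r * (coords G u r z)\<^sup>2) = R0 (fst z) + (\<Sum>d\<in>D. R d (fst z))"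
    if "z \<in> topspace (mtop W)" for z
    by (rule signed_isometry_coords(2)[where P = P and R = R and g = "residual A horo v" and ?R0.0 = R0])
      (use line prof g that in \<open>simp_all add: Q\<close>)
  have cards: "card {r \<in> ?R. fst r} \<le> b" "card {r \<in> ?R. \<not> fst r} \<le> n - b"
  proof -
    have "(\<Sum>d\<in>D. card {q \<in> Q (Some d). fst q}) = (\<Sum>d\<in>D. if d \<in> A then 1 else 0)"
      by (intro sum.cong refl) (simp add: Q slots_def card_negative_slots card_positive_slots)
    then have "(\<Sum>d\<in>D. card {q \<in> Q (Some d). fst q}) = card A"
      by (simp add: sum_if_subset[OF finite_D A])
    then show "card {r \<in> ?R. fst r} \<le> b"
      using neg card_index_set[where Q = Q and T = "\<lambda>x. x", OF finite_D fin] by (simp add: Q)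
    have "(\<Sum>d\<in>D. card {q \<in> Q (Some d). \<not> fst q}) = (\<Sum>d\<in>D. if d \<in> A then if horo then 2 else 1 else 2 * N)"
      by (intro sum.cong refl) (simp add: Q slots_def card_negative_slots card_positive_slots)
    then have "(\<Sum>d\<in>D. card {q \<in> Q (Some d). \<not> fst q}) = card A * (if horo then 2 else 1) + (card D - card A) * (2 * N)"
      by (simp only: sum_if_subset[OF finite_D A])
    then show "card {r \<in> ?R. \<not> fst r} \<le> n - b"
      using pos card_index_set[where Q = Q and T = Not, OF finite_D fin] by (simp add: Q)
  qed
  obtain F where F: "coordinate_isometry W n b F"
    "\<forall>z. semi_inner n b (F z) (F z) = (\<Sum>r\<in>?R. signature r * (coords G u r z)\<^sup>2)"
    "\<forall>r\<in>?R. \<exists>s. \<forall>z. F z s = coords G u r z"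
    by (rule coordinate_isometry_of_signed[OF iso cards b])
  show thesis
  proof (rule that[OF F(1)])
    show "\<forall>z\<in>topspace (mtop W). semi_inner n b (F z) (F z) = R0 (fst z) + (\<Sum>d\<in>D. weight A horo d * norm2 v d (fst z))"
      unfolding R_def[symmetric]
      by (intro ballI) (simp only: F(2)[rule_format] norm)
    show "recovers_parameter I Q0 u \<and> (\<forall>d\<in>D. recovers_line I (slots A horo N d) (G d)) \<and> all_embeddings \<longrightarrow>
      embedding_map (mtop W) (Euclidean_space n) F"
    proof (intro impI embedding_map_of_recovery[OF coordinate_isometry_continuous[OF F(1)] Hausdorff_W])
      fix z0 L
      assume rec: "recovers_parameter I Q0 u \<and> (\<forall>d\<in>D. recovers_line I (slots A horo N d) (G d)) \<and> all_embeddings"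
        and z0: "z0 \<in> topspace (mtop W)" and ev: "\<forall>\<^sub>F z in L. z \<in> topspace (mtop W)"
        and lim: "\<And>s. ((\<lambda>z. F z s) \<longlongrightarrow> F z0 s) L"
      show "limitin (mtop W) (\<lambda>z. z) z0 L"
      proof (rule coords_recover[where Q = Q and G = G and u = u])
        show "(coords G u r \<longlongrightarrow> coords G u r z0) L" if r: "r \<in> ?R" for r
        proof -
          obtain s where "\<forall>z. F z s = coords G u r z" using F(3) r by blast
          then have "coords G u r = (\<lambda>z. F z s)" by auto
          then show ?thesis using lim[of s] by simp
        qed
      qed (use rec z0 ev in \<open>auto simp: Q\<close>)
    qed
  qed
qed

lemma isometric_embeddingI:
  "isometric_immersion X Z F \<Longrightarrow> embedding_map (mtop X) (mtop Z) F \<Longrightarrow> isometric_embedding X Z F"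
  by (simp add: isometric_embedding_def embedding_def isometric_immersion_def)

theorem semi_euclidean_target:
  assumes A: "A \<subseteq> D" and \<sigma>: "unit_sphere_curve N \<sigma>"
    and n: "card A + (card A + (card D - card A) * (2 * N) + 1) \<le> n"
  shows "\<exists>F. isometric_immersion W (semi_euclidean n (card A)) F \<and>
    (recovers_parameter UNIV {..<N} \<sigma> \<and> all_embeddings \<longrightarrow> isometric_embedding W (semi_euclidean n (card A)) F)"
proof -
  have c1: "(1 :: real) > 0" by simp
  obtain G v where sys: "flat_system A False N 1 G v"
    and rec: "recovers_parameter UNIV {..<N} \<sigma> \<longrightarrow> (\<forall>d\<in>D. recovers_line I (slots A False N d) (G d))"
    by (rule flat_system_exists[where horo = False, OF A \<sigma> c1])
  let ?Q0 = "{(False, False, 0 :: nat)}"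
  obtain u R0 where u: "profile_curve I (residual A False v) ?Q0 u R0" "recovers_parameter I ?Q0 u"
    using profile_curve_line[OF I flat_system_smooth(1)[OF sys], of "(False, 0 :: nat)"] residual_pos[OF A sys]
    by blast
  have cs: "{q \<in> ?Q0. fst q} = {}" "{q \<in> ?Q0. \<not> fst q} = ?Q0" by auto
  have cards: "card {q \<in> ?Q0. fst q} + card A \<le> card A"
    "card {q \<in> ?Q0. \<not> fst q} + card A * (if False then 2 else 1) + (card D - card A) * (2 * N) \<le> n - card A"
    "card A \<le> n"
    unfolding cs using n by auto
  obtain F where F: "coordinate_isometry W n (card A) F"
    "recovers_parameter I ?Q0 u \<and> (\<forall>d\<in>D. recovers_line I (slots A False N d) (G d)) \<and> all_embeddings \<longrightarrow>
      embedding_map (mtop W) (Euclidean_space n) F"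
    by (rule coordinate_isometry_exists[OF A sys u(1) cards])
  have imm: "isometric_immersion W (semi_euclidean n (card A)) F"
    by (rule isometric_immersion_semi_euclidean[OF F(1) cards(3) definite_W])
  moreover have "isometric_embedding W (semi_euclidean n (card A)) F"
    if "recovers_parameter UNIV {..<N} \<sigma> \<and> all_embeddings"
    using F(2) u(2) rec that by (intro isometric_embeddingI[OF imm]) simp
  ultimately show ?thesis by blast
qed

lemma quadric_target:
  assumes F: "coordinate_isometry W (Suc n) b F" and b: "b \<le> Suc n"
    and q: "\<And>z. z \<in> topspace (mtop W) \<Longrightarrow> semi_inner (Suc n) b (F z) (F z) = q"
    and emb: "H \<longrightarrow> embedding_map (mtop W) (Euclidean_space (Suc n)) F"
  shows "isometric_immersion W (hyperquadric n b q) F \<and> (H \<longrightarrow> isometric_embedding W (hyperquadric n b q) F)"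
proof -
  have imm: "isometric_immersion W (hyperquadric n b q) F"
    by (rule isometric_immersion_hyperquadric[OF F b definite_W open_charts_W q])
  moreover have "F ` topspace (mtop W) \<subseteq> quadric n b q"
    using F q by (auto simp: quadric_def topspace_Euclidean_space coordinate_isometry_def)
  then have "H \<longrightarrow> embedding_map (mtop W) (mtop (hyperquadric n b q)) F"
    using emb by (simp add: embedding_map_in_subtopology)
  ultimately show ?thesis using isometric_embeddingI by blast
qed

text \<open>
  In the sphere the squared length \<open>1/c - \<Sum> weight * norm2\<close> is left for the profile curve
  \<open>r \<sigma>(\<theta>)\<close>, and its radial part costs \<open>r'\<^sup>2\<close>. The fixed amplitudes \<open>\<eta>\<close> are not small, so \<open>r'\<close> need not be
  small either. But \<open>r\<^sup>2\<close> is at least the sum of the squares of all amplitudes, hence by Cauchy-Schwarz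
  \<open>r'\<^sup>2\<close> is at most the sum of the squares of their derivatives, and of these the share of \<open>A\<close> is
  returned by the negative coordinates.
\<close>

theorem pseudo_sphere_target:
  assumes A: "A \<subseteq> D" and \<sigma>: "unit_sphere_curve N \<sigma>" and c: "c > 0"
    and n: "card A + (card A + (card D - card A) * (2 * N) + N) \<le> Suc n"
  shows "\<exists>F. isometric_immersion W (pseudo_sphere n (card A) c) F \<and>
    (recovers_parameter UNIV {..<N} \<sigma> \<and> all_embeddings \<longrightarrow> isometric_embedding W (pseudo_sphere n (card A) c) F)"
proof -
  let ?B = "UNIV :: bool set"
  obtain G v where sys: "flat_system A False N c G v"
    and rec: "recovers_parameter UNIV {..<N} \<sigma> \<longrightarrow> (\<forall>d\<in>D. recovers_line I (slots A False N d) (G d))"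
    by (rule flat_system_exists[where horo = False, OF A \<sigma> c])
  define E where "E t = 1 / c - (\<Sum>d\<in>D. weight A False d * norm2 v d t)" for t
  define r where "r t = sqrt (E t)" for t
  have sE: "smooth1 I E"
    unfolding E_def[abs_def] by (intro smooth1_diff smooth1_const flat_system_smooth(2)[OF sys])
  have split: "(\<Sum>d\<in>D. w d) = (\<Sum>d\<in>A. w d) + (\<Sum>d\<in>D - A. w d)" for w :: "nat \<times> nat \<Rightarrow> real"
    using sum.subset_diff[OF A finite_D, of w] by simp
  have small: "(\<Sum>d\<in>D - A. norm2 v d t) < 1 / (2 * c)" "(\<Sum>d\<in>D - A. speed2 v d t) < (\<rho> t)\<^sup>2 / 2" if "t \<in> I" for t
    using sys that by (simp_all add: flat_system_def)
  have E_ge: "(\<Sum>d\<in>D. norm2 v d t) \<le> E t" and Epos: "E t > 0" if t: "t \<in> I" for t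
  proof -
    have "E t = 1 / c + (\<Sum>d\<in>A. norm2 v d t) - (\<Sum>d\<in>D - A. norm2 v d t)"
      by (simp add: E_def sum_weight[OF A])
    moreover have "1 / c = 2 * (1 / (2 * c))" by simp
    moreover have "(\<Sum>d\<in>A. norm2 v d t) \<ge> 0" "(\<Sum>d\<in>D - A. norm2 v d t) \<ge> 0"
      using norm2_nonneg by (auto intro: sum_nonneg)
    ultimately show "(\<Sum>d\<in>D. norm2 v d t) \<le> E t" "E t > 0"
      using small(1)[OF t] unfolding split by linarith+
  qed
  have sr: "smooth1 I r" unfolding r_def[abs_def] by (rule smooth1_sqrt[OF sE Epos])
  have rpos: "r t > 0" if "t \<in> I" for t using Epos[OF that] by (simp add: r_def)
  have gr: "residual A False v t - (deriv r t)\<^sup>2 > 0" if t: "t \<in> I" for t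
  proof -
    let ?X = "\<lambda>z. weight A False (fst z) * v (fst z) (snd z) t"
    let ?Y = "\<lambda>z. deriv (v (fst z) (snd z)) t"
    have "(E has_real_derivative 0 - (\<Sum>d\<in>D. weight A False d * (\<Sum>b\<in>?B. 2 * (v d b t * deriv (v d b) t)))) (at t)"
      unfolding E_def[abs_def] norm2_def
    proof (intro DERIV_diff DERIV_const DERIV_sum DERIV_cmult)
      fix d b assume "d \<in> D"
      then have "(v d b has_real_derivative deriv (v d b) t) (at t)"
        using sys t smooth1_DERIV unfolding flat_system_def by blast
      from DERIV_power[OF this, of 2]
      show "((\<lambda>t. (v d b t)\<^sup>2) has_real_derivative 2 * (v d b t * deriv (v d b) t)) (at t)"
        by (simp add: mult_ac)
    qed
    moreover have "(\<Sum>d\<in>D. weight A False d * (\<Sum>b\<in>?B. 2 * (v d b t * deriv (v d b) t))) =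
        2 * (\<Sum>z\<in>D \<times> ?B. ?X z * ?Y z)"
      by (simp add: sum.cartesian_product' sum_distrib_left mult_ac)
    ultimately have dE: "(E has_real_derivative - 2 * (\<Sum>z\<in>D \<times> ?B. ?X z * ?Y z)) (at t)" by simp
    have "deriv r t = inverse (sqrt (E t)) / 2 * (- 2 * (\<Sum>z\<in>D \<times> ?B. ?X z * ?Y z))"
      unfolding r_def[abs_def] by (rule DERIV_imp_deriv[OF DERIV_chain2[OF DERIV_real_sqrt[OF Epos[OF t]] dE]])
    then have dr: "deriv r t = - (\<Sum>z\<in>D \<times> ?B. ?X z * ?Y z) / sqrt (E t)"
      by (simp add: inverse_eq_divide)
    have "(\<Sum>z\<in>D \<times> ?B. ?X z * ?Y z)\<^sup>2 \<le> (\<Sum>z\<in>D \<times> ?B. (?X z)\<^sup>2) * (\<Sum>z\<in>D \<times> ?B. (?Y z)\<^sup>2)"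
      by (rule Cauchy_Schwarz_ineq_sum)
    moreover have "(weight A False d)\<^sup>2 = 1" for d by (simp add: weight_def)
    then have "(\<Sum>z\<in>D \<times> ?B. (?X z)\<^sup>2) = (\<Sum>d\<in>D. norm2 v d t)"
      by (simp add: sum.cartesian_product' norm2_def power_mult_distrib)
    moreover have "(\<Sum>z\<in>D \<times> ?B. (?Y z)\<^sup>2) = (\<Sum>d\<in>D. speed2 v d t)"
      by (simp add: sum.cartesian_product' speed2_def)
    ultimately have "(\<Sum>z\<in>D \<times> ?B. ?X z * ?Y z)\<^sup>2 \<le> (\<Sum>d\<in>D. norm2 v d t) * (\<Sum>d\<in>D. speed2 v d t)" by simp
    also have "\<dots> \<le> E t * (\<Sum>d\<in>D. speed2 v d t)"
      using E_ge[OF t] speed2_nonneg by (intro mult_right_mono sum_nonneg) auto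
    finally have "(deriv r t)\<^sup>2 \<le> (\<Sum>d\<in>D. speed2 v d t)"
      using Epos[OF t] by (simp add: dr power_divide field_simps)
    moreover have "residual A False v t = (\<rho> t)\<^sup>2 + (\<Sum>d\<in>A. speed2 v d t) - (\<Sum>d\<in>D - A. speed2 v d t)"
      by (simp add: residual_eq[OF A])
    ultimately show ?thesis using small(2)[OF t] unfolding split by linarith
  qed
  let ?Q0 = "{False} \<times> {False} \<times> {..<N}"
  obtain u where u: "profile_curve I (residual A False v) ?Q0 u (\<lambda>t. (r t)\<^sup>2)"
    "recovers_parameter UNIV {..<N} \<sigma> \<longrightarrow> recovers_parameter I ?Q0 u"
    using profile_curve_spherical[OF I flat_system_smooth(1)[OF sys] \<sigma> sr, of False] rpos gr by blast
  have "{q \<in> ?Q0. fst q} = {}" "{q \<in> ?Q0. \<not> fst q} = ?Q0" by auto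
  then have cs: "card {q \<in> ?Q0. fst q} = 0" "card {q \<in> ?Q0. \<not> fst q} = N" by (simp_all add: card_cartesian_product)
  have cards: "card {q \<in> ?Q0. fst q} + card A \<le> card A"
    "card {q \<in> ?Q0. \<not> fst q} + card A * (if False then 2 else 1) + (card D - card A) * (2 * N) \<le> Suc n - card A"
    "card A \<le> Suc n"
    unfolding cs using n by auto
  obtain F where F: "coordinate_isometry W (Suc n) (card A) F"
    "\<forall>z\<in>topspace (mtop W). semi_inner (Suc n) (card A) (F z) (F z) =
      (r (fst z))\<^sup>2 + (\<Sum>d\<in>D. weight A False d * norm2 v d (fst z))"
    "recovers_parameter I ?Q0 u \<and> (\<forall>d\<in>D. recovers_line I (slots A False N d) (G d)) \<and> all_embeddings \<longrightarrow>
      embedding_map (mtop W) (Euclidean_space (Suc n)) F"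
    by (rule coordinate_isometry_exists[OF A sys u(1) cards])
  have q: "semi_inner (Suc n) (card A) (F z) (F z) = 1 / c" if z: "z \<in> topspace (mtop W)" for z
  proof -
    have "fst z \<in> I" using z by (auto simp: mtop_W)
    then have "(r (fst z))\<^sup>2 = E (fst z)" using Epos[of "fst z"] by (simp add: r_def)
    then show ?thesis using F(2) z by (simp add: E_def)
  qed
  have "recovers_parameter UNIV {..<N} \<sigma> \<and> all_embeddings \<longrightarrow> embedding_map (mtop W) (Euclidean_space (Suc n)) F"
    using F(3) u(2) rec by simp
  from quadric_target[OF F(1) cards(3) q this] show ?thesis unfolding pseudo_sphere_def by blast
qed

text \<open>
  The horospheric model contributes neither to \<open>dt\<^sup>2\<close> nor to the squared length, so \<open>r\<^sup>2 = 1/c\<close> plus the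
  small amplitudes is always positive, and the radial part of the profile curve counts in favour of
  the residual metric.
\<close>

theorem pseudo_hyperbolic_target:
  assumes A: "A \<subseteq> D" and \<sigma>: "unit_sphere_curve N \<sigma>" and c: "c > 0"
    and n: "Suc (card A) + (card A * 2 + (card D - card A) * (2 * N) + 1) \<le> Suc n"
  shows "\<exists>F. isometric_immersion W (pseudo_hyperbolic n (card A) c) F \<and>
    (recovers_parameter UNIV {..<N} \<sigma> \<and> all_embeddings \<longrightarrow> isometric_embedding W (pseudo_hyperbolic n (card A) c) F)"
proof -
  obtain G v where sys: "flat_system A True N c G v"
    and rec: "recovers_parameter UNIV {..<N} \<sigma> \<longrightarrow> (\<forall>d\<in>D. recovers_line I (slots A True N d) (G d))"
    by (rule flat_system_exists[where horo = True, OF A \<sigma> c])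
  define E where "E t = 1 / c + (\<Sum>d\<in>D. weight A True d * norm2 v d t)" for t
  define r where "r t = sqrt (E t)" for t
  have sE: "smooth1 I E"
    unfolding E_def[abs_def] by (intro smooth1_add smooth1_const flat_system_smooth(2)[OF sys])
  have Epos: "E t > 0" for t
  proof -
    have "(\<Sum>d\<in>D - A. norm2 v d t) \<ge> 0" by (intro sum_nonneg norm2_nonneg)
    moreover have "1 / c > 0" using c by simp
    ultimately show ?thesis unfolding E_def sum_weight[OF A] by (simp only: if_True)
  qed
  have sr: "smooth1 I r" unfolding r_def[abs_def] by (rule smooth1_sqrt[OF sE Epos])
  have rpos: "r t > 0" for t using Epos[of t] by (simp add: r_def)
  have gr: "residual A True v t + (deriv r t)\<^sup>2 > 0" if t: "t \<in> I" for t
    using residual_pos[OF A sys t] zero_le_power2[of "deriv r t"] by linarith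
  let ?Q0 = "(UNIV :: bool set) \<times> {(False, 0 :: nat)}"
  obtain u where u: "profile_curve I (residual A True v) ?Q0 u (\<lambda>t. - (r t)\<^sup>2)" "recovers_parameter I ?Q0 u"
    using profile_curve_hyperbolic[OF I flat_system_smooth(1)[OF sys] sr, of "(False, 0 :: nat)"] rpos gr by blast
  have "{q \<in> ?Q0. fst q} = {(True, False, 0)}" "{q \<in> ?Q0. \<not> fst q} = {(False, False, 0)}" by auto
  then have cs: "card {q \<in> ?Q0. fst q} = 1" "card {q \<in> ?Q0. \<not> fst q} = 1" by simp_all
  have cards: "card {q \<in> ?Q0. fst q} + card A \<le> Suc (card A)"
    "card {q \<in> ?Q0. \<not> fst q} + card A * (if True then 2 else 1) + (card D - card A) * (2 * N)
      \<le> Suc n - Suc (card A)" "Suc (card A) \<le> Suc n"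
    unfolding cs using n by auto
  obtain F where F: "coordinate_isometry W (Suc n) (Suc (card A)) F"
    "\<forall>z\<in>topspace (mtop W). semi_inner (Suc n) (Suc (card A)) (F z) (F z) =
      - (r (fst z))\<^sup>2 + (\<Sum>d\<in>D. weight A True d * norm2 v d (fst z))"
    "recovers_parameter I ?Q0 u \<and> (\<forall>d\<in>D. recovers_line I (slots A True N d) (G d)) \<and> all_embeddings \<longrightarrow>
      embedding_map (mtop W) (Euclidean_space (Suc n)) F"
    by (rule coordinate_isometry_exists[OF A sys u(1) cards])
  have q: "semi_inner (Suc n) (Suc (card A)) (F z) (F z) = - (1 / c)" if z: "z \<in> topspace (mtop W)" for z
  proof -
    have "(r (fst z))\<^sup>2 = E (fst z)" using Epos[of "fst z"] by (simp add: r_def)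
    then show ?thesis using F(2) z by (simp add: E_def)
  qed
  have "recovers_parameter UNIV {..<N} \<sigma> \<and> all_embeddings \<longrightarrow> embedding_map (mtop W) (Euclidean_space (Suc n)) F"
    using F(3) u(2) rec by simp
  from quadric_target[OF F(1) cards(3) q this] show ?thesis unfolding pseudo_hyperbolic_def by blast
qed

end

theorem corollary1p3:
  fixes k :: nat
    and M :: "nat \<Rightarrow> ('a, 'i) metric_manifold"
    and m :: "nat \<Rightarrow> nat"
    and f :: "nat \<Rightarrow> 'a \<Rightarrow> nat \<Rightarrow> real"
    and I :: "real set"
    and \<rho> :: "real \<Rightarrow> real"
    and \<eta> :: "nat \<Rightarrow> real \<Rightarrow> real"
    and n a :: nat
    and c :: real
  assumes "k \<ge> 1"
    and "\<And>l. l \<in> {1..k} \<Longrightarrow> riemannian_manifold (M l)"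
    and "\<And>l. l \<in> {1..k} \<Longrightarrow> isometric_immersion (M l) (semi_euclidean (m l) 0) (f l)"
    and "open I" and "is_interval I"
    and "smooth_real_on I \<rho>" and "\<And>t. t \<in> I \<Longrightarrow> \<rho> t > 0"
    and "\<And>l. l \<in> {1..k} \<Longrightarrow> smooth_real_on I (\<eta> l)"
    and "\<And>l t. l \<in> {1..k} \<Longrightarrow> t \<in> I \<Longrightarrow> \<eta> l t > 0"
    and "n = (\<Sum>l=1..k. m l)"
    and "a \<le> n"
    and "c > 0"
  shows
    "((\<exists>F. isometric_immersion (warped_product I \<rho> k \<eta> M) (semi_euclidean (4*n + 1 - 2*a) a) F) \<and>
      (\<exists>F. isometric_immersion (warped_product I \<rho> k \<eta> M) (pseudo_sphere (4*n + 1 - 2*a) a c) F) \<and>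
      (\<exists>F. isometric_immersion (warped_product I \<rho> k \<eta> M) (pseudo_hyperbolic (4*n + 1 - a) a c) F))
     \<and>
     ((\<forall>l\<in>{1..k}. embedding (M l) (semi_euclidean (m l) 0) (f l)) \<longrightarrow>
      (\<exists>F. isometric_embedding (warped_product I \<rho> k \<eta> M) (semi_euclidean (8*n + 1 - 6*a) a) F) \<and>
      (\<exists>F. isometric_embedding (warped_product I \<rho> k \<eta> M) (pseudo_sphere (8*n + 3 - 6*a) a c) F) \<and>
      (\<exists>F. isometric_embedding (warped_product I \<rho> k \<eta> M) (pseudo_hyperbolic (8*n + 1 - 5*a) a c) F))"
proof -
  interpret immersed_warped_product k M m f I \<rho> \<eta>
    using assms(2-9) by unfold_locales (auto simp: riemannian_manifold_def smooth_real_on_imp_smooth1)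
  have cD: "card D = n" unfolding D_def assms(10) by simp
  then obtain A where A: "A \<subseteq> D" "card A = a"
    using assms(11) obtain_subset_with_card_n[of a D] by metis
  note circle = circle_is_unit_sphere_curve
  obtain \<sigma> where \<sigma>: "unit_sphere_curve 4 \<sigma>" "recovers_parameter UNIV {..<4} \<sigma>"
    by (rule embedded_unit_sphere_curve)
  have emb: "all_embeddings" if "\<forall>l\<in>{1..k}. embedding (M l) (semi_euclidean (m l) 0) (f l)"
    using that by (simp add: embedding_def)
  obtain e where e: "n = a + e" using assms(11) le_Suc_ex by blast
  have dims: "a + (a + (n - a) * (2 * 2) + 1) \<le> 4*n + 1 - 2*a"
    "a + (a + (n - a) * (2 * 2) + 2) \<le> Suc (4*n + 1 - 2*a)"
    "Suc a + (a * 2 + (n - a) * (2 * 2) + 1) \<le> Suc (4*n + 1 - a)"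
    "a + (a + (n - a) * (2 * 4) + 1) \<le> 8*n + 1 - 6*a"
    "a + (a + (n - a) * (2 * 4) + 4) \<le> Suc (8*n + 3 - 6*a)"
    "Suc a + (a * 2 + (n - a) * (2 * 4) + 1) \<le> Suc (8*n + 1 - 5*a)"
    unfolding e by simp_all
  note targets = semi_euclidean_target[OF A(1), unfolded cD A(2)]
    pseudo_sphere_target[OF A(1), unfolded cD A(2), OF _ assms(12)]
    pseudo_hyperbolic_target[OF A(1), unfolded cD A(2), OF _ assms(12)]
  show ?thesis
    unfolding W_def[symmetric]
  proof (intro conjI impI)
    show "\<exists>F. isometric_immersion W (semi_euclidean (4*n + 1 - 2*a) a) F"
      using targets(1)[OF circle dims(1)] by blast
    show "\<exists>F. isometric_immersion W (pseudo_sphere (4*n + 1 - 2*a) a c) F"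
      using targets(2)[OF circle dims(2)] by blast
    show "\<exists>F. isometric_immersion W (pseudo_hyperbolic (4*n + 1 - a) a c) F"
      using targets(3)[OF circle dims(3)] by blast
    assume "\<forall>l\<in>{1..k}. embedding (M l) (semi_euclidean (m l) 0) (f l)"
    note rec = conjI[OF \<sigma>(2) emb[OF this]]
    show "\<exists>F. isometric_embedding W (semi_euclidean (8*n + 1 - 6*a) a) F"
      using targets(1)[OF \<sigma>(1) dims(4)] rec by blast
    show "\<exists>F. isometric_embedding W (pseudo_sphere (8*n + 3 - 6*a) a c) F"
      using targets(2)[OF \<sigma>(1) dims(5)] rec by blast
    show "\<exists>F. isometric_embedding W (pseudo_hyperbolic (8*n + 1 - 5*a) a c) F"
      using targets(3)[OF \<sigma>(1) dims(6)] rec by blast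
  qed
qed

end
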